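(* Let $(\alpha,\beta)$ be an s-malleable deformation of tracial von Neumann algebras $M\subseteq\widetilde M$. Then for any $Q\in\mathrm{Rig}(\alpha)$ with $Q'\cap\widetilde M\subseteq M$, and any $t\in\mathbb R$, we have $$\frac1{24}\sup_{\substack{N\geq Q\\ N\in\mathrm{Rig}(\alpha)}}\epsilon_{4t}(N)\;\le\;\epsilon_{2t}(Q)\;\le\;24\inf_{\substack{N\leq Q\\ N'\cap\widetilde M\subseteq M}}\epsilon_t(N),$$ where in the supremum $N$ ranges over the $\alpha$-rigid von Neumann subalgebras of $M$ containing $Q$, and in the infimum $N$ ranges over the von Neumann subalgebras of $Q$ with $N'\cap\widetilde M\subseteq M$.
   Context: A tracial von Neumann algebra $(M,\tau)$ is a von Neumann algebra with a faithful normal tracial state $\tau$; $\|x\|_2=\tau(x^*x)^{1/2}$. Inclusions $M\subseteq\widetilde M$ of tracial von Neumann algebras are unital and trace-preserving; von Neumann subalgebras $N\leq M$ are unital. $(Q)_1$ is the (operator norm) unit ball of $Q$. $\mathrm{Aut}(\widetilde M)$ is the group of trace-preserving $*$-automorphisms of $\widetilde M$. An s-malleable deformation $(\alpha,\beta)$ of $M$ inside $\widetilde M$ consists of an action (group homomorphism) $\alpha:\mathbb R\to\mathrm{Aut}(\widetilde M)$ with $\|\alpha_t(x)-x\|_2\to0$ as $t\to0$ for each $x\in\widetilde M$, together with $\beta\in\mathrm{Aut}(\widetilde M)$ satisfying $\beta|_M=\mathrm{id}$, $\beta^2=\mathrm{id}$ and $\beta\alpha_t=\alpha_{-t}\beta$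 for all $t\in\mathbb R$. For a von Neumann subalgebra $Q\leq M$ put $\epsilon_t(Q)=\sup_{x\in(Q)_1}\|\alpha_t(x)-x\|_2$. $Q$ is $\alpha$-rigid if $\epsilon_t(Q)\to0$ as $t\to0$. $\mathrm{Rig}(\alpha)$ is the collection of all $\alpha$-rigid von Neumann subalgebras of $M$. *)

theory Defs
  imports "HOL-Analysis.Analysis"
begin

text \<open>
  Complex Hilbert spaces, built on top of the real Hilbert space given by the real part of
  the complex inner product (so that norm, completeness and the type of bounded operators are
  those of the library). The inner product is conjugate-linear in its first argument.
\<close>

class complex_hilbert = real_inner + complete_space +
  fixes scaleC :: "complex \<Rightarrow> 'a \<Rightarrow> 'a" (infixr \<open>*\<^sub>C\<close> 75)
    and cinner :: "'a \<Rightarrow> 'a \<Rightarrow> complex"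
  assumes scaleC_add_right: "c *\<^sub>C (x + y) = c *\<^sub>C x + c *\<^sub>C y"
    and scaleC_add_left: "(c + d) *\<^sub>C x = c *\<^sub>C x + d *\<^sub>C x"
    and scaleC_scaleC: "c *\<^sub>C d *\<^sub>C x = (c * d) *\<^sub>C x"
    and scaleC_of_real: "complex_of_real r *\<^sub>C x = r *\<^sub>R x"
    and cinner_add_right: "cinner x (y + z) = cinner x y + cinner x z"
    and cinner_scaleC_right: "cinner x (c *\<^sub>C y) = c * cinner x y"
    and cinner_commute: "cinner x y = cnj (cinner y x)"
    and Re_cinner: "Re (cinner x y) = inner x y"

instantiation complex :: complex_hilbert
begin
definition scaleC_complex :: "complex \<Rightarrow> complex \<Rightarrow> complex" where "scaleC_complex c x = c * x"
definition cinner_complex :: "complex \<Rightarrow> complex \<Rightarrow> complex" where "cinner_complex x y = cnj x * y"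
instance
  by standard (simp_all add: scaleC_complex_def cinner_complex_def algebra_simps
      scaleR_conv_of_real inner_complex_def)
end

lemma norm_scaleC: "norm (c *\<^sub>C (x :: 'h :: complex_hilbert)) = cmod c * norm x"
proof -
  have real: "cinner y y = complex_of_real (inner y y)" for y :: 'h
    using cinner_commute[of y y] Re_cinner[of y y] by (simp add: complex_eq_iff)
  have "cinner (c *\<^sub>C x) (c *\<^sub>C x) = c * cnj c * cinner x x"
    using cinner_commute[of "c *\<^sub>C x" x] cinner_scaleC_right[of x c x] real[of x]
    by (simp add: cinner_scaleC_right)
  also have "\<dots> = complex_of_real ((cmod c)\<^sup>2 * inner x x)"
    by (simp add: real flip: complex_norm_square)
  finally have "inner (c *\<^sub>C x) (c *\<^sub>C x) = (cmod c * norm x)\<^sup>2"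
    unfolding real of_real_eq_iff by (simp add: power_mult_distrib power2_norm_eq_inner)
  then show ?thesis
    by (simp add: norm_eq_sqrt_inner[of "c *\<^sub>C x"])
qed

lemma bounded_linear_scaleC: "bounded_linear ((*\<^sub>C) c :: 'h :: complex_hilbert \<Rightarrow> 'h)"
proof (rule bounded_linear_intro)
  fix r :: real and x :: 'h
  show "c *\<^sub>C r *\<^sub>R x = r *\<^sub>R c *\<^sub>C x"
    by (metis scaleC_of_real scaleC_scaleC mult.commute)
  show "norm (c *\<^sub>C x) \<le> norm x * cmod c" by (simp add: norm_scaleC)
qed (rule scaleC_add_right)

text \<open>
  The library's \<open>'h \<Rightarrow>\<^sub>L 'h\<close> consists of the bounded \<^emph>\<open>real\<close>-linear
  operators; \<open>B(H)\<close> is its subset \<open>complex_operators\<close>.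
\<close>

type_synonym 'h operator = "'h \<Rightarrow>\<^sub>L 'h"

definition complex_operators :: "'h::complex_hilbert operator set" where
  "complex_operators = {a. \<forall>c x. blinfun_apply a (c *\<^sub>C x) = c *\<^sub>C blinfun_apply a x}"

lift_definition scalar_op :: "complex \<Rightarrow> 'h::complex_hilbert operator" is "\<lambda>c x. c *\<^sub>C x"
  by (rule bounded_linear_scaleC)

definition adj :: "'h::complex_hilbert operator \<Rightarrow> 'h operator" where
  "adj a = (THE b. \<forall>x y. cinner (blinfun_apply b x) y = cinner x (blinfun_apply a y))"

definition commutant :: "'h::complex_hilbert operator set \<Rightarrow> 'h operator set" where
  "commutant S = {b \<in> complex_operators. \<forall>a\<in>S. a o\<^sub>L b = b o\<^sub>L a}"

definition von_neumann_algebra :: "'h::complex_hilbert operator set \<Rightarrow> bool" where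
  "von_neumann_algebra A \<longleftrightarrow>
     A \<subseteq> complex_operators \<and> id_blinfun \<in> A \<and>
     (\<forall>a\<in>A. \<forall>b\<in>A. a + b \<in> A \<and> a o\<^sub>L b \<in> A) \<and>
     (\<forall>a\<in>A. \<forall>c. scalar_op c o\<^sub>L a \<in> A) \<and>
     (\<forall>a\<in>A. adj a \<in> A) \<and>
     commutant (commutant A) = A"

definition von_neumann_subalgebra ::
    "'h::complex_hilbert operator set \<Rightarrow> 'h operator set \<Rightarrow> bool" where
  "von_neumann_subalgebra N A \<longleftrightarrow> von_neumann_algebra N \<and> N \<subseteq> A"

text \<open>
  The ultraweak (sigma-weak) topology: the coarsest one for which all functionals
  \<open>a \<mapsto> \<Sum>n. \<langle>\<xi>\<^sub>n, a \<eta>\<^sub>n\<rangle>\<close> with square-summable \<open>\<xi>\<close>, \<open>\<eta>\<close> are continuous.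
\<close>

definition ultraweak_topology :: "'h::complex_hilbert operator topology" where
  "ultraweak_topology = topology_generated_by
     {{a. (\<Sum>n. cinner (\<xi> n) (blinfun_apply a (\<eta> n))) \<in> U} | (\<xi> :: nat \<Rightarrow> 'h) \<eta> U.
        summable (\<lambda>n. (norm (\<xi> n))\<^sup>2) \<and> summable (\<lambda>n. (norm (\<eta> n))\<^sup>2) \<and> open U}"

definition normal_functional ::
    "'h::complex_hilbert operator set \<Rightarrow> ('h operator \<Rightarrow> complex) \<Rightarrow> bool" where
  "normal_functional A \<phi> \<longleftrightarrow> continuous_map (subtopology ultraweak_topology A) euclidean \<phi>"

definition faithful_normal_tracial_state ::
    "'h::complex_hilbert operator set \<Rightarrow> ('h operator \<Rightarrow> complex) \<Rightarrow> bool" where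
  "faithful_normal_tracial_state A \<tau> \<longleftrightarrow>
     (\<forall>a\<in>A. \<forall>b\<in>A. \<tau> (a + b) = \<tau> a + \<tau> b) \<and>
     (\<forall>a\<in>A. \<forall>c. \<tau> (scalar_op c o\<^sub>L a) = c * \<tau> a) \<and>
     (\<forall>a\<in>A. \<tau> (adj a o\<^sub>L a) \<in> \<real>\<^sub>\<ge>\<^sub>0) \<and>
     \<tau> id_blinfun = 1 \<and>
     (\<forall>a\<in>A. \<tau> (adj a o\<^sub>L a) = 0 \<longrightarrow> a = 0) \<and>
     (\<forall>a\<in>A. \<forall>b\<in>A. \<tau> (a o\<^sub>L b) = \<tau> (b o\<^sub>L a)) \<and>
     normal_functional A \<tau>"

definition tracial_von_neumann_algebra ::
    "'h::complex_hilbert operator set \<Rightarrow> ('h operator \<Rightarrow> complex) \<Rightarrow> bool" where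
  "tracial_von_neumann_algebra A \<tau> \<longleftrightarrow>
     von_neumann_algebra A \<and> faithful_normal_tracial_state A \<tau>"

definition norm2 :: "('h::complex_hilbert operator \<Rightarrow> complex) \<Rightarrow> 'h operator \<Rightarrow> real" where
  "norm2 \<tau> x = sqrt (Re (\<tau> (adj x o\<^sub>L x)))"

text \<open>
  Automorphisms are functions on all operators of which only the values on \<open>A\<close> matter.
\<close>

definition trace_preserving_automorphism ::
    "'h::complex_hilbert operator set \<Rightarrow> ('h operator \<Rightarrow> complex) \<Rightarrow>
     ('h operator \<Rightarrow> 'h operator) \<Rightarrow> bool" where
  "trace_preserving_automorphism A \<tau> \<theta> \<longleftrightarrow>
     bij_betw \<theta> A A \<and>
     (\<forall>a\<in>A. \<forall>b\<in>A. \<theta> (a + b) = \<theta> a + \<theta> b \<and> \<theta> (a o\<^sub>L b) = \<theta> a o\<^sub>L \<theta> b) \<and>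
     (\<forall>a\<in>A. \<forall>c. \<theta> (scalar_op c o\<^sub>L a) = scalar_op c o\<^sub>L \<theta> a) \<and>
     (\<forall>a\<in>A. \<theta> (adj a) = adj (\<theta> a)) \<and>
     (\<forall>a\<in>A. \<tau> (\<theta> a) = \<tau> a)"

definition s_malleable_deformation ::
    "('h::complex_hilbert operator \<Rightarrow> complex) \<Rightarrow> 'h operator set \<Rightarrow> 'h operator set \<Rightarrow>
     (real \<Rightarrow> 'h operator \<Rightarrow> 'h operator) \<Rightarrow> ('h operator \<Rightarrow> 'h operator) \<Rightarrow> bool" where
  "s_malleable_deformation \<tau> M Mt \<alpha> \<beta> \<longleftrightarrow>
     (\<forall>t. trace_preserving_automorphism Mt \<tau> (\<alpha> t)) \<and>
     (\<forall>s t. \<forall>x\<in>Mt. \<alpha> (s + t) x = \<alpha> s (\<alpha> t x)) \<and>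
     (\<forall>x\<in>Mt. ((\<lambda>t. norm2 \<tau> (\<alpha> t x - x)) \<longlongrightarrow> 0) (at 0)) \<and>
     trace_preserving_automorphism Mt \<tau> \<beta> \<and>
     (\<forall>x\<in>M. \<beta> x = x) \<and>
     (\<forall>x\<in>Mt. \<beta> (\<beta> x) = x) \<and>
     (\<forall>t. \<forall>x\<in>Mt. \<beta> (\<alpha> t x) = \<alpha> (- t) (\<beta> x))"

text \<open>
  The supremum is over a set of reals that contains 0 and is bounded above by 2.
\<close>

definition eps ::
    "('h::complex_hilbert operator \<Rightarrow> complex) \<Rightarrow> (real \<Rightarrow> 'h operator \<Rightarrow> 'h operator) \<Rightarrow>
     real \<Rightarrow> 'h operator set \<Rightarrow> real" where
  "eps \<tau> \<alpha> t Q = (SUP x\<in>{x \<in> Q. norm x \<le> 1}. norm2 \<tau> (\<alpha> t x - x))"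

definition Rig ::
    "('h::complex_hilbert operator \<Rightarrow> complex) \<Rightarrow> 'h operator set \<Rightarrow>
     (real \<Rightarrow> 'h operator \<Rightarrow> 'h operator) \<Rightarrow> 'h operator set set" where
  "Rig \<tau> M \<alpha> = {Q. von_neumann_subalgebra Q M \<and> ((\<lambda>t. eps \<tau> \<alpha> t Q) \<longlongrightarrow> 0) (at 0)}"

end

theory Submission
  imports Defs
begin

text \<open>
  Both inequalities are instances of one estimate, \<open>eps_double_le\<close>: if \<open>Q \<subseteq> N \<subseteq> M\<close>, if \<open>N\<close> is
  rigid and if \<open>Q' \<inter> Mt \<subseteq> M\<close>, then \<open>\<epsilon>\<^sub>2\<^sub>t(N) \<le> 4 \<epsilon>\<^sub>t(Q)\<close>. It bounds the supremum by taking \<open>2t\<close> for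
  \<open>t\<close>, and the infimum by taking \<open>Q\<close> itself as the large algebra.

  The estimate is about the spaces \<open>W\<^sub>t(N) = {x \<in> Mt. x \<alpha>\<^sub>t(n) = n x for all n \<in> N}\<close> of intertwiners.
  Such spaces multiply along \<open>\<alpha>\<close>: \<open>W\<^sub>s \<alpha>\<^sub>s(W\<^sub>t) \<subseteq> W\<^sub>s\<^sub>+\<^sub>t\<close>; and \<open>x y\<^sup>* \<in> N' \<inter> Mt\<close> for \<open>x, y \<in> W\<^sub>t(N)\<close>.
  Averaging over the unitaries of \<open>Q\<close> gives \<open>v \<in> W\<^sub>t(Q)\<close> with \<open>\<parallel>v - 1\<parallel>\<^sub>2 \<le> \<epsilon>\<^sub>t(Q)\<close>
  (\<open>intertwiner_near_id\<close>). For \<open>N\<close> the same average tells little, since \<open>\<epsilon>\<^sub>t(N)\<close> is not known to be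
  small at this \<open>t\<close>. What does hold at every \<open>t\<close> is that \<open>W\<^sub>t(N)\<close> is full: the ranges of its elements span a
  dense subspace (\<open>intertwiners_full\<close>). Indeed, let \<open>p\<^sub>t\<close> be the projection onto the orthogonal
  complement of these ranges. It commutes with \<open>N\<close>, so it lies in \<open>M\<close> and \<open>\<beta>\<close> fixes it; as
  \<open>w \<mapsto> \<alpha>\<^sub>t(\<beta>(w\<^sup>*))\<close> maps \<open>W\<^sub>t(N)\<close> to itself, \<open>p\<^sub>t w = 0\<close> for all \<open>w \<in> W\<^sub>t(N)\<close> turns into
  \<open>w \<alpha>\<^sub>t(p\<^sub>t) = 0\<close>. With \<open>W\<^sub>s \<alpha>\<^sub>s(W\<^sub>s) \<subseteq> W\<^sub>2\<^sub>s\<close> this gives \<open>p\<^sub>2\<^sub>s \<le> p\<^sub>s\<close>, hence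
  \<open>\<parallel>p\<^sub>t\<parallel>\<^sub>2 \<le> \<parallel>p\<^sub>s\<parallel>\<^sub>2 \<le> \<epsilon>\<^sub>s(N)\<close> for \<open>s = t / 2\<^sup>k\<close>, and rigidity forces \<open>p\<^sub>t = 0\<close>.

  Now \<open>w z\<^sup>* \<in> N' \<inter> Mt \<subseteq> M\<close> for \<open>w, z \<in> W\<^sub>t(N)\<close>, so \<open>\<beta>(w) \<beta>(z)\<^sup>* = w z\<^sup>*\<close>. Therefore
  \<open>w\<^sup>* \<xi> \<mapsto> \<beta>(w)\<^sup>* \<xi>\<close> is isometric; by fullness, which the reflection transfers to the adjoints, it extends to an isometry \<open>Y\<close>, which lies in \<open>Mt\<close>
  because it commutes with the commutant (\<open>transport_isometry\<close>). One has
  \<open>Y \<alpha>\<^sub>t(n) = \<alpha>\<^sub>-\<^sub>t(n) Y\<close> for \<open>n \<in> N\<close>, and, since \<open>v w\<^sup>* \<in> Q' \<inter> Mt \<subseteq> M\<close>, also \<open>\<beta>(v) Y = v\<close>.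
  The latter makes \<open>\<parallel>Y - 1\<parallel>\<^sub>2 \<le> 2 \<parallel>v - 1\<parallel>\<^sub>2\<close>, and the former bounds, for \<open>n\<close> in the unit ball of \<open>N\<close>,
  \<open>\<parallel>\<alpha>\<^sub>2\<^sub>t(n) - n\<parallel>\<^sub>2 = \<parallel>\<alpha>\<^sub>t(n) - \<alpha>\<^sub>-\<^sub>t(n)\<parallel>\<^sub>2\<close> by \<open>2 \<parallel>Y - 1\<parallel>\<^sub>2\<close>.

  The analytic input is kept elementary. The trace enters through the inequality
  \<open>\<parallel>x\<parallel>\<^sub>2\<^sup>2 \<le> C \<Sum>\<^sub>n \<parallel>x \<zeta>\<^sub>n\<parallel>\<^sup>2\<close>, which expresses its normality (\<open>norm2_le_mass\<close>); it makes a bounded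
  convex set have a vector of least trace norm in its closure (\<open>norm2_minimiser\<close>).
\<close>

section \<open>Minimising sequences, projections and adjoints\<close>

text \<open>
  By the parallelogram identity, two vectors on which a quadratic form is close to its infimum are
  close to each other. The form is minimised over a shrinking sequence of sets rather than over one
  set, so that one form can be minimised among the almost-minimisers of another. The infima increase
  with \<open>k\<close> and stay below \<open>B\<close>, so they converge, and this is what makes \<open>y j\<close> close to \<open>y k\<close>.
\<close>

lemma quadratic_minimising_sequence:
  fixes q :: "'a::real_vector \<Rightarrow> real" and C :: "nat \<Rightarrow> 'a set"
  assumes nonneg: "\<And>x. 0 \<le> q x"
    and median: "\<And>x y. x \<in> C 0 \<Longrightarrow> y \<in> C 0 \<Longrightarrow>
           4 * q ((1/2) *\<^sub>R (x + y)) + q (x - y) = 2 * q x + 2 * q y"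
    and anti: "\<And>j k. j \<le> k \<Longrightarrow> C k \<subseteq> C j"
    and mid: "\<And>k x y. x \<in> C k \<Longrightarrow> y \<in> C k \<Longrightarrow> (1/2) *\<^sub>R (x + y) \<in> C k"
    and low: "\<And>k. \<exists>x\<in>C k. q x \<le> B"
  obtains y where "\<And>k. y k \<in> C k"
    and "\<And>e. 0 < e \<Longrightarrow> \<exists>K. \<forall>j\<ge>K. \<forall>k\<ge>K. q (y j - y k) < e"
proof -
  define r where "r k = inverse (real (Suc k))" for k
  define m where "m k = Inf (q ` C k)" for k
  have bdd: "bdd_below (q ` C k)" for k
    using nonneg by (auto intro!: bdd_belowI[of _ 0])
  have ne: "q ` C k \<noteq> {}" for k using low by blast
  have m_le: "m k \<le> q x" if "x \<in> C k" for k x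
    unfolding m_def using that bdd by (intro cInf_lower) auto
  have m_mono: "m j \<le> m k" if "j \<le> k" for j k
    unfolding m_def using anti[OF that] ne bdd by (intro cInf_superset_mono) auto
  have m_B: "m k \<le> B" for k using low[of k] m_le by force
  have "incseq m" using m_mono by (auto simp: incseq_def)
  then have Cau: "Cauchy m"
    using incseq_convergent[of m B] m_B by (metis LIMSEQ_imp_Cauchy)
  have "\<exists>x\<in>C k. q x < m k + r k" for k
    using cInf_lessD[OF ne[of k], of "m k + r k"] unfolding m_def r_def by auto
  then obtain y where y: "\<And>k. y k \<in> C k" "\<And>k. q (y k) < m k + r k"
    by metis
  have close: "q (y j - y k) \<le> 2 * (m j - m k) + 4 * r k"
    if "k \<le> j" for j k
  proof -
    have yj: "y j \<in> C k" using y anti[OF that] by blast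
    have "m k \<le> q ((1/2) *\<^sub>R (y j + y k))" using m_le mid yj y by blast
    moreover have "4 * q ((1/2) *\<^sub>R (y j + y k)) + q (y j - y k) = 2 * q (y j) + 2 * q (y k)"
      using median[of "y j" "y k"] y anti[of 0] by blast
    moreover have "r j \<le> r k"
      using that by (simp add: r_def le_imp_inverse_le)
    ultimately show ?thesis using y(2)[of j] y(2)[of k] by argo
  qed
  have sym: "q (x - y) = q (y - x)" if "x \<in> C 0" "y \<in> C 0" for x y
    using median[OF that] median[OF that(2,1)] by (simp add: add.commute)
  show thesis
  proof (rule that[OF y(1)])
    fix e :: real assume e: "0 < e"
    obtain K1 where K1: "\<And>j k. j \<ge> K1 \<Longrightarrow> k \<ge> K1 \<Longrightarrow> dist (m j) (m k) < e/4"
      using Cau e unfolding Cauchy_def by (meson divide_pos_pos zero_less_numeral)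
    obtain K2 where K2: "r K2 < e/8"
      using reals_Archimedean[of "e/8"] e by (auto simp: r_def)
    have main: "q (y j - y k) < e" if "max K1 K2 \<le> k" "k \<le> j" for j k
    proof -
      have "r k \<le> r K2"
        using that by (simp add: r_def le_imp_inverse_le)
      moreover have "\<bar>m j - m k\<bar> < e/4" using K1[of j k] that by (simp add: dist_real_def)
      ultimately show ?thesis using close[OF that(2)] K2 by argo
    qed
    show "\<exists>K. \<forall>j\<ge>K. \<forall>k\<ge>K. q (y j - y k) < e"
    proof (intro exI allI impI)
      fix j k assume "max K1 K2 \<le> j" "max K1 K2 \<le> k"
      then show "q (y j - y k) < e"
        using main[of k j] main[of j k] sym[of "y j" "y k"] y(1) anti[of 0]
        by (metis le0 linear subsetD)
    qed
  qed
qed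

lemma orthogonal_projection_exists:
  fixes V :: "'h::{real_inner,complete_space} set"
  assumes V: "subspace V" and cl: "closed V"
  obtains p where "p \<in> V" "\<And>y. y \<in> V \<Longrightarrow> inner (x - p) y = 0"
proof -
  let ?q = "\<lambda>z::'h. (norm z)\<^sup>2"
  define C where "C = (\<lambda>y. y - x) ` V"
  obtain z where zC: "\<And>k. z k \<in> C"
    and zc: "\<And>e. 0 < e \<Longrightarrow> \<exists>K. \<forall>j\<ge>K. \<forall>k\<ge>K. ?q (z j - z k) < e"
    and zmin: "\<And>c. c \<in> C \<Longrightarrow> \<exists>K. \<forall>k\<ge>K. ?q (z k) < ?q c + inverse (real (Suc k))"
  proof -
    define d where "d = Inf (?q ` C)"
    have bdd: "bdd_below (?q ` C)" by (auto intro!: bdd_belowI[of _ 0])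
    have ne: "?q ` C \<noteq> {}" using subspace_0[OF V] by (auto simp: C_def)
    define D where "D k = {c \<in> C. ?q c < d + inverse (real (Suc k))}" for k
    have midC: "(1/2) *\<^sub>R (a + b) \<in> C" if "a \<in> C" "b \<in> C" for a b
    proof -
      from that obtain a' b' where "a' \<in> V" "b' \<in> V" "a = a' - x" "b = b' - x"
        by (auto simp: C_def)
      moreover have "(1/2) *\<^sub>R (a' - x + (b' - x)) = (1/2) *\<^sub>R (a' + b') - x"
        by (simp add: scaleR_left_distrib[symmetric] algebra_simps flip: scaleR_2)
      ultimately show ?thesis using V by (auto simp: C_def subspace_add subspace_scale)
    qed
    have med: "4 * ?q ((1/2) *\<^sub>R (a + b)) + ?q (a - b) = 2 * ?q a + 2 * ?q b" for a b :: 'h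
      unfolding power2_norm_eq_inner by (simp add: inner_simps inner_commute field_simps)
    have low: "\<exists>c\<in>D k. ?q c \<le> d + 1" for k
    proof -
      obtain c where "c \<in> C" "?q c < d + inverse (real (Suc k))"
        using cInf_lessD[OF ne, of "d + inverse (real (Suc k))"] unfolding d_def by auto
      moreover have "inverse (real (Suc k)) \<le> 1" by (simp add: inverse_le_1_iff)
      ultimately show ?thesis unfolding D_def by force
    qed
    have anti: "D k \<subseteq> D j" if "j \<le> k" for j k
    proof -
      have "inverse (real (Suc k)) \<le> inverse (real (Suc j))"
        using that by (simp add: le_imp_inverse_le)
      then show ?thesis unfolding D_def by (smt (verit) Collect_mono)
    qed
    have midD: "(1/2) *\<^sub>R (a + b) \<in> D k" if "a \<in> D k" "b \<in> D k" for k a b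
    proof -
      have median_less: "m < c" if "0 \<le> e" "r < c" "s < c" "4 * m + e = 2 * r + 2 * s"
        for m c e r s :: real using that by linarith
      have "0 \<le> ?q (a - b)" "?q a < d + inverse (real (Suc k))" "?q b < d + inverse (real (Suc k))"
        using that unfolding D_def by auto
      then have "?q ((1/2) *\<^sub>R (a + b)) < d + inverse (real (Suc k))"
        using med[of a b] by (rule median_less)
      then show ?thesis using that midC unfolding D_def by auto
    qed
    obtain z where z: "\<And>k. z k \<in> D k"
      and zc: "\<And>e. 0 < e \<Longrightarrow> \<exists>K. \<forall>j\<ge>K. \<forall>k\<ge>K. ?q (z j - z k) < e"
      using quadratic_minimising_sequence[of ?q D "d + 1", OF _ med anti midD low] by auto
    have "d \<le> ?q c" if "c \<in> C" for c unfolding d_def using that bdd by (intro cInf_lower) auto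
    then have "\<exists>K. \<forall>k\<ge>K. ?q (z k) < ?q c + inverse (real (Suc k))" if "c \<in> C" for c
      using z that unfolding D_def by (smt (verit) mem_Collect_eq)
    with z zc show thesis by (intro that[of z]) (auto simp: D_def)
  qed
  have "Cauchy z" unfolding Cauchy_def dist_norm
  proof (intro allI impI)
    fix e :: real assume "0 < e"
    then obtain K where "\<forall>j\<ge>K. \<forall>k\<ge>K. ?q (z j - z k) < e\<^sup>2" using zc[of "e\<^sup>2"] by auto
    then show "\<exists>M. \<forall>m\<ge>M. \<forall>n\<ge>M. norm (z m - z n) < e"
      using \<open>0 < e\<close> by (meson less_imp_le power2_less_imp_less)
  qed
  then obtain l where l: "z \<longlonglongrightarrow> l" by (auto simp: Cauchy_convergent_iff convergent_def)
  define p where "p = l + x"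
  have zx: "(\<lambda>k. z k + x) \<longlonglongrightarrow> p" unfolding p_def by (intro tendsto_intros l)
  have "z k + x \<in> V" for k using zC[of k] by (auto simp: C_def)
  then have pV: "p \<in> V" by (rule closed_sequentially[OF cl _ zx])
  have lim: "(\<lambda>k. ?q (z k)) \<longlonglongrightarrow> ?q l" by (intro tendsto_intros l)
  have l_min: "?q l \<le> ?q c" if "c \<in> C" for c
  proof -
    have "(\<lambda>k. ?q c + inverse (real (Suc k))) \<longlonglongrightarrow> ?q c + 0"
      by (intro tendsto_intros LIMSEQ_inverse_real_of_nat)
    then have "(\<lambda>k. ?q c + inverse (real (Suc k))) \<longlonglongrightarrow> ?q c" by simp
    moreover have "\<exists>K. \<forall>k\<ge>K. ?q (z k) \<le> ?q c + inverse (real (Suc k))"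
      using zmin[OF that] less_imp_le by blast
    ultimately show ?thesis using LIMSEQ_le[OF lim] by blast
  qed
  have "inner (x - p) y = 0" if y: "y \<in> V" for y
  proof (cases "y = 0")
    case False
    define s where "s = inner (x - p) y / inner y y"
    have "p + s *\<^sub>R y \<in> V" using pV y V by (simp add: subspace_add subspace_scale)
    then have "p + s *\<^sub>R y - x \<in> C" by (auto simp: C_def)
    from l_min[OF this] have "inner (p - x) (p - x) \<le> inner (p - x + s *\<^sub>R y) (p - x + s *\<^sub>R y)"
      by (simp add: p_def power2_norm_eq_inner algebra_simps)
    then have "0 \<le> 2 * s * inner (p - x) y + s * s * inner y y"
      by (simp add: inner_add_left inner_add_right inner_commute algebra_simps)
    moreover have "inner (p - x) y = - s * inner y y"
      using False by (simp add: s_def inner_diff_left)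
    ultimately have "s * s * inner y y \<le> 0" by simp
    moreover have "inner y y > 0" using False by simp
    ultimately have "s = 0" by (metis mult_pos_pos not_le not_real_square_gt_zero)
    then show ?thesis using False by (simp add: s_def)
  qed simp
  with pV show thesis by (rule that)
qed

lemma riesz_representation:
  fixes f :: "'h::{real_inner,complete_space} \<Rightarrow> real"
  assumes f: "bounded_linear f"
  obtains z where "\<And>y. f y = inner z y"
proof (cases "\<forall>y. f y = 0")
  case True then show ?thesis by (intro that[of 0]) simp
next
  case False
  interpret f: bounded_linear f by fact
  let ?V = "{y. f y = 0}"
  have V: "subspace ?V" by (auto simp: subspace_def f.add f.scaleR f.zero)
  have cl: "closed ?V"
    by (intro closed_Collect_eq continuous_intros linear_continuous_on f)
  from False obtain x where x: "f x \<noteq> 0" by auto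
  obtain p where p: "p \<in> ?V" "\<And>y. y \<in> ?V \<Longrightarrow> inner (x - p) y = 0"
    using orthogonal_projection_exists[OF V cl, of x] by blast
  define w where "w = x - p"
  have fw: "f w = f x" using p by (simp add: w_def f.diff)
  have wn: "w \<noteq> 0" using fw x f.zero by auto
  have "f y = inner ((f w / inner w w) *\<^sub>R w) y" for y
  proof -
    have "f y *\<^sub>R w - f w *\<^sub>R y \<in> ?V" by (simp add: f.diff f.scaleR)
    then have "inner w (f y *\<^sub>R w - f w *\<^sub>R y) = 0" using p(2) w_def by blast
    then have "f y * inner w w = f w * inner w y" by (simp add: inner_diff_right)
    then show ?thesis using wn by (simp add: field_simps)
  qed
  then show ?thesis by (rule that)
qed

lemma Im_cinner: "Im (cinner x y) = - inner x (\<i> *\<^sub>C y)"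
  by (simp add: cinner_scaleC_right flip: Re_cinner)

lemma cinner_scaleC_left: "cinner (c *\<^sub>C x) y = cnj c * cinner x y"
  by (metis cinner_commute cinner_scaleC_right complex_cnj_mult)

lemma complex_operatorsD: "a \<in> complex_operators \<Longrightarrow> a (c *\<^sub>C x) = c *\<^sub>C a x"
  by (simp add: complex_operators_def)

lemma adjoint_unique:
  assumes "\<And>x y. cinner (blinfun_apply b x) y = cinner x (blinfun_apply a y)"
  shows "adj a = b"
  unfolding adj_def
proof (rule the_equality)
  show "\<forall>x y. cinner (b x) y = cinner x (a y)" using assms by blast
  fix c assume c: "\<forall>x y. cinner (blinfun_apply c x) y = cinner x (a y)"
  show "c = b"
  proof (rule blinfun_eqI)
    fix x
    have "inner (c x) y = inner (b x) y" for y using c assms Re_cinner by metis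
    then show "c x = b x" by (metis inner_commute vector_eq_ldot)
  qed
qed

text \<open>
  The imaginary part of the complex inner product is the real inner product with \<open>- \<i> y\<close>, so for
  a complex-linear operator the adjoint relation can be checked on the real inner product.
\<close>

lemma adjoint_eqI:
  assumes a: "a \<in> complex_operators"
    and b: "\<And>x y. inner (blinfun_apply b x) y = inner x (blinfun_apply a y)"
  shows "adj a = b"
proof (rule adjoint_unique)
  fix x y
  show "cinner (b x) y = cinner x (a y)"
    by (rule complex_eqI) (simp_all add: Re_cinner Im_cinner b flip: complex_operatorsD[OF a])
qed

text \<open>
  The adjoint is a definite description; that it describes something is the Riesz representation
  of the functionals \<open>y \<mapsto> \<langle>x, a y\<rangle>\<close>.
\<close>

lemma inner_adj:
  assumes a: "a \<in> complex_operators"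
  shows "inner (adj a x) y = inner x (blinfun_apply a y)"
proof -
  have "\<exists>z. \<forall>y. inner x (a y) = inner z y" for x
    by (rule riesz_representation[of "\<lambda>y. inner x (a y)"])
      (auto intro!: bounded_linear_intros)
  then obtain b where b: "\<And>x y. inner x (a y) = inner (b x) y" by metis
  have "bounded_linear b"
  proof (rule bounded_linear_intro)
    show "b (x + y) = b x + b y" for x y
      by (metis b inner_add_left vector_eq_rdot)
    show "b (r *\<^sub>R x) = r *\<^sub>R b x" for r x
      by (metis b inner_scaleR_left vector_eq_rdot)
    show "norm (b x) \<le> norm x * norm a" for x
    proof -
      have "norm (b x) * norm (b x) = inner x (a (b x))"
        by (metis b power2_norm_eq_inner power2_eq_square)
      also have "\<dots> \<le> norm x * norm (a (b x))" by (rule norm_cauchy_schwarz)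
      also have "\<dots> \<le> norm x * (norm a * norm (b x))"
        by (intro mult_left_mono norm_blinfun) auto
      finally have *: "norm (b x) * norm (b x) \<le> (norm x * norm a) * norm (b x)"
        by (simp add: mult.assoc)
      show ?thesis
        using * by (cases "norm (b x) = 0") (simp, metis mult_right_le_imp_le norm_ge_zero order_le_less)
    qed
  qed
  then have "inner (Blinfun b x) y = inner x (a y)" for x y
    by (simp add: bounded_linear_Blinfun_apply b)
  then show ?thesis using adjoint_eqI[OF a] by metis
qed

lemma inner_adj_right:
  "a \<in> complex_operators \<Longrightarrow> inner y (adj a x) = inner (blinfun_apply a y) x"
  by (metis inner_adj inner_commute)

lemma inner_scaleC: "inner (c *\<^sub>C x) y = inner x (cnj c *\<^sub>C y)"
  by (metis Re_cinner cinner_scaleC_left cinner_scaleC_right)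

lemma adj_complex_operators:
  assumes a: "a \<in> complex_operators" shows "adj a \<in> complex_operators"
proof -
  have "inner (adj a (c *\<^sub>C x)) y = inner (c *\<^sub>C adj a x) y" for c x y
    using a by (simp add: inner_adj inner_scaleC complex_operatorsD)
  then show ?thesis unfolding complex_operators_def using vector_eq_rdot by blast
qed

lemma adj_adj: "a \<in> complex_operators \<Longrightarrow> adj (adj a) = a"
  by (intro adjoint_eqI adj_complex_operators) (simp_all add: inner_adj_right)

lemma complex_operators_compose:
  "a \<in> complex_operators \<Longrightarrow> b \<in> complex_operators \<Longrightarrow> a o\<^sub>L b \<in> complex_operators"
  by (simp add: complex_operators_def)

lemma complex_operators_add:
  "a \<in> complex_operators \<Longrightarrow> b \<in> complex_operators \<Longrightarrow> a + b \<in> complex_operators"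
  by (simp add: complex_operators_def blinfun.bilinear_simps scaleC_add_right)

lemma scalar_op_apply [simp]: "scalar_op c x = c *\<^sub>C x"
  by (simp add: scalar_op.rep_eq)

lemma scalar_op_complex: "scalar_op c \<in> complex_operators"
  by (simp add: complex_operators_def scaleC_scaleC mult.commute)

lemma adj_compose:
  "a \<in> complex_operators \<Longrightarrow> b \<in> complex_operators \<Longrightarrow> adj (a o\<^sub>L b) = adj b o\<^sub>L adj a"
  by (intro adjoint_eqI complex_operators_compose) (simp_all add: inner_adj)

lemma adj_add:
  "a \<in> complex_operators \<Longrightarrow> b \<in> complex_operators \<Longrightarrow> adj (a + b) = adj a + adj b"
  by (intro adjoint_eqI complex_operators_add)
    (simp_all add: inner_adj blinfun.bilinear_simps inner_simps)

lemma adj_scalar_op: "adj (scalar_op c) = scalar_op (cnj c)"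
  by (intro adjoint_eqI scalar_op_complex) (simp add: inner_scaleC)

lemma adj_id [simp]: "adj id_blinfun = id_blinfun"
  by (intro adjoint_eqI) (simp_all add: complex_operators_def)

lemma norm_adj_le:
  assumes a: "a \<in> complex_operators" shows "norm (adj a) \<le> norm a"
proof (rule norm_blinfun_bound)
  fix x
  have "norm (adj a x) * norm (adj a x) = inner x (a (adj a x))"
    by (metis inner_adj[OF a] power2_norm_eq_inner power2_eq_square)
  also have "\<dots> \<le> norm x * norm (a (adj a x))" by (rule norm_cauchy_schwarz)
  also have "\<dots> \<le> norm x * (norm a * norm (adj a x))"
    by (intro mult_left_mono norm_blinfun) auto
  finally have *: "norm (adj a x) * norm (adj a x) \<le> (norm a * norm x) * norm (adj a x)"
    by (simp add: ac_simps)
  show "norm (adj a x) \<le> norm a * norm x"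
    using * by (cases "norm (adj a x) = 0") (simp, metis mult_right_le_imp_le norm_ge_zero order_le_less)
qed simp

section \<open>Closed subspaces and isometries\<close>

lemma subspace_closure:
  fixes S :: "'a::real_normed_vector set"
  assumes S: "subspace S" shows "subspace (closure S)"
proof (rule subspaceI)
  show "0 \<in> closure S" using subspace_0[OF S] closure_subset by blast
next
  fix x y assume "x \<in> closure S" "y \<in> closure S"
  then obtain f g where "\<And>n. f n \<in> S" "f \<longlonglongrightarrow> x" "\<And>n. g n \<in> S" "g \<longlonglongrightarrow> y"
    by (auto simp: closure_sequential)
  then have "\<And>n. f n + g n \<in> S" "(\<lambda>n. f n + g n) \<longlonglongrightarrow> x + y"
    by (auto intro: subspace_add[OF S] tendsto_add)
  then show "x + y \<in> closure S" unfolding closure_sequential by metis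
next
  fix r x assume "x \<in> closure S"
  then obtain f where "\<And>n. f n \<in> S" "f \<longlonglongrightarrow> x" by (auto simp: closure_sequential)
  then have "\<And>n. r *\<^sub>R f n \<in> S" "(\<lambda>n. r *\<^sub>R f n) \<longlonglongrightarrow> r *\<^sub>R x"
    by (auto intro: subspace_scale[OF S] tendsto_scaleR)
  then show "r *\<^sub>R x \<in> closure S" unfolding closure_sequential by metis
qed

lemma closure_span_invariant:
  assumes c: "bounded_linear c" and G: "\<And>x. x \<in> G \<Longrightarrow> c x \<in> G"
    and x: "x \<in> closure (span G)"
  shows "c x \<in> closure (span G)"
proof -
  have "c ` span G = span (c ` G)"
    by (rule linear_span_image[OF bounded_linear.linear[OF c], symmetric])
  also have "\<dots> \<subseteq> span G" using G by (intro span_mono) auto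
  finally have "c ` closure (span G) \<subseteq> closure (span G)"
    using closure_bounded_linear_image_subset[OF c] closure_mono by (metis order_trans)
  then show ?thesis using x by blast
qed

lemma bounded_linear_eq_closure_span:
  assumes f: "bounded_linear f" and g: "bounded_linear g"
    and eq: "\<And>x. x \<in> G \<Longrightarrow> f x = g x" and x: "x \<in> closure (span G)"
  shows "f x = g x"
proof -
  have "closed {x. f x = g x}"
    by (intro closed_Collect_eq linear_continuous_on f g)
  moreover have "span G \<subseteq> {x. f x = g x}"
    using linear_eq_on_span[OF bounded_linear.linear[OF f] bounded_linear.linear[OF g] eq] by auto
  ultimately show ?thesis using x closure_minimal by blast
qed

text \<open>
  The projection onto the orthogonal complement of \<open>G\<close>, in the form in which it is used: it is the
  largest projection annihilating \<open>G\<close>, and it commutes with every operator that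
  together with its adjoint leaves \<open>G\<close> invariant. Through the latter it belongs to a von Neumann
  algebra as soon as the commutant leaves \<open>G\<close> invariant.
\<close>

lemma complement_projection:
  fixes G :: "'h::complex_hilbert set"
  assumes G: "\<forall>x\<in>G. \<forall>c. c *\<^sub>C x \<in> G"
  obtains p :: "'h operator" where "p \<in> complex_operators" "adj p = p" "p o\<^sub>L p = p"
    "\<forall>x\<in>G. p x = 0"
    "\<forall>y::'h operator. (\<forall>x\<in>G. blinfun_apply y x = 0) \<longrightarrow> y o\<^sub>L p = y"
    "\<forall>c\<in>complex_operators. (\<forall>x\<in>G. blinfun_apply c x \<in> G \<and> adj c x \<in> G) \<longrightarrow> c o\<^sub>L p = p o\<^sub>L c"
    "p = 0 \<longrightarrow> closure (span G) = UNIV"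
proof -
  define V where "V = closure (span G)"
  have sV: "subspace V" and cV: "closed V"
    by (simp_all add: V_def subspace_closure)
  have GV: "x \<in> V" if "x \<in> G" for x
    using that closure_subset span_base unfolding V_def by blast
  have "\<exists>e. x - e \<in> V \<and> (\<forall>y\<in>V. inner e y = 0)" for x
    using orthogonal_projection_exists[OF sV cV, of x]
    by (metis (no_types, opaque_lifting) diff_diff_eq2 add_diff_cancel_left')
  then obtain e where eV: "\<And>x. x - e x \<in> V" and eo: "\<And>x y. y \<in> V \<Longrightarrow> inner (e x) y = 0"
    by metis
  have uniq: "z = e x" if "x - z \<in> V" "\<And>y. y \<in> V \<Longrightarrow> inner z y = 0" for x z
  proof -
    have "z - e x = (x - e x) - (x - z)" by simp
    then have "z - e x \<in> V" using subspace_diff[OF sV eV[of x] that(1)] by simp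
    then have "inner (z - e x) (z - e x) = 0"
      by (simp add: inner_diff_left that(2) eo)
    then show ?thesis by simp
  qed
  have add: "e (x + y) = e x + e y" for x y
  proof (rule uniq[symmetric])
    have "x + y - (e x + e y) = (x - e x) + (y - e y)" by simp
    then show "x + y - (e x + e y) \<in> V" using subspace_add[OF sV eV[of x] eV[of y]] by metis
  qed (simp add: eo inner_add_left)
  have scale: "e (r *\<^sub>R x) = r *\<^sub>R e x" for r x
  proof (rule uniq[symmetric])
    have "r *\<^sub>R x - r *\<^sub>R e x = r *\<^sub>R (x - e x)" by (simp add: scaleR_diff_right)
    then show "r *\<^sub>R x - r *\<^sub>R e x \<in> V" using subspace_scale[OF sV eV[of x]] by simp
  qed (simp add: eo)
  have bound: "norm (e x) \<le> norm x * 1" for x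
  proof -
    have "inner (e x) x = inner (e x) (e x)"
      using eo[OF eV, of x x] by (simp add: inner_diff_right)
    then have "norm (e x) * norm (e x) \<le> norm (e x) * norm x"
      by (metis norm_cauchy_schwarz power2_norm_eq_inner power2_eq_square)
    then show ?thesis by (cases "e x = 0") auto
  qed
  have bl: "bounded_linear e" by (rule bounded_linear_intro[OF add scale bound])
  define p where "p = Blinfun e"
  have p: "blinfun_apply p = e" by (simp add: p_def bounded_linear_Blinfun_apply[OF bl])
  have inner_p: "inner (e x) y = inner x (e y)" for x y
    using eo[OF eV, of x y] eo[OF eV, of y x] by (simp add: inner_diff_right inner_commute)
  have comm: "c (e x) = e (c x)"
    if c: "c \<in> complex_operators" "\<And>x. x \<in> G \<Longrightarrow> c x \<in> G" "\<And>x. x \<in> G \<Longrightarrow> adj c x \<in> G"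
    for c :: "'h operator" and x
  proof (rule uniq)
    show "c x - c (e x) \<in> V"
      using closure_span_invariant[OF blinfun.bounded_linear_right c(2)] eV
      unfolding V_def by (metis blinfun.diff_right)
    fix y assume "y \<in> V"
    then have "adj c y \<in> V"
      using closure_span_invariant[OF blinfun.bounded_linear_right c(3)] unfolding V_def by blast
    then show "inner (c (e x)) y = 0" by (simp add: eo flip: inner_adj_right[OF c(1)])
  qed
  have co: "p \<in> complex_operators"
    using comm[OF scalar_op_complex] G by (simp add: complex_operators_def p adj_scalar_op)
  show thesis
  proof (rule that[of p])
    show "adj p = p" by (rule adjoint_eqI[OF co]) (simp add: p inner_p)
    have "e (e x) = e x" for x by (rule uniq[symmetric]) (auto simp: eo subspace_0[OF sV])
    then show "p o\<^sub>L p = p" by (intro blinfun_eqI) (simp add: p)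
    show "\<forall>x\<in>G. p x = 0"
    proof
      fix x assume "x \<in> G"
      then show "p x = 0"
        unfolding p by (intro uniq[symmetric]) (auto simp: GV)
    qed
    show "\<forall>y::'h operator. (\<forall>x\<in>G. blinfun_apply y x = 0) \<longrightarrow> y o\<^sub>L p = y"
    proof (intro allI impI blinfun_eqI)
      fix y :: "'h operator" and x assume y: "\<forall>x\<in>G. blinfun_apply y x = 0"
      have "y (x - e x) = 0"
        using bounded_linear_eq_closure_span[of y "\<lambda>_. 0" G "x - e x"] y eV
        by (auto simp: V_def blinfun.bounded_linear_right)
      then show "(y o\<^sub>L p) x = y x" by (simp add: p blinfun.diff_right)
    qed
    show "\<forall>c\<in>complex_operators. (\<forall>x\<in>G. blinfun_apply c x \<in> G \<and> adj c x \<in> G) \<longrightarrow> c o\<^sub>L p = p o\<^sub>L c"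
      using comm by (intro ballI impI blinfun_eqI) (simp add: p)
    show "p = 0 \<longrightarrow> closure (span G) = UNIV"
      using eV unfolding V_def[symmetric] p[symmetric] by auto
  qed (rule co)
qed

text \<open>
  The isometry is given by pairs (argument, value). The inner product condition makes the two
  components of every element of the linear span of \<open>G\<close> equal in norm, so this span is the graph of an
  isometry, and the closure of the graph is the graph of its extension to the whole space.
\<close>

lemma isometry_extension:
  fixes G :: "('a::real_inner \<times> 'b::{real_inner,complete_space}) set"
  assumes iso: "\<And>g g'. g \<in> G \<Longrightarrow> g' \<in> G \<Longrightarrow> inner (fst g) (fst g') = inner (snd g) (snd g')"
    and dense: "closure (span (fst ` G)) = UNIV"
  obtains y :: "'a \<Rightarrow>\<^sub>L 'b" where "\<And>g. g \<in> G \<Longrightarrow> y (fst g) = snd g"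
    "\<And>a. norm (y a) = norm a"
proof -
  have iso1: "inner (fst g) (fst g') = inner (snd g) (snd g')" if "g \<in> span G" "g' \<in> G" for g g'
    using that(1) by (induction rule: span_induct_alt) (auto simp: inner_add_left iso that(2))
  have iso2: "inner (fst g) (fst g') = inner (snd g) (snd g')" if "g \<in> span G" "g' \<in> span G" for g g'
    using that(2) by (induction rule: span_induct_alt) (auto simp: inner_add_right iso1 that(1))
  have nrm: "norm (fst g) = norm (snd g)" if "g \<in> span G" for g
    using iso2[OF that that] by (simp add: norm_eq_sqrt_inner)
  define C where "C = closure (span G)"
  have sC: "subspace C" by (simp add: C_def subspace_closure)
  have nC: "norm (snd g) = norm (fst g)" if "g \<in> C" for g
  proof -
    have "closed {g :: 'a \<times> 'b. norm (snd g) = norm (fst g)}"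
      by (intro closed_Collect_eq continuous_intros)
    moreover have "span G \<subseteq> {g. norm (snd g) = norm (fst g)}" using nrm by auto
    ultimately show ?thesis using that closure_minimal unfolding C_def by blast
  qed
  have ex: "\<exists>b. (a, b) \<in> C" for a
  proof -
    have "span (fst ` G) = fst ` span G"
      by (rule linear_span_image[OF bounded_linear.linear[OF bounded_linear_fst]])
    then have "a \<in> closure (fst ` span G)" using dense by auto
    then obtain f where f: "\<And>n. f n \<in> fst ` span G" "f \<longlonglongrightarrow> a" by (auto simp: closure_sequential)
    then have "\<forall>n. \<exists>g. g \<in> span G \<and> fst g = f n" by (metis imageE)
    then obtain g where g: "\<And>n. g n \<in> span G" "\<And>n. fst (g n) = f n" by metis
    have "norm (snd (g m) - snd (g n)) = norm (f m - f n)" for m n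
      using nrm[OF span_diff[OF g(1)[of m] g(1)[of n]]] by (simp add: g(2))
    moreover have "Cauchy f" using f(2) by (rule LIMSEQ_imp_Cauchy)
    ultimately have "Cauchy (\<lambda>n. snd (g n))" by (simp add: Cauchy_def dist_norm)
    then obtain b where "(\<lambda>n. snd (g n)) \<longlonglongrightarrow> b" by (auto simp: Cauchy_convergent_iff convergent_def)
    then have "(\<lambda>n. (fst (g n), snd (g n))) \<longlonglongrightarrow> (a, b)"
      using f(2) by (intro tendsto_Pair) (simp_all add: g(2))
    then have "g \<longlonglongrightarrow> (a, b)" by simp
    then show ?thesis using g(1) unfolding C_def closure_sequential by blast
  qed
  then obtain y where y: "\<And>a. (a, y a) \<in> C" by metis
  have uniq: "b = y a" if "(a, b) \<in> C" for a b
    using nC[OF subspace_diff[OF sC that y[of a]]] by simp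
  have "bounded_linear y"
  proof (rule bounded_linear_intro)
    show "y (a + b) = y a + y b" for a b
      using subspace_add[OF sC y[of a] y[of b]] by (intro uniq[symmetric]) simp
    show "y (r *\<^sub>R a) = r *\<^sub>R y a" for r a
      using subspace_scale[OF sC y[of a], of r] by (intro uniq[symmetric]) simp
    show "norm (y a) \<le> norm a * 1" for a using nC[OF y[of a]] by simp
  qed
  then have ap: "blinfun_apply (Blinfun y) = y" by (rule bounded_linear_Blinfun_apply)
  show thesis
  proof (rule that[of "Blinfun y"])
    fix g assume "g \<in> G"
    then have "g \<in> C" using closure_subset span_base unfolding C_def by blast
    then show "Blinfun y (fst g) = snd g" using uniq[of "fst g" "snd g"] by (simp add: ap)
  next
    show "norm (Blinfun y a) = norm a" for a using nC[OF y[of a]] by (simp add: ap)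
  qed
qed

section \<open>Operator algebras and unitaries\<close>

lemma compose_assoc: "(a o\<^sub>L b) o\<^sub>L c = a o\<^sub>L (b o\<^sub>L c)"
  by (rule blinfun_eqI) simp

lemma compose_add_left: "(a + b) o\<^sub>L c = (a o\<^sub>L c) + (b o\<^sub>L c)"
  by (rule blinfun_eqI) (simp add: blinfun.bilinear_simps)

lemma compose_add_right: "a o\<^sub>L (b + c) = (a o\<^sub>L b) + (a o\<^sub>L c)"
  by (rule blinfun_eqI) (simp add: blinfun.bilinear_simps)

lemma compose_diff_left: "(a - b) o\<^sub>L c = (a o\<^sub>L c) - (b o\<^sub>L c)"
  by (rule blinfun_eqI) (simp add: blinfun.bilinear_simps)

lemma compose_diff_right: "a o\<^sub>L (b - c) = (a o\<^sub>L b) - (a o\<^sub>L c)"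
  by (rule blinfun_eqI) (simp add: blinfun.bilinear_simps)

lemma compose_id [simp]: "a o\<^sub>L id_blinfun = a" "id_blinfun o\<^sub>L a = a"
  by (auto intro: blinfun_eqI)

lemmas compose_algebra = compose_assoc compose_add_left compose_add_right
  compose_diff_left compose_diff_right

lemma scaleR_eq_scalar_op: "r *\<^sub>R a = scalar_op (of_real r) o\<^sub>L a"
  by (rule blinfun_eqI) (simp add: blinfun.bilinear_simps scaleC_of_real)

lemma scalar_op_compose: "scalar_op c o\<^sub>L (scalar_op d o\<^sub>L a) = scalar_op (c * d) o\<^sub>L a"
  by (rule blinfun_eqI) (simp add: scaleC_scaleC)

lemma scalar_op_1 [simp]: "scalar_op 1 = id_blinfun"
  by (rule blinfun_eqI) (metis scalar_op_apply scaleC_of_real of_real_1 scaleR_one blinfun_apply_id_blinfun id_apply)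

lemma scalar_op_0: "scalar_op 0 = 0"
  by (rule blinfun_eqI) (metis scalar_op_apply scaleC_of_real of_real_0 scaleR_zero_left zero_blinfun.rep_eq)

lemma compose_scalar_op:
  "a \<in> complex_operators \<Longrightarrow> a o\<^sub>L (scalar_op c o\<^sub>L b) = scalar_op c o\<^sub>L (a o\<^sub>L b)"
  by (rule blinfun_eqI) (simp add: complex_operatorsD)

lemma uminus_eq_scalar_op: "- a = scalar_op (- 1) o\<^sub>L a"
  using scaleR_eq_scalar_op[of "-1" a] by simp

lemma commutant_complex: "c \<in> commutant S \<Longrightarrow> c \<in> complex_operators"
  by (simp add: commutant_def)

lemma commutantD: "c \<in> commutant S \<Longrightarrow> a \<in> S \<Longrightarrow> a o\<^sub>L c = c o\<^sub>L a"
  by (simp add: commutant_def)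

lemma commutant_antimono: "S \<subseteq> T \<Longrightarrow> commutant T \<subseteq> commutant S"
  by (auto simp: commutant_def)

definition unitaries :: "'h::complex_hilbert operator set \<Rightarrow> 'h operator set" where
  "unitaries A = {u \<in> A. adj u o\<^sub>L u = id_blinfun \<and> u o\<^sub>L adj u = id_blinfun}"

locale von_neumann =
  fixes A :: "'h::complex_hilbert operator set"
  assumes vna: "von_neumann_algebra A"
begin

lemma complex: "a \<in> A \<Longrightarrow> a \<in> complex_operators"
  and id_mem [simp]: "id_blinfun \<in> A"
  and add_mem [simp]: "a \<in> A \<Longrightarrow> b \<in> A \<Longrightarrow> a + b \<in> A"
  and compose_mem [simp]: "a \<in> A \<Longrightarrow> b \<in> A \<Longrightarrow> a o\<^sub>L b \<in> A"
  and scalar_mem [simp]: "a \<in> A \<Longrightarrow> scalar_op c o\<^sub>L a \<in> A"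
  and adj_mem [simp]: "a \<in> A \<Longrightarrow> adj a \<in> A"
  using vna unfolding von_neumann_algebra_def by auto

lemma zero_mem [simp]: "0 \<in> A"
  using scalar_mem[OF id_mem, of 0] by (simp add: scalar_op_0)

lemma scaleR_mem [simp]: "a \<in> A \<Longrightarrow> r *\<^sub>R a \<in> A"
  by (simp add: scaleR_eq_scalar_op)

lemma uminus_mem [simp]: "a \<in> A \<Longrightarrow> - a \<in> A"
  by (simp add: uminus_eq_scalar_op)

lemma diff_mem [simp]: "a \<in> A \<Longrightarrow> b \<in> A \<Longrightarrow> a - b \<in> A"
  using add_mem[of a "- b"] by simp

lemma adj_adj_mem [simp]: "a \<in> A \<Longrightarrow> adj (adj a) = a"
  by (simp add: adj_adj complex)

lemma adj_compose_mem: "a \<in> A \<Longrightarrow> b \<in> A \<Longrightarrow> adj (a o\<^sub>L b) = adj b o\<^sub>L adj a"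
  by (simp add: adj_compose complex)

lemma adj_add_mem: "a \<in> A \<Longrightarrow> b \<in> A \<Longrightarrow> adj (a + b) = adj a + adj b"
  by (simp add: adj_add complex)

lemma adj_scalar_mem: "a \<in> A \<Longrightarrow> adj (scalar_op c o\<^sub>L a) = scalar_op (cnj c) o\<^sub>L adj a"
  by (rule blinfun_eqI)
    (simp add: adj_compose complex scalar_op_complex adj_scalar_op
      complex_operatorsD[OF complex[OF adj_mem]])

lemma adj_diff_mem: "a \<in> A \<Longrightarrow> b \<in> A \<Longrightarrow> adj (a - b) = adj a - adj b"
  using adj_add_mem[of a "- b"] adj_scalar_mem[of b "- 1"]
  by (simp flip: uminus_eq_scalar_op)

lemma bicommutant_memI:
  "x \<in> complex_operators \<Longrightarrow> (\<And>c. c \<in> commutant A \<Longrightarrow> c o\<^sub>L x = x o\<^sub>L c) \<Longrightarrow> x \<in> A"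
  using vna unfolding von_neumann_algebra_def commutant_def by blast

lemma commutant_adj: 
  assumes c: "c \<in> commutant A" shows "adj c \<in> commutant A"
proof -
  have "a o\<^sub>L adj c = adj c o\<^sub>L a" if a: "a \<in> A" for a
  proof -
    have "adj a o\<^sub>L c = c o\<^sub>L adj a" using c a by (simp add: commutantD)
    then have "adj (adj a o\<^sub>L c) = adj (c o\<^sub>L adj a)" by simp
    then show ?thesis using a c
      by (simp add: adj_compose complex commutant_complex adj_complex_operators)
  qed
  then show ?thesis using c
    by (simp add: commutant_def adj_complex_operators)
qed

lemma commutant_compose:
  assumes "c \<in> commutant A" "d \<in> commutant A" shows "c o\<^sub>L d \<in> commutant A"
proof -
  have "a o\<^sub>L (c o\<^sub>L d) = (c o\<^sub>L d) o\<^sub>L a" if "a \<in> A" for a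
    using commutantD[OF assms(1) that] commutantD[OF assms(2) that] by (metis compose_assoc)
  then show ?thesis using assms by (simp add: commutant_def complex_operators_compose)
qed

lemma scalar_commutant: "scalar_op c \<in> commutant A"
  using compose_scalar_op[OF complex, of _ c id_blinfun]
  by (simp add: commutant_def scalar_op_complex)

text \<open>
  The solution \<open>x\<close> of \<open>x + a x = y\<close> is the fixed point of the contraction \<open>x \<mapsto> y - a x\<close>. As the solution
  is unique, every operator that commutes with \<open>a\<close> commutes with the inverse, so the inverse lies in
  the bicommutant.
\<close>

lemma inverse_one_plus_small:
  assumes a: "a \<in> A" and na: "norm a \<le> 1/2"
  obtains b where "b \<in> A" "(id_blinfun + a) o\<^sub>L b = id_blinfun" "b o\<^sub>L (id_blinfun + a) = id_blinfun"
proof -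
  have na': "norm (a z) \<le> 1/2 * norm z" for z
    using norm_blinfun[of a z] mult_right_mono[OF na norm_ge_zero[of z]] by linarith
  have "\<exists>!x. y - a x = x" for y
  proof -
    have "dist (y - a x) (y - a z) \<le> 1/2 * dist x z" for x z
      using na'[of "z - x"] by (simp add: dist_norm blinfun.diff_right norm_minus_commute)
    then show ?thesis
      by (intro banach_fix_type[of "1/2"]) auto
  qed
  then obtain f where f: "\<And>y. y - a (f y) = f y" and u: "\<And>x y. y - a x = x \<Longrightarrow> x = f y"
    by metis
  have "bounded_linear f"
  proof (rule bounded_linear_intro)
    show "f (x + y) = f x + f y" for x y
      by (rule u[symmetric]) (metis add_diff_add blinfun.add_right f)
    show "f (r *\<^sub>R x) = r *\<^sub>R f x" for r x
      by (rule u[symmetric]) (metis blinfun.scaleR_right f scaleR_diff_right)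
    show "norm (f y) \<le> norm y * 2" for y
      using na'[of "f y"] norm_triangle_ineq4[of y "a (f y)"] f[of y] by simp
  qed
  then have ap: "blinfun_apply (Blinfun f) = f" by (rule bounded_linear_Blinfun_apply)
  have comm: "c (f y) = f (c y)" if "\<And>x. c (a x) = a (c x)" for c :: "'h operator" and y
    by (rule u) (metis blinfun.diff_right f that)
  show thesis
  proof (rule that[of "Blinfun f"])
    show "Blinfun f \<in> A"
    proof (rule bicommutant_memI)
      show "Blinfun f \<in> complex_operators"
        using comm[of "scalar_op _"] complex_operatorsD[OF complex[OF a]]
        by (simp add: complex_operators_def ap)
      fix c assume "c \<in> commutant A"
      then have "a o\<^sub>L c = c o\<^sub>L a" using a by (rule commutantD)
      then have "\<And>x. c (a x) = a (c x)" by (metis blinfun_apply_blinfun_compose)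
      then show "c o\<^sub>L Blinfun f = Blinfun f o\<^sub>L c"
        by (intro blinfun_eqI) (simp add: ap comm)
    qed
    have "f y + a (f y) = y" for y by (metis f diff_add_cancel)
    then show "(id_blinfun + a) o\<^sub>L Blinfun f = id_blinfun"
      by (intro blinfun_eqI) (simp add: ap blinfun.add_left)
    have "f (y + a y) = y" for y by (rule u[symmetric]) simp
    then show "Blinfun f o\<^sub>L (id_blinfun + a) = id_blinfun"
      by (intro blinfun_eqI) (simp add: ap blinfun.add_left)
  qed
qed

text \<open>
  The Cayley transform \<open>u = (1 - ih)(1 + ih)\<^sup>-\<^sup>1\<close> replaces the functional calculus that would be
  used to write a self-adjoint contraction as a mean of two unitaries: it needs only an inverse.
\<close>

lemma cayley_unitary:
  assumes h: "h \<in> A" and sa: "adj h = h" and nh: "norm h \<le> 1/2"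
  defines "w \<equiv> id_blinfun + (scalar_op \<i> o\<^sub>L h)"
  obtains u where "u \<in> unitaries A" "w o\<^sub>L (id_blinfun + u) = 2 *\<^sub>R id_blinfun"
    "(id_blinfun + u) o\<^sub>L w = 2 *\<^sub>R id_blinfun"
proof -
  define k where "k = scalar_op \<i> o\<^sub>L h"
  have k: "k \<in> A" using h by (simp add: k_def)
  have adj_k: "adj k = - k"
    using h by (simp add: k_def adj_scalar_mem sa uminus_eq_scalar_op[of "_ o\<^sub>L _"] scalar_op_compose)
  have "norm k \<le> 1 * norm h"
    unfolding k_def
    by (rule order_trans[OF norm_blinfun_compose], intro mult_right_mono norm_blinfun_bound)
      (simp_all add: norm_scaleC)
  then have nk: "norm k \<le> 1/2" using nh by simp
  obtain b where b: "b \<in> A" "(id_blinfun + k) o\<^sub>L b = id_blinfun" "b o\<^sub>L (id_blinfun + k) = id_blinfun"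
    using inverse_one_plus_small[OF k nk] by blast
  define b' where "b' = adj b"
  have b': "b' \<in> A" "b' o\<^sub>L (id_blinfun - k) = id_blinfun" "(id_blinfun - k) o\<^sub>L b' = id_blinfun"
  proof -
    have "b' o\<^sub>L (id_blinfun - k) = adj ((id_blinfun + k) o\<^sub>L b)"
      "(id_blinfun - k) o\<^sub>L b' = adj (b o\<^sub>L (id_blinfun + k))"
      using b(1) k by (simp_all add: b'_def adj_compose_mem adj_add_mem adj_k)
    then show "b' o\<^sub>L (id_blinfun - k) = id_blinfun" "(id_blinfun - k) o\<^sub>L b' = id_blinfun"
      by (simp_all add: b)
  qed (use b in \<open>simp add: b'_def\<close>)
  define u where "u = (id_blinfun - k) o\<^sub>L b"
  have u: "u \<in> A" using b k by (simp add: u_def)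
  have adj_u: "adj u = b' o\<^sub>L (id_blinfun + k)"
    using b k by (simp add: u_def b'_def adj_compose_mem adj_diff_mem adj_k)
  have kk: "(id_blinfun + k) o\<^sub>L (id_blinfun - k) = (id_blinfun - k) o\<^sub>L (id_blinfun + k)"
    by (simp add: compose_algebra)
  have "adj u o\<^sub>L u = b' o\<^sub>L (((id_blinfun + k) o\<^sub>L (id_blinfun - k)) o\<^sub>L b)"
    unfolding adj_u by (simp only: u_def compose_assoc)
  also have "\<dots> = (b' o\<^sub>L (id_blinfun - k)) o\<^sub>L ((id_blinfun + k) o\<^sub>L b)"
    by (simp only: kk compose_assoc)
  finally have uu: "adj u o\<^sub>L u = id_blinfun" by (simp add: b b')
  have bb: "b o\<^sub>L b' = b' o\<^sub>L b"
  proof -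
    have "b o\<^sub>L b' = (b' o\<^sub>L (id_blinfun - k)) o\<^sub>L (((id_blinfun + k) o\<^sub>L b) o\<^sub>L (b o\<^sub>L b'))"
      by (simp add: b b')
    also have "\<dots> = b' o\<^sub>L (((id_blinfun + k) o\<^sub>L (id_blinfun - k)) o\<^sub>L (b o\<^sub>L (b o\<^sub>L b')))"
      by (simp only: kk compose_assoc)
    also have "\<dots> = b' o\<^sub>L b"
    proof -
      have kb: "k o\<^sub>L b = b o\<^sub>L k"
        using b(2,3) by (simp add: compose_algebra algebra_simps) (metis add_left_cancel)
      have "(id_blinfun - k) o\<^sub>L (b o\<^sub>L (b o\<^sub>L b')) = b o\<^sub>L (b o\<^sub>L ((id_blinfun - k) o\<^sub>L b'))"
        by (simp add: compose_diff_left compose_diff_right) (metis kb compose_assoc)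
      then have "(id_blinfun - k) o\<^sub>L (b o\<^sub>L (b o\<^sub>L b')) = b o\<^sub>L b" by (simp add: b')
      then show ?thesis by (simp only: compose_assoc) (metis b(2) compose_assoc compose_id(2))
    qed
    finally show ?thesis .
  qed
  have "u o\<^sub>L adj u = (id_blinfun - k) o\<^sub>L ((b o\<^sub>L b') o\<^sub>L (id_blinfun + k))"
    unfolding adj_u by (simp only: u_def compose_assoc)
  also have "\<dots> = ((id_blinfun - k) o\<^sub>L b') o\<^sub>L (b o\<^sub>L (id_blinfun + k))"
    by (simp only: bb compose_assoc)
  finally have "u o\<^sub>L adj u = id_blinfun" by (simp add: b b')
  with u uu have "u \<in> unitaries A" by (simp add: unitaries_def)
  moreover have "id_blinfun + u = 2 *\<^sub>R b"
  proof -
    have "id_blinfun + u = ((id_blinfun + k) o\<^sub>L b) + ((id_blinfun - k) o\<^sub>L b)"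
      by (simp add: b u_def)
    then show ?thesis by (simp add: compose_algebra scaleR_2)
  qed
  ultimately show thesis
    using b(2,3) by (intro that[of u])
      (simp_all only: w_def k_def[symmetric] scaleR_2 compose_add_right[of _ b b] compose_add_left[of b b])
qed

text \<open>
  If \<open>v\<close> intertwines the Cayley transform \<open>u\<close> of \<open>h\<close> with its image, it intertwines the inverse
  \<open>2 (1 + u)\<^sup>-\<^sup>1\<close>, which is \<open>1 + ih\<close>, and so \<open>h\<close>. Small self-adjoint elements span the algebra.
\<close>

lemma intertwining_from_unitaries:
  assumes add: "\<And>a b. a \<in> A \<Longrightarrow> b \<in> A \<Longrightarrow> \<theta> (a + b) = \<theta> a + \<theta> b"
    and mult: "\<And>a b. a \<in> A \<Longrightarrow> b \<in> A \<Longrightarrow> \<theta> (a o\<^sub>L b) = \<theta> a o\<^sub>L \<theta> b"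
    and scal: "\<And>c a. a \<in> A \<Longrightarrow> \<theta> (scalar_op c o\<^sub>L a) = scalar_op c o\<^sub>L \<theta> a"
    and one: "\<theta> id_blinfun = id_blinfun"
    and v: "v \<in> complex_operators"
    and unit: "\<And>u. u \<in> unitaries A \<Longrightarrow> v o\<^sub>L \<theta> u = u o\<^sub>L v"
    and a: "a \<in> A"
  shows "v o\<^sub>L \<theta> a = a o\<^sub>L v"
proof -
  let ?I = "id_blinfun :: 'h operator"
  have scal_closed: "v o\<^sub>L \<theta> (scalar_op c o\<^sub>L x) = (scalar_op c o\<^sub>L x) o\<^sub>L v"
    if "x \<in> A" "v o\<^sub>L \<theta> x = x o\<^sub>L v" for c x
    using that v by (simp add: scal compose_scalar_op compose_assoc)
  have small: "v o\<^sub>L \<theta> h = h o\<^sub>L v" if h: "h \<in> A" "adj h = h" "norm h \<le> 1/2" for h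
  proof -
    define w where "w = ?I + (scalar_op \<i> o\<^sub>L h)"
    have w: "w \<in> A" using h by (simp add: w_def)
    obtain u where u: "u \<in> unitaries A" "w o\<^sub>L (?I + u) = 2 *\<^sub>R ?I" "(?I + u) o\<^sub>L w = 2 *\<^sub>R ?I"
      using cayley_unitary[OF h] unfolding w_def by blast
    have uA: "u \<in> A" using u by (simp add: unitaries_def)
    have "\<theta> ((?I + u) o\<^sub>L w) = \<theta> (scalar_op (of_real 2) o\<^sub>L ?I)"
      by (simp only: u scaleR_eq_scalar_op)
    also have "\<dots> = 2 *\<^sub>R ?I" by (simp only: scal[OF id_mem] one scaleR_eq_scalar_op)
    finally have \<theta>w: "(?I + \<theta> u) o\<^sub>L \<theta> w = 2 *\<^sub>R ?I"
      using uA w by (simp add: mult add one)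
    have vu: "v o\<^sub>L (?I + \<theta> u) = (?I + u) o\<^sub>L v"
      by (simp add: compose_algebra unit[OF u(1)])
    have "2 *\<^sub>R (w o\<^sub>L v) = w o\<^sub>L (v o\<^sub>L ((?I + \<theta> u) o\<^sub>L \<theta> w))"
      by (simp add: \<theta>w scaleR_2 compose_add_right)
    also have "\<dots> = w o\<^sub>L ((v o\<^sub>L (?I + \<theta> u)) o\<^sub>L \<theta> w)" by (simp only: compose_assoc)
    also have "\<dots> = (w o\<^sub>L (?I + u)) o\<^sub>L (v o\<^sub>L \<theta> w)" by (simp only: vu compose_assoc)
    also have "\<dots> = 2 *\<^sub>R (v o\<^sub>L \<theta> w)" by (simp add: u scaleR_2 compose_add_left)
    finally have "w o\<^sub>L v = v o\<^sub>L \<theta> w" by simp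
    then have "v o\<^sub>L \<theta> (scalar_op \<i> o\<^sub>L h) = (scalar_op \<i> o\<^sub>L h) o\<^sub>L v"
      using h by (simp add: w_def add one compose_add_left compose_add_right)
    then have "v o\<^sub>L \<theta> (scalar_op (-\<i>) o\<^sub>L (scalar_op \<i> o\<^sub>L h)) = (scalar_op (-\<i>) o\<^sub>L (scalar_op \<i> o\<^sub>L h)) o\<^sub>L v"
      using h by (intro scal_closed[OF scalar_mem]) auto
    then show ?thesis by (simp add: scalar_op_compose)
  qed
  have sa: "v o\<^sub>L \<theta> h = h o\<^sub>L v" if h: "h \<in> A" "adj h = h" for h
  proof -
    define r where "r = 2 * norm h + 1"
    have r: "0 < r" by (simp add: r_def add_nonneg_pos)
    define g where "g = scalar_op (of_real (1 / r)) o\<^sub>L h"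
    have g: "g = (1 / r) *\<^sub>R h" by (simp only: g_def scaleR_eq_scalar_op)
    have "norm g \<le> 1/2" using r by (simp add: g r_def field_simps)
    moreover have "adj g = g" "g \<in> A" using h by (simp_all add: g_def adj_scalar_mem)
    ultimately have "v o\<^sub>L \<theta> (scalar_op (of_real r) o\<^sub>L g) = (scalar_op (of_real r) o\<^sub>L g) o\<^sub>L v"
      by (intro scal_closed small) auto
    moreover have "scalar_op (of_real r) o\<^sub>L g = h"
      using r by (simp add: g flip: scaleR_eq_scalar_op)
    ultimately show ?thesis by simp
  qed
  \<comment> \<open>\<open>h1\<close> and \<open>h2\<close> are self-adjoint with \<open>h1 + \<i> h2 = 2 a\<close>\<close>
  define h1 where "h1 = a + adj a"
  define h2 where "h2 = scalar_op \<i> o\<^sub>L (adj a - a)"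
  have hA: "h1 \<in> A" "h2 \<in> A" using a by (simp_all add: h1_def h2_def)
  have "adj h1 = h1" using a by (simp add: h1_def adj_add_mem add.commute)
  moreover have "adj h2 = h2"
  proof -
    have "adj h2 = scalar_op (- \<i>) o\<^sub>L (- (adj a - a))"
      using a by (simp add: h2_def adj_scalar_mem adj_diff_mem)
    also have "\<dots> = h2" by (simp only: uminus_eq_scalar_op scalar_op_compose h2_def) simp
    finally show ?thesis .
  qed
  ultimately have "v o\<^sub>L \<theta> h1 = h1 o\<^sub>L v" "v o\<^sub>L \<theta> (scalar_op \<i> o\<^sub>L h2) = (scalar_op \<i> o\<^sub>L h2) o\<^sub>L v"
    using hA sa scal_closed by blast+
  then have "v o\<^sub>L \<theta> (h1 + (scalar_op \<i> o\<^sub>L h2)) = (h1 + (scalar_op \<i> o\<^sub>L h2)) o\<^sub>L v"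
    using hA by (simp add: add compose_add_left compose_add_right)
  moreover have "h1 + (scalar_op \<i> o\<^sub>L h2) = scalar_op 2 o\<^sub>L a"
  proof -
    have "scalar_op \<i> o\<^sub>L h2 = - (adj a - a)"
      by (simp add: h2_def scalar_op_compose flip: uminus_eq_scalar_op)
    moreover have "scalar_op 2 o\<^sub>L a = a + a" using scaleR_eq_scalar_op[of 2 a] by (simp add: scaleR_2)
    ultimately show ?thesis by (simp add: h1_def)
  qed
  ultimately have "v o\<^sub>L \<theta> (scalar_op (1/2) o\<^sub>L (scalar_op 2 o\<^sub>L a)) = (scalar_op (1/2) o\<^sub>L (scalar_op 2 o\<^sub>L a)) o\<^sub>L v"
    using a by (intro scal_closed[OF scalar_mem]) auto
  then show ?thesis by (simp add: scalar_op_compose)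
qed

end

section \<open>The trace norm\<close>

text \<open>
  The ratios of consecutive terms of a log-convex sequence increase. If \<open>r 1\<close> were larger than \<open>r 0\<close>,
  the sequence would grow at least geometrically.
\<close>

lemma log_convex_bounded:
  fixes r :: "nat \<Rightarrow> real"
  assumes nonneg: "\<And>k. 0 \<le> r k" and conv: "\<And>k. (r (Suc k))\<^sup>2 \<le> r k * r (Suc (Suc k))"
    and bdd: "\<And>k. r k \<le> B"
  shows "r 1 \<le> r 0"
proof (rule ccontr)
  assume "\<not> r 1 \<le> r 0"
  then have lt: "r 0 < r 1" by simp
  have pos: "0 < r 0"
  proof (rule ccontr)
    assume "\<not> 0 < r 0"
    then have "r 0 = 0" using nonneg[of 0] by simp
    then have "r 1 = 0" using conv[of 0] by simp
    then show False using lt nonneg[of 0] by simp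
  qed
  define c where "c = r 1 / r 0"
  have c: "1 < c" using lt pos by (simp add: c_def)
  have grow: "0 < r k \<and> c * r k \<le> r (Suc k)" for k
  proof (induction k)
    case 0 show ?case using pos by (simp add: c_def)
  next
    case (Suc k)
    have p: "0 < r (Suc k)" using Suc c by (smt (verit) mult_pos_pos)
    have "r (Suc k) * (c * r (Suc k)) = c * (r (Suc k))\<^sup>2" by (simp add: power2_eq_square)
    also have "\<dots> \<le> c * (r k * r (Suc (Suc k)))" using conv[of k] c by simp
    also have "\<dots> = (c * r k) * r (Suc (Suc k))" by simp
    also have "\<dots> \<le> r (Suc k) * r (Suc (Suc k))"
      using Suc nonneg by (intro mult_right_mono) auto
    finally show ?case using p by simp
  qed
  have "c ^ k * r 0 \<le> r k" for k
  proof (induction k)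
    case (Suc k)
    have "c ^ Suc k * r 0 = c * (c ^ k * r 0)" by simp
    also have "\<dots> \<le> c * r k" using Suc c by (intro mult_left_mono) auto
    also have "\<dots> \<le> r (Suc k)" using grow by blast
    finally show ?case .
  qed simp
  moreover obtain n where "B / r 0 < c ^ n" using real_arch_pow[OF c] by blast
  ultimately show False using bdd[of n] pos by (smt (verit) pos_divide_less_eq)
qed

definition mass :: "(nat \<Rightarrow> 'h::complex_hilbert) \<Rightarrow> 'h operator \<Rightarrow> real" where
  "mass \<zeta> x = (\<Sum>n. (norm (x (\<zeta> n)))\<^sup>2)"

abbreviation square_summable :: "(nat \<Rightarrow> 'a::real_normed_vector) \<Rightarrow> bool" where
  "square_summable \<zeta> \<equiv> summable (\<lambda>n. (norm (\<zeta> n))\<^sup>2)"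

lemma norm_apply_square_le: "(norm (blinfun_apply x z))\<^sup>2 \<le> (norm x)\<^sup>2 * (norm z)\<^sup>2"
  by (metis norm_blinfun norm_ge_zero power_mono power_mult_distrib)

lemma mass_summable:
  assumes "square_summable \<zeta>" shows "summable (\<lambda>n. (norm (blinfun_apply x (\<zeta> n)))\<^sup>2)"
  by (rule summable_comparison_test'[where g = "\<lambda>n. (norm x)\<^sup>2 * (norm (\<zeta> n))\<^sup>2" and N = 0])
    (auto intro: summable_mult assms norm_apply_square_le)

lemma mass_nonneg: "square_summable \<zeta> \<Longrightarrow> 0 \<le> mass \<zeta> x"
  unfolding mass_def by (intro suminf_nonneg mass_summable) auto

lemma mass_le:
  assumes "square_summable \<zeta>" shows "mass \<zeta> x \<le> (norm x)\<^sup>2 * (\<Sum>n. (norm (\<zeta> n))\<^sup>2)"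
  unfolding mass_def suminf_mult[OF assms, symmetric]
  by (intro suminf_le norm_apply_square_le mass_summable assms summable_mult)

lemma apply_le_mass:
  assumes "square_summable \<zeta>" shows "(norm (blinfun_apply x (\<zeta> n)))\<^sup>2 \<le> mass \<zeta> x"
  unfolding mass_def
  using sum_le_suminf[OF mass_summable[OF assms, of x], of "{n}"] by simp

lemma mass_median:
  assumes "square_summable \<zeta>"
  shows "4 * mass \<zeta> ((1/2) *\<^sub>R (x + y)) + mass \<zeta> (x - y) = 2 * mass \<zeta> x + 2 * mass \<zeta> y"
proof -
  have "4 * (norm (((1/2) *\<^sub>R (x + y)) (\<zeta> n)))\<^sup>2 + (norm ((x - y) (\<zeta> n)))\<^sup>2
      = 2 * (norm (x (\<zeta> n)))\<^sup>2 + 2 * (norm (y (\<zeta> n)))\<^sup>2" for n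
    unfolding power2_norm_eq_inner
    by (simp add: blinfun.bilinear_simps inner_simps inner_commute field_simps)
  then show ?thesis
    unfolding mass_def
    by (simp add: suminf_mult[symmetric] suminf_add mass_summable[OF assms] summable_mult
        del: suminf_mult)
qed

lemma cmod_cinner_adj_le:
  assumes x: "x \<in> complex_operators"
  shows "cmod (cinner \<xi> ((adj x o\<^sub>L x) \<eta>)) \<le> (norm (blinfun_apply x \<xi>))\<^sup>2 + (norm (x \<eta>))\<^sup>2"
proof -
  have "Re (cinner \<xi> ((adj x o\<^sub>L x) \<eta>)) = inner (x \<xi>) (x \<eta>)"
    by (simp add: Re_cinner inner_adj_right[OF x])
  moreover have "Im (cinner \<xi> ((adj x o\<^sub>L x) \<eta>)) = - inner (x \<xi>) (\<i> *\<^sub>C x \<eta>)"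
    by (simp add: Im_cinner inner_adj_right[OF x]
        flip: complex_operatorsD[OF adj_complex_operators[OF x]])
  ultimately have "cmod (cinner \<xi> ((adj x o\<^sub>L x) \<eta>)) \<le> \<bar>inner (x \<xi>) (x \<eta>)\<bar> + \<bar>inner (x \<xi>) (\<i> *\<^sub>C x \<eta>)\<bar>"
    using cmod_le[of "cinner \<xi> ((adj x o\<^sub>L x) \<eta>)"] by simp
  also have "\<dots> \<le> norm (x \<xi>) * norm (x \<eta>) + norm (x \<xi>) * norm (\<i> *\<^sub>C x \<eta>)"
    by (intro add_mono Cauchy_Schwarz_ineq2)
  also have "\<dots> = 2 * (norm (x \<xi>) * norm (x \<eta>))" by (simp add: norm_scaleC)
  also have "\<dots> \<le> (norm (x \<xi>))\<^sup>2 + (norm (x \<eta>))\<^sup>2"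
    using sum_squares_bound[of "norm (x \<xi>)" "norm (x \<eta>)"] by simp
  finally show ?thesis .
qed

text \<open>
  A basic neighbourhood restricts finitely many functionals \<open>a \<mapsto> \<Sum>\<^sub>n \<langle>\<xi>\<^sub>n, a \<eta>\<^sub>n\<rangle>\<close>. On \<open>a = x\<^sup>* x\<close> such
  a functional is bounded by \<open>\<Sum>\<^sub>n \<parallel>x \<xi>\<^sub>n\<parallel>\<^sup>2 + \<parallel>x \<eta>\<^sub>n\<parallel>\<^sup>2\<close>, whence a condition on finitely many square-summable
  sequences suffices.
\<close>

lemma ultraweak_neighbourhood_of_0:
  fixes U :: "'h::complex_hilbert operator set"
  assumes "openin ultraweak_topology U" and "0 \<in> U"
  obtains F :: "(nat \<Rightarrow> 'h) set" and \<delta> where "finite F" "\<And>\<zeta>. \<zeta> \<in> F \<Longrightarrow> square_summable \<zeta>" "0 < \<delta>"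
    "\<And>x. x \<in> complex_operators \<Longrightarrow> (\<Sum>\<zeta>\<in>F. mass \<zeta> x) < \<delta> \<Longrightarrow> adj x o\<^sub>L x \<in> U"
proof -
  define S :: "'h operator set set" where
    "S = {{a. (\<Sum>n. cinner (\<xi> n) (blinfun_apply a (\<eta> n))) \<in> U} | (\<xi> :: nat \<Rightarrow> 'h) \<eta> U.
        square_summable \<xi> \<and> square_summable \<eta> \<and> open U}"
  have "generate_topology_on S U"
    using assms(1) unfolding ultraweak_topology_def S_def by (rule openin_topology_generated_by)
  then have "0 \<in> U \<longrightarrow> (\<exists>(F :: (nat \<Rightarrow> 'h) set) \<delta>. finite F \<and> (\<forall>\<zeta>\<in>F. square_summable \<zeta>) \<and> 0 < \<delta> \<and>
    (\<forall>x\<in>complex_operators. (\<Sum>\<zeta>\<in>F. mass \<zeta> x) < \<delta> \<longrightarrow> adj x o\<^sub>L x \<in> U))"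
  proof induction
    case (Int a b)
    show ?case
    proof
      assume "0 \<in> a \<inter> b"
      with Int obtain F \<delta> G \<epsilon> where
        F: "finite F" "\<forall>\<zeta>\<in>F. square_summable (\<zeta> :: nat \<Rightarrow> 'h)" "0 < \<delta>"
        "\<forall>x\<in>complex_operators. (\<Sum>\<zeta>\<in>F. mass \<zeta> x) < \<delta> \<longrightarrow> adj x o\<^sub>L x \<in> a" and
        G: "finite G" "\<forall>\<zeta>\<in>G. square_summable (\<zeta> :: nat \<Rightarrow> 'h)" "0 < \<epsilon>"
        "\<forall>x\<in>complex_operators. (\<Sum>\<zeta>\<in>G. mass \<zeta> x) < \<epsilon> \<longrightarrow> adj x o\<^sub>L x \<in> b"
        by auto
      have "(\<Sum>\<zeta>\<in>F. mass \<zeta> x) \<le> (\<Sum>\<zeta>\<in>F \<union> G. mass \<zeta> x)"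
        "(\<Sum>\<zeta>\<in>G. mass \<zeta> x) \<le> (\<Sum>\<zeta>\<in>F \<union> G. mass \<zeta> x)" for x
        using F(1,2) G(1,2) by (auto intro!: sum_mono2 mass_nonneg)
      then have "\<forall>x\<in>complex_operators. (\<Sum>\<zeta>\<in>F \<union> G. mass \<zeta> x) < min \<delta> \<epsilon> \<longrightarrow> adj x o\<^sub>L x \<in> a \<inter> b"
        using F(4) G(4) by (metis IntI min_less_iff_conj order_le_less_trans)
      then show "\<exists>(F :: (nat \<Rightarrow> 'h) set) \<delta>. finite F \<and> (\<forall>\<zeta>\<in>F. square_summable \<zeta>) \<and> 0 < \<delta> \<and>
          (\<forall>x\<in>complex_operators. (\<Sum>\<zeta>\<in>F. mass \<zeta> x) < \<delta> \<longrightarrow> adj x o\<^sub>L x \<in> a \<inter> b)"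
        using F G by (intro exI[of _ "F \<union> G"] exI[of _ "min \<delta> \<epsilon>"]) auto
    qed
  next
    case (UN K)
    then show ?case by (meson Union_iff)
  next
    case (Basis s)
    then obtain \<xi> \<eta> V where s: "s = {a. (\<Sum>n. cinner (\<xi> n) (blinfun_apply a (\<eta> n))) \<in> V}"
      and sq: "square_summable \<xi>" "square_summable \<eta>" and V: "open V"
      unfolding S_def by blast
    show ?case
    proof
      assume "0 \<in> s"
      have "cinner x 0 = 0" for x :: 'h using cinner_add_right[of x 0 0] by simp
      then have "0 \<in> V" using \<open>0 \<in> s\<close> by (simp add: s)
      then obtain r where r: "0 < r" "ball 0 r \<subseteq> V" using V open_contains_ball by blast
      have "adj x o\<^sub>L x \<in> s" if x: "x \<in> complex_operators" and small: "(\<Sum>\<zeta>\<in>{\<xi>, \<eta>}. mass \<zeta> x) < r / 2" for x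
      proof -
        let ?f = "\<lambda>n. cinner (\<xi> n) ((adj x o\<^sub>L x) (\<eta> n))"
        let ?g = "\<lambda>n. (norm (x (\<xi> n)))\<^sup>2 + (norm (x (\<eta> n)))\<^sup>2"
        have sg: "summable ?g" by (intro summable_add mass_summable sq)
        have sf: "summable (\<lambda>n. norm (?f n))"
          by (rule summable_comparison_test'[OF sg, of 0]) (use cmod_cinner_adj_le[OF x] in auto)
        have "norm (\<Sum>n. ?f n) \<le> (\<Sum>n. norm (?f n))" by (rule summable_norm[OF sf])
        also have "\<dots> \<le> (\<Sum>n. ?g n)" by (intro suminf_le sf sg cmod_cinner_adj_le[OF x])
        also have "\<dots> = mass \<xi> x + mass \<eta> x"
          unfolding mass_def by (intro suminf_add[symmetric] mass_summable sq)
        also have "\<dots> < r"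
        proof -
          have "mass \<xi> x \<le> (\<Sum>\<zeta>\<in>{\<xi>, \<eta>}. mass \<zeta> x)" "mass \<eta> x \<le> (\<Sum>\<zeta>\<in>{\<xi>, \<eta>}. mass \<zeta> x)"
            by (intro member_le_sum; use sq in \<open>auto simp: mass_nonneg\<close>)+
          then show ?thesis using small by linarith
        qed
        finally have "(\<Sum>n. ?f n) \<in> V" using r(2) by (auto simp: subset_iff dist_norm)
        then show ?thesis by (simp add: s)
      qed
      then show "\<exists>(F :: (nat \<Rightarrow> 'h) set) \<delta>. finite F \<and> (\<forall>\<zeta>\<in>F. square_summable \<zeta>) \<and> 0 < \<delta> \<and>
          (\<forall>x\<in>complex_operators. (\<Sum>\<zeta>\<in>F. mass \<zeta> x) < \<delta> \<longrightarrow> adj x o\<^sub>L x \<in> s)"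
        using r(1) sq by (intro exI[of _ "{\<xi>, \<eta>}"] exI[of _ "r / 2"]) auto
    qed
  qed simp
  then obtain F :: "(nat \<Rightarrow> 'h) set" and \<delta> where
    "finite F" "\<forall>\<zeta>\<in>F. square_summable \<zeta>" "0 < \<delta>"
    "\<forall>x\<in>complex_operators. (\<Sum>\<zeta>\<in>F. mass \<zeta> x) < \<delta> \<longrightarrow> adj x o\<^sub>L x \<in> U"
    using assms(2) by auto
  then show thesis by (intro that[of F \<delta>]) auto
qed

locale tracial = von_neumann A for A :: "'h::complex_hilbert operator set" +
  fixes \<tau> :: "'h operator \<Rightarrow> complex"
  assumes trace: "faithful_normal_tracial_state A \<tau>"
begin

lemma trace_add: "a \<in> A \<Longrightarrow> b \<in> A \<Longrightarrow> \<tau> (a + b) = \<tau> a + \<tau> b"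
  and trace_scalar: "a \<in> A \<Longrightarrow> \<tau> (scalar_op c o\<^sub>L a) = c * \<tau> a"
  and trace_one: "\<tau> id_blinfun = 1"
  and trace_faithful: "a \<in> A \<Longrightarrow> \<tau> (adj a o\<^sub>L a) = 0 \<Longrightarrow> a = 0"
  and trace_commute: "a \<in> A \<Longrightarrow> b \<in> A \<Longrightarrow> \<tau> (a o\<^sub>L b) = \<tau> (b o\<^sub>L a)"
  and trace_normal: "normal_functional A \<tau>"
  using trace unfolding faithful_normal_tracial_state_def by simp_all

lemma trace_pos: "a \<in> A \<Longrightarrow> \<tau> (adj a o\<^sub>L a) \<in> \<real>\<^sub>\<ge>\<^sub>0"
  using trace unfolding faithful_normal_tracial_state_def by meson

lemma trace_scaleR: "a \<in> A \<Longrightarrow> \<tau> (r *\<^sub>R a) = of_real r * \<tau> a"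
  by (simp add: scaleR_eq_scalar_op trace_scalar)

definition trace_inner :: "'h operator \<Rightarrow> 'h operator \<Rightarrow> real" where
  "trace_inner x y = Re (\<tau> (adj x o\<^sub>L y))"

text \<open>
  The reality of \<open>\<tau>(b\<^sup>* b)\<close> for \<open>b = 1 + ia\<close> says that \<open>\<tau>(a)\<close> and \<open>\<tau>(a\<^sup>*)\<close> have the same real part. This is
  the symmetry of the real inner product defined by the trace.
\<close>

lemma Re_trace_adj: 
  assumes a: "a \<in> A" shows "Re (\<tau> (adj a)) = Re (\<tau> a)"
proof -
  define b where "b = id_blinfun + (scalar_op \<i> o\<^sub>L a)"
  have b: "b \<in> A" using a by (simp add: b_def)
  have "adj b = id_blinfun + (scalar_op (- \<i>) o\<^sub>L adj a)"
    using a by (simp add: b_def adj_add_mem adj_scalar_mem)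
  then have "adj b o\<^sub>L b = (id_blinfun + (scalar_op (- \<i>) o\<^sub>L adj a))
      + ((scalar_op \<i> o\<^sub>L a) + (adj a o\<^sub>L a))"
    using a by (simp add: b_def compose_add_left compose_add_right compose_assoc
        compose_scalar_op[OF complex] scalar_op_compose)
  then have "\<tau> (adj b o\<^sub>L b) = 1 - \<i> * \<tau> (adj a) + \<i> * \<tau> a + \<tau> (adj a o\<^sub>L a)"
    using a by (simp add: trace_add trace_scalar trace_one)
  then have "Im (\<tau> (adj b o\<^sub>L b)) = - Re (\<tau> (adj a)) + Re (\<tau> a) + Im (\<tau> (adj a o\<^sub>L a))" by simp
  moreover have "Im (\<tau> (adj b o\<^sub>L b)) = 0" "Im (\<tau> (adj a o\<^sub>L a)) = 0"
    using trace_pos[OF a] trace_pos[OF b] by (auto simp: complex_nonneg_Reals_iff)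
  ultimately show ?thesis by simp
qed

lemma trace_inner_commute: "x \<in> A \<Longrightarrow> y \<in> A \<Longrightarrow> trace_inner x y = trace_inner y x"
  using Re_trace_adj[of "adj x o\<^sub>L y"] by (simp add: trace_inner_def adj_compose_mem)

lemma trace_inner_add_right: "x \<in> A \<Longrightarrow> y \<in> A \<Longrightarrow> z \<in> A \<Longrightarrow>
    trace_inner x (y + z) = trace_inner x y + trace_inner x z"
  by (simp add: trace_inner_def compose_add_right trace_add)

lemma trace_inner_scale_right: "x \<in> A \<Longrightarrow> y \<in> A \<Longrightarrow>
    trace_inner x (r *\<^sub>R y) = r * trace_inner x y"
proof -
  have "adj x o\<^sub>L (r *\<^sub>R y) = r *\<^sub>R (adj x o\<^sub>L y)"
    by (rule blinfun_eqI) (simp add: blinfun.bilinear_simps)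
  then show "x \<in> A \<Longrightarrow> y \<in> A \<Longrightarrow> ?thesis" by (simp add: trace_inner_def trace_scaleR)
qed

lemma trace_inner_add_left: "x \<in> A \<Longrightarrow> y \<in> A \<Longrightarrow> z \<in> A \<Longrightarrow>
    trace_inner (x + y) z = trace_inner x z + trace_inner y z"
  by (simp add: trace_inner_commute[of _ z] trace_inner_add_right)

lemma trace_inner_scale_left: "x \<in> A \<Longrightarrow> y \<in> A \<Longrightarrow>
    trace_inner (r *\<^sub>R x) y = r * trace_inner x y"
  by (simp add: trace_inner_commute[of _ y] trace_inner_scale_right)

lemma trace_inner_uminus_right: "x \<in> A \<Longrightarrow> y \<in> A \<Longrightarrow> trace_inner x (- y) = - trace_inner x y"
  using trace_inner_scale_right[of x y "-1"] by simp

lemma trace_inner_diff_right: "x \<in> A \<Longrightarrow> y \<in> A \<Longrightarrow> z \<in> A \<Longrightarrow>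
    trace_inner x (y - z) = trace_inner x y - trace_inner x z"
  using trace_inner_add_right[of x y "- z"] by (simp add: trace_inner_uminus_right)

lemma trace_inner_diff_left: "x \<in> A \<Longrightarrow> y \<in> A \<Longrightarrow> z \<in> A \<Longrightarrow>
    trace_inner (x - y) z = trace_inner x z - trace_inner y z"
  by (simp add: trace_inner_commute[of _ z] trace_inner_diff_right)

lemmas trace_inner_simps = trace_inner_add_right trace_inner_scale_right trace_inner_add_left
  trace_inner_scale_left trace_inner_diff_right trace_inner_diff_left

lemma norm2_square: "x \<in> A \<Longrightarrow> (norm2 \<tau> x)\<^sup>2 = trace_inner x x"
  and norm2_nonneg [simp]: "x \<in> A \<Longrightarrow> 0 \<le> norm2 \<tau> x"
  using trace_pos[of x]
  by (auto simp: norm2_def trace_inner_def complex_nonneg_Reals_iff)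

lemma norm2_eq_0: 
  assumes x: "x \<in> A" and 0: "norm2 \<tau> x = 0" shows "x = 0"
proof -
  have "Re (\<tau> (adj x o\<^sub>L x)) = 0" "Im (\<tau> (adj x o\<^sub>L x)) = 0"
    using trace_pos[OF x] 0 by (auto simp: norm2_def complex_nonneg_Reals_iff)
  then show ?thesis using trace_faithful[OF x] by (simp add: complex_eq_iff)
qed

lemma norm2_0 [simp]: "norm2 \<tau> 0 = 0"
  using trace_scalar[of 0 0] by (simp add: norm2_def scalar_op_0)

lemma trace_inner_cauchy_schwarz:
  assumes x: "x \<in> A" and y: "y \<in> A"
  shows "trace_inner x y \<le> norm2 \<tau> x * norm2 \<tau> y"
proof (cases "norm2 \<tau> y = 0")
  case True
  then have "y = 0" using norm2_eq_0 y by blast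
  then show ?thesis using trace_inner_scale_right[of x 0 0] x by simp
next
  case False
  define t where "t = trace_inner x y / trace_inner y y"
  have pos: "0 < trace_inner y y"
    unfolding norm2_square[OF y, symmetric] using False by simp
  have "x - t *\<^sub>R y \<in> A" using x y by simp
  then have "0 \<le> trace_inner (x - t *\<^sub>R y) (x - t *\<^sub>R y)"
    by (simp flip: norm2_square)
  also have "\<dots> = trace_inner x x - 2 * t * trace_inner x y + t * t * trace_inner y y"
    using x y by (simp add: trace_inner_simps trace_inner_commute[of y x] algebra_simps)
  also have "\<dots> = trace_inner x x - (trace_inner x y)\<^sup>2 / trace_inner y y"
    using pos by (simp add: t_def power2_eq_square field_simps)
  finally have "(trace_inner x y)\<^sup>2 \<le> trace_inner x x * trace_inner y y"
    using pos by (simp add: field_simps)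
  also have "\<dots> = (norm2 \<tau> x * norm2 \<tau> y)\<^sup>2" using x y by (simp add: norm2_square power_mult_distrib)
  finally show ?thesis by (rule power2_le_imp_le) (use x y in auto)
qed

lemma norm2_triangle:
  assumes x: "x \<in> A" and y: "y \<in> A" shows "norm2 \<tau> (x + y) \<le> norm2 \<tau> x + norm2 \<tau> y"
proof (rule power2_le_imp_le)
  have "(norm2 \<tau> (x + y))\<^sup>2 = (norm2 \<tau> x)\<^sup>2 + 2 * trace_inner x y + (norm2 \<tau> y)\<^sup>2"
    using x y by (simp add: norm2_square trace_inner_simps trace_inner_commute[of y x])
  also have "\<dots> \<le> (norm2 \<tau> x + norm2 \<tau> y)\<^sup>2"
    using trace_inner_cauchy_schwarz[OF x y] by (simp add: power2_sum)
  finally show "(norm2 \<tau> (x + y))\<^sup>2 \<le> (norm2 \<tau> x + norm2 \<tau> y)\<^sup>2" .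
qed (use x y in auto)

lemma norm2_median:
  assumes "x \<in> A" "y \<in> A"
  shows "4 * (norm2 \<tau> ((1/2) *\<^sub>R (x + y)))\<^sup>2 + (norm2 \<tau> (x - y))\<^sup>2
    = 2 * (norm2 \<tau> x)\<^sup>2 + 2 * (norm2 \<tau> y)\<^sup>2"
  using assms by (simp add: norm2_square trace_inner_simps field_simps)

lemma norm2_scaleR: "x \<in> A \<Longrightarrow> norm2 \<tau> (r *\<^sub>R x) = \<bar>r\<bar> * norm2 \<tau> x"
  by (rule power2_eq_imp_eq)
    (simp_all add: norm2_square trace_inner_simps power_mult_distrib power2_eq_square[of r])

lemma norm2_minus [simp]: "x \<in> A \<Longrightarrow> norm2 \<tau> (- x) = norm2 \<tau> x"
  using norm2_scaleR[of x "-1"] by simp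

lemma norm2_minus_commute: "x \<in> A \<Longrightarrow> y \<in> A \<Longrightarrow> norm2 \<tau> (x - y) = norm2 \<tau> (y - x)"
  using norm2_minus[of "x - y"] by simp

lemma norm2_diff_triangle: "x \<in> A \<Longrightarrow> y \<in> A \<Longrightarrow> norm2 \<tau> (x - y) \<le> norm2 \<tau> x + norm2 \<tau> y"
  using norm2_triangle[of x "- y"] by simp

lemma norm2_adj [simp]: "x \<in> A \<Longrightarrow> norm2 \<tau> (adj x) = norm2 \<tau> x"
  by (simp add: norm2_def trace_commute)

lemma norm2_isometry: 
  assumes "u \<in> A" "x \<in> A" "adj u o\<^sub>L u = id_blinfun" shows "norm2 \<tau> (u o\<^sub>L x) = norm2 \<tau> x"
proof -
  have "adj (u o\<^sub>L x) o\<^sub>L (u o\<^sub>L x) = adj x o\<^sub>L ((adj u o\<^sub>L u) o\<^sub>L x)"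
    using assms(1,2) by (simp only: adj_compose_mem compose_assoc)
  then show ?thesis by (simp add: norm2_def assms(3))
qed

text \<open>
  Quantitative form of normality: being continuous at \<open>0\<close>, the trace is smaller than \<open>1\<close> on an ultraweak
  neighbourhood of \<open>0\<close>, and homogeneity turns this into an inequality between quadratic forms.
\<close>

lemma norm2_le_mass:
  obtains F :: "(nat \<Rightarrow> 'h) set" and C where "finite F" "\<And>\<zeta>. \<zeta> \<in> F \<Longrightarrow> square_summable \<zeta>" "0 < C"
    "\<And>x. x \<in> A \<Longrightarrow> (norm2 \<tau> x)\<^sup>2 \<le> C * (\<Sum>\<zeta>\<in>F. mass \<zeta> x)"
proof -
  have top: "topspace (ultraweak_topology :: 'h operator topology) = UNIV"
  proof -
    have "UNIV \<in> {{a. (\<Sum>n. cinner (\<xi> n) (blinfun_apply a (\<eta> n))) \<in> U} | (\<xi> :: nat \<Rightarrow> 'h) \<eta> U.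
        square_summable \<xi> \<and> square_summable \<eta> \<and> open U}"
      by (intro CollectI exI[of _ "\<lambda>_. 0"] exI[of _ UNIV]) auto
    then show ?thesis unfolding ultraweak_topology_def by auto
  qed
  have "openin (subtopology ultraweak_topology A) {a \<in> topspace (subtopology ultraweak_topology A). \<tau> a \<in> ball 0 1}"
    using trace_normal unfolding normal_functional_def
    by (intro openin_continuous_map_preimage) auto
  then obtain U where U: "openin ultraweak_topology U" "{a \<in> A. \<tau> a \<in> ball 0 1} = U \<inter> A"
    by (auto simp: openin_subtopology top)
  have "\<tau> 0 = 0" using trace_scalar[of 0 0] by (simp add: scalar_op_0)
  then have "0 \<in> {a \<in> A. \<tau> a \<in> ball 0 1}" by simp
  then have "0 \<in> U" using U(2) by blast
  then obtain F \<delta> where F: "finite F" "\<And>\<zeta>. \<zeta> \<in> F \<Longrightarrow> square_summable \<zeta>" "0 < \<delta>"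
    "\<And>x. x \<in> complex_operators \<Longrightarrow> (\<Sum>\<zeta>\<in>F. mass \<zeta> x) < \<delta> \<Longrightarrow> adj x o\<^sub>L x \<in> U"
    using ultraweak_neighbourhood_of_0[OF U(1)] by blast
  have small: "(norm2 \<tau> x)\<^sup>2 < 1" if "x \<in> A" "(\<Sum>\<zeta>\<in>F. mass \<zeta> x) < \<delta>" for x
  proof -
    have "adj x o\<^sub>L x \<in> U \<inter> A" using that F(4) complex by auto
    then have "cmod (\<tau> (adj x o\<^sub>L x)) < 1" using U(2) by auto
    then show ?thesis using that(1) complex_Re_le_cmod[of "\<tau> (adj x o\<^sub>L x)"]
      by (simp add: norm2_square trace_inner_def)
  qed
  show thesis
  proof (rule that[of F "1 / \<delta>"])
    fix x assume x: "x \<in> A"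
    show "(norm2 \<tau> x)\<^sup>2 \<le> 1 / \<delta> * (\<Sum>\<zeta>\<in>F. mass \<zeta> x)"
    proof (rule ccontr)
      let ?s = "\<Sum>\<zeta>\<in>F. mass \<zeta> x"
      assume "\<not> ?thesis"
      then have gt: "?s < \<delta> * (norm2 \<tau> x)\<^sup>2" using F(3) by (simp add: field_simps)
      moreover have "0 \<le> ?s" by (intro sum_nonneg mass_nonneg F)
      ultimately have "norm2 \<tau> x \<noteq> 0" by auto
      then have n: "0 < norm2 \<tau> x" using norm2_nonneg[OF x] by linarith
      define y where "y = (1 / norm2 \<tau> x) *\<^sub>R x"
      have "mass \<zeta> y = (1 / norm2 \<tau> x)\<^sup>2 * mass \<zeta> x" if "\<zeta> \<in> F" for \<zeta>
        unfolding mass_def y_def using n mass_summable[OF F(2)[OF that], of x]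
        by (simp add: blinfun.bilinear_simps power_mult_distrib power_divide suminf_mult divide_inverse)
      then have "(\<Sum>\<zeta>\<in>F. mass \<zeta> y) = (1 / norm2 \<tau> x)\<^sup>2 * ?s" by (simp add: sum_distrib_left)
      also have "\<dots> < \<delta>" using gt n by (simp add: field_simps power_divide)
      finally have "(norm2 \<tau> y)\<^sup>2 < 1" using x by (intro small) (auto simp: y_def)
      then show False using x n by (simp add: y_def norm2_scaleR)
    qed
  qed (use F in auto)
qed

lemma norm2_le_norm_bound:
  obtains B where "\<And>x. x \<in> A \<Longrightarrow> norm2 \<tau> x \<le> B * norm x"
proof -
  obtain F C where F: "finite F" "\<And>\<zeta>. \<zeta> \<in> F \<Longrightarrow> square_summable \<zeta>" "0 < C"
    "\<And>x. x \<in> A \<Longrightarrow> (norm2 \<tau> x)\<^sup>2 \<le> C * (\<Sum>\<zeta>\<in>F. mass \<zeta> x)" using norm2_le_mass by metis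
  define D where "D = C * (\<Sum>\<zeta>\<in>F. \<Sum>n. (norm (\<zeta> n))\<^sup>2)"
  have D: "0 \<le> D" using F by (auto simp: D_def intro!: mult_nonneg_nonneg sum_nonneg suminf_nonneg)
  have "norm2 \<tau> x \<le> sqrt D * norm x" if x: "x \<in> A" for x
  proof (rule power2_le_imp_le)
    have "(norm2 \<tau> x)\<^sup>2 \<le> C * (\<Sum>\<zeta>\<in>F. mass \<zeta> x)" using F x by blast
    also have "\<dots> \<le> C * (\<Sum>\<zeta>\<in>F. (norm x)\<^sup>2 * (\<Sum>n. (norm (\<zeta> n))\<^sup>2))"
      using F by (intro mult_left_mono sum_mono mass_le) auto
    also have "\<dots> = (sqrt D * norm x)\<^sup>2"
      using D by (simp add: D_def power_mult_distrib sum_distrib_left mult_ac)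
    finally show "(norm2 \<tau> x)\<^sup>2 \<le> (sqrt D * norm x)\<^sup>2" .
  qed (use D in simp)
  then show thesis by (rule that)
qed

text \<open>
  For \<open>h = a\<^sup>* a\<close> the numbers \<open>\<parallel>h\<^sup>k x\<parallel>\<^sub>2\<close> are log-convex by the Cauchy-Schwarz inequality, and bounded because
  \<open>h\<close> is a contraction and the trace norm is dominated by a multiple of the operator norm. Hence
  \<open>\<parallel>h x\<parallel>\<^sub>2 \<le> \<parallel>x\<parallel>\<^sub>2\<close>, and \<open>\<parallel>a x\<parallel>\<^sub>2\<^sup>2 = \<langle>x, h x\<rangle> \<le> \<parallel>x\<parallel>\<^sub>2 \<parallel>h x\<parallel>\<^sub>2\<close>. This avoids a factorisation of \<open>1 - a\<^sup>* a\<close>.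
\<close>

lemma norm2_compose_contraction:
  assumes a: "a \<in> A" and na: "norm a \<le> 1" and x: "x \<in> A"
  shows "norm2 \<tau> (a o\<^sub>L x) \<le> norm2 \<tau> x"
proof -
  define h where "h = adj a o\<^sub>L a"
  have h: "h \<in> A" "adj h = h" using a by (simp_all add: h_def adj_compose_mem)
  have nh: "norm h \<le> 1"
  proof -
    have "norm h \<le> norm (adj a) * norm a" unfolding h_def by (rule norm_blinfun_compose)
    also have "\<dots> \<le> 1 * 1" using na norm_adj_le[OF complex[OF a]] by (intro mult_mono) auto
    finally show ?thesis by simp
  qed
  define y where "y k = ((\<lambda>z. h o\<^sub>L z) ^^ k) x" for k
  have y: "y 0 = x" "\<And>k. y (Suc k) = h o\<^sub>L y k" by (simp_all add: y_def)
  have yA: "y k \<in> A" for k by (induction k) (simp_all add: y x h)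
  have ny: "norm (y k) \<le> norm x" for k
  proof (induction k)
    case (Suc k)
    have "norm (y (Suc k)) \<le> norm h * norm (y k)" unfolding y by (rule norm_blinfun_compose)
    also have "\<dots> \<le> 1 * norm x" using nh Suc by (intro mult_mono) auto
    finally show ?case by simp
  qed (simp add: y)
  obtain B where B: "\<And>z. z \<in> A \<Longrightarrow> norm2 \<tau> z \<le> B * norm z" using norm2_le_norm_bound by blast
  have "norm2 \<tau> (y 1) \<le> norm2 \<tau> (y 0)"
  proof (rule log_convex_bounded[where r = "\<lambda>k. norm2 \<tau> (y k)"])
    fix k
    show "0 \<le> norm2 \<tau> (y k)" using yA by simp
    have "(norm2 \<tau> (y (Suc k)))\<^sup>2 = trace_inner (y k) (y (Suc (Suc k)))"
      using h yA by (simp add: norm2_square trace_inner_def y adj_compose_mem compose_assoc)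
    then show "(norm2 \<tau> (y (Suc k)))\<^sup>2 \<le> norm2 \<tau> (y k) * norm2 \<tau> (y (Suc (Suc k)))"
      using trace_inner_cauchy_schwarz yA by simp
    have "norm2 \<tau> (y k) \<le> B * norm (y k)" using B yA by simp
    also have "\<dots> \<le> \<bar>B\<bar> * norm x" using ny[of k] by (intro mult_mono) auto
    finally show "norm2 \<tau> (y k) \<le> \<bar>B\<bar> * norm x" .
  qed
  then have "norm2 \<tau> (h o\<^sub>L x) \<le> norm2 \<tau> x" by (simp add: y)
  then have "norm2 \<tau> x * norm2 \<tau> (h o\<^sub>L x) \<le> norm2 \<tau> x * norm2 \<tau> x"
    using x by (intro mult_left_mono) auto
  moreover have "(norm2 \<tau> (a o\<^sub>L x))\<^sup>2 = trace_inner x (h o\<^sub>L x)"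
    using a x by (simp add: norm2_square trace_inner_def h_def adj_compose_mem compose_assoc)
  moreover have "\<dots> \<le> norm2 \<tau> x * norm2 \<tau> (h o\<^sub>L x)"
    using h x by (intro trace_inner_cauchy_schwarz) auto
  ultimately have "(norm2 \<tau> (a o\<^sub>L x))\<^sup>2 \<le> (norm2 \<tau> x)\<^sup>2" by (simp add: power2_eq_square)
  then show ?thesis by (rule power2_le_imp_le) (use x in auto)
qed

lemma norm2_compose_contraction_right:
  assumes "a \<in> A" "norm a \<le> 1" "x \<in> A"
  shows "norm2 \<tau> (x o\<^sub>L a) \<le> norm2 \<tau> x"
proof -
  have "norm2 \<tau> (adj a o\<^sub>L adj x) \<le> norm2 \<tau> (adj x)"
    using assms norm_adj_le[OF complex, of a] by (intro norm2_compose_contraction) auto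
  then show ?thesis using assms by (simp flip: adj_compose_mem)
qed

lemma norm2_le_1: "x \<in> A \<Longrightarrow> norm x \<le> 1 \<Longrightarrow> norm2 \<tau> x \<le> 1"
  using norm2_compose_contraction[of x id_blinfun] by (simp add: norm2_def trace_one)

end

section \<open>Minimal vectors in bounded convex sets\<close>

context tracial
begin

text \<open>
  Vectors on which normality can be tested are separating for \<open>A\<close>, because the trace is faithful, and a
  separating family is cyclic for the commutant: the projection onto the complement of its
  orbits under the commutant lies in \<open>A\<close> and annihilates the family.
\<close>

lemma commutant_orbit_dense:
  assumes F: "finite F" "\<And>\<zeta>. \<zeta> \<in> F \<Longrightarrow> square_summable \<zeta>"
    and le: "\<And>x. x \<in> A \<Longrightarrow> (norm2 \<tau> x)\<^sup>2 \<le> C * (\<Sum>\<zeta>\<in>F. mass \<zeta> x)"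
  shows "closure (span {blinfun_apply c (\<zeta> n) | c \<zeta> n. c \<in> commutant A \<and> \<zeta> \<in> F}) = UNIV"
    (is "closure (span ?G) = UNIV")
proof -
  have invariant: "c x \<in> ?G" if c: "c \<in> commutant A" and x: "x \<in> ?G" for c x
  proof -
    from x obtain d \<zeta> n where "d \<in> commutant A" "\<zeta> \<in> F" "x = d (\<zeta> n)" by blast
    then show ?thesis using commutant_compose[OF c, of d] by (metis (mono_tags, lifting)
          blinfun_apply_blinfun_compose mem_Collect_eq)
  qed
  have scalars: "\<forall>x\<in>?G. \<forall>c. c *\<^sub>C x \<in> ?G"
    using invariant[OF scalar_commutant] by (metis (no_types, lifting) scalar_op_apply)
  obtain p :: "'h operator" where p: "p \<in> complex_operators" "\<forall>x\<in>?G. p x = 0"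
    "\<forall>c\<in>complex_operators. (\<forall>x\<in>?G. blinfun_apply c x \<in> ?G \<and> adj c x \<in> ?G) \<longrightarrow> c o\<^sub>L p = p o\<^sub>L c"
    "p = 0 \<longrightarrow> closure (span ?G) = UNIV"
    by (rule complement_projection[OF scalars]) (rule that)
  have pA: "p \<in> A"
    by (intro bicommutant_memI p(1) p(3)[rule_format] conjI invariant commutant_adj commutant_complex)
  have "id_blinfun \<in> commutant A" using scalar_commutant[of 1] by simp
  then have "\<zeta> n \<in> ?G" if "\<zeta> \<in> F" for \<zeta> n
    using that by (metis (mono_tags, lifting) blinfun_apply_id_blinfun id_apply mem_Collect_eq)
  then have "mass \<zeta> p = 0" if "\<zeta> \<in> F" for \<zeta>
    using that by (simp add: mass_def p(2)[rule_format])
  then have "(norm2 \<tau> p)\<^sup>2 \<le> 0" using le[OF pA] by simp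
  then have "p = 0" using norm2_eq_0 pA by simp
  then show ?thesis by (rule p(4)[rule_format])
qed

text \<open>
  A bounded sequence of operators that converges on a set with dense span converges strongly, and a
  strong limit of elements of \<open>A\<close> commutes with the commutant of \<open>A\<close>.
\<close>

lemma strong_limit:
  assumes G: "closure (span G) = UNIV" and yA: "\<And>k::nat. y k \<in> A" and yR: "\<And>k. norm (y k) \<le> R"
    and conv: "\<And>g. g \<in> G \<Longrightarrow> convergent (\<lambda>k. blinfun_apply (y k) g)"
  obtains v where "v \<in> A" "\<And>x. (\<lambda>k. blinfun_apply (y k) x) \<longlonglongrightarrow> v x"
proof -
  define Z where "Z = {x. convergent (\<lambda>k. y k x)}"
  have R: "0 \<le> R" using yR[of 0] norm_ge_zero order_trans by blast
  have "subspace Z"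
    unfolding subspace_def Z_def
    by (auto simp: blinfun.bilinear_simps intro!: convergent_add
        intro: bounded_linear.convergent[OF bounded_linear_scaleR_right] convergent_const)
  then have sZ: "span G \<subseteq> Z" using conv by (intro span_minimal) (auto simp: Z_def)
  have all: "convergent (\<lambda>k. y k x)" for x
  proof -
    have "Cauchy (\<lambda>k. y k x)"
      unfolding Cauchy_def
    proof (intro allI impI)
      fix e :: real assume e: "0 < e"
      have "x \<in> closure (span G)" using G by simp
      then obtain g where g: "g \<in> span G" "dist g x < e / (4 * (R + 1))"
        using e R unfolding closure_approachable
        by (metis divide_pos_pos add_nonneg_pos mult_pos_pos zero_less_numeral zero_less_one)
      then have "Cauchy (\<lambda>k. y k g)" using sZ by (auto simp: Z_def convergent_Cauchy)
      then obtain N where N: "\<And>m n. m \<ge> N \<Longrightarrow> n \<ge> N \<Longrightarrow> dist (y m g) (y n g) < e / 2"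
        using e unfolding Cauchy_def by (meson half_gt_zero)
      have d: "dist (y k x) (y k g) \<le> e / 4" for k
      proof -
        have "dist (y k x) (y k g) \<le> norm (y k) * norm (x - g)"
          by (simp add: dist_norm norm_blinfun flip: blinfun.diff_right)
        also have "\<dots> \<le> (R + 1) * (e / (4 * (R + 1)))"
          using yR[of k] g(2) R by (intro mult_mono) (auto simp: dist_norm norm_minus_commute)
        also have "\<dots> = e / 4" using R by (simp add: divide_simps)
        finally show ?thesis .
      qed
      have "dist (y m x) (y n x) < e" if "m \<ge> N" "n \<ge> N" for m n
        using N[OF that] d[of m] d[of n] dist_triangle[of "y m x" "y n x" "y m g"]
          dist_triangle[of "y m g" "y n x" "y n g"] by (simp add: dist_commute)
      then show "\<exists>M. \<forall>m\<ge>M. \<forall>n\<ge>M. dist (y m x) (y n x) < e" by blast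
    qed
    then show ?thesis by (simp add: Cauchy_convergent_iff)
  qed
  define f where "f x = lim (\<lambda>k. y k x)" for x
  have f: "(\<lambda>k. y k x) \<longlonglongrightarrow> f x" for x using all by (simp add: f_def convergent_LIMSEQ_iff)
  have "bounded_linear f"
  proof (rule bounded_linear_intro)
    show "f (a + b) = f a + f b" for a b
      using tendsto_add[OF f[of a] f[of b]] f[of "a + b"] LIMSEQ_unique
      by (auto simp: blinfun.add_right)
    show "f (r *\<^sub>R a) = r *\<^sub>R f a" for r a
      using tendsto_scaleR[OF tendsto_const f[of a], of r] f[of "r *\<^sub>R a"] LIMSEQ_unique
      by (auto simp: blinfun.scaleR_right)
    show "norm (f a) \<le> norm a * R" for a
    proof (rule LIMSEQ_le_const2[OF tendsto_norm[OF f]])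
      show "\<exists>N. \<forall>n\<ge>N. norm (y n a) \<le> norm a * R"
        by (metis mult.commute mult_right_mono norm_blinfun norm_ge_zero order_trans yR)
    qed
  qed
  then have ap: "blinfun_apply (Blinfun f) = f" by (rule bounded_linear_Blinfun_apply)
  have comm: "c (f x) = f (c x)" if c: "\<And>k. y k o\<^sub>L c = c o\<^sub>L y k" for c :: "'h operator" and x
  proof -
    have "c (y k x) = y k (c x)" for k by (metis blinfun_apply_blinfun_compose c)
    then have "(\<lambda>k. y k (c x)) \<longlonglongrightarrow> c (f x)"
      using bounded_linear.tendsto[OF blinfun.bounded_linear_right f, of c x] by simp
    then show ?thesis using f LIMSEQ_unique by blast
  qed
  have "Blinfun f \<in> A"
  proof (rule bicommutant_memI)
    have "y k o\<^sub>L scalar_op c = scalar_op c o\<^sub>L y k" for k c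
      using compose_scalar_op[OF complex[OF yA], of k c id_blinfun] by simp
    then show "Blinfun f \<in> complex_operators"
      using comm[of "scalar_op _"] by (simp add: complex_operators_def ap)
    show "c o\<^sub>L Blinfun f = Blinfun f o\<^sub>L c" if "c \<in> commutant A" for c
      using comm[of c] commutantD[OF that yA] by (intro blinfun_eqI) (simp add: ap)
  qed
  then show thesis using f by (intro that[of "Blinfun f"]) (simp_all add: ap)
qed

text \<open>
  A minimising sequence for the trace norm is Cauchy in that norm, which by itself yields no operator. So,
  within the sets \<open>D k\<close> of almost-minimisers, the larger form \<open>S x = \<Sum>\<^sub>\<zeta> \<Sum>\<^sub>n \<parallel>x \<zeta>\<^sub>n\<parallel>\<^sup>2\<close> is minimised as well.
  A sequence that is Cauchy for \<open>S\<close> converges at the vectors \<open>\<zeta>\<^sub>n\<close>, hence on their orbits under the commutant,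
  hence strongly; and convergence for \<open>S\<close> implies convergence in trace norm.
\<close>

lemma norm2_minimiser:
  assumes KA: "K \<subseteq> A" and ne: "K \<noteq> {}" and KR: "\<And>x. x \<in> K \<Longrightarrow> norm x \<le> R"
    and midK: "\<And>x y. x \<in> K \<Longrightarrow> y \<in> K \<Longrightarrow> (1/2) *\<^sub>R (x + y) \<in> K"
  obtains v y where "v \<in> A" "\<And>k::nat. y k \<in> K" "(\<lambda>k. norm2 \<tau> (y k - v)) \<longlonglongrightarrow> 0"
    "\<And>x. x \<in> K \<Longrightarrow> norm2 \<tau> v \<le> norm2 \<tau> x"
proof -
  obtain F C where F: "finite F" "\<And>\<zeta>. \<zeta> \<in> F \<Longrightarrow> square_summable \<zeta>" and C: "0 < C"
    and le: "\<And>x. x \<in> A \<Longrightarrow> (norm2 \<tau> x)\<^sup>2 \<le> C * (\<Sum>\<zeta>\<in>F. mass \<zeta> x)"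
    using norm2_le_mass by metis
  define S where "S x = (\<Sum>\<zeta>\<in>F. mass \<zeta> x)" for x
  define d where "d = Inf ((\<lambda>x. (norm2 \<tau> x)\<^sup>2) ` K)"
  have bdd: "bdd_below ((\<lambda>x. (norm2 \<tau> x)\<^sup>2) ` K)" by (auto intro!: bdd_belowI[of _ 0])
  have d_le: "d \<le> (norm2 \<tau> x)\<^sup>2" if "x \<in> K" for x
    unfolding d_def using that bdd by (intro cInf_lower) auto
  define r where "r k = inverse (real (Suc k))" for k
  have r: "0 < r k" "j \<le> k \<Longrightarrow> r k \<le> r j" for j k
    by (auto simp: r_def le_imp_inverse_le)
  define D where "D k = {x \<in> K. (norm2 \<tau> x)\<^sup>2 < d + r k}" for k
  have D_ne: "\<exists>x. x \<in> D k" for k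
    using cInf_lessD[of "(\<lambda>x. (norm2 \<tau> x)\<^sup>2) ` K" "d + r k"] ne r(1)[of k]
    unfolding D_def d_def by auto
  have D_mid: "(1/2) *\<^sub>R (x + y) \<in> D k" if "x \<in> D k" "y \<in> D k" for k x y
  proof -
    have less: "m < c" if "4 * m + e = 2 * p + 2 * q" "0 \<le> e" "p < c" "q < c"
      for m c e p q :: real using that by linarith
    have "(norm2 \<tau> ((1/2) *\<^sub>R (x + y)))\<^sup>2 < d + r k"
      by (rule less[OF norm2_median[of x y]]) (use that KA in \<open>auto simp: D_def\<close>)
    then show ?thesis using that midK by (auto simp: D_def)
  qed
  define B where "B = R\<^sup>2 * (\<Sum>\<zeta>\<in>F. \<Sum>n. (norm (\<zeta> n))\<^sup>2)"
  have S_B: "S x \<le> B" if "x \<in> K" for x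
  proof -
    have "S x \<le> (\<Sum>\<zeta>\<in>F. R\<^sup>2 * (\<Sum>n. (norm (\<zeta> n))\<^sup>2))"
      unfolding S_def
    proof (intro sum_mono order_trans[OF mass_le] mult_right_mono)
      show "(norm x)\<^sup>2 \<le> R\<^sup>2" using KR[OF that] by (intro power_mono) auto
    qed (auto intro: suminf_nonneg F)
    then show ?thesis by (simp add: B_def sum_distrib_left)
  qed
  have S_median: "4 * S ((1/2) *\<^sub>R (x + y)) + S (x - y) = 2 * S x + 2 * S y" for x y
  proof -
    have "(\<Sum>\<zeta>\<in>F. 4 * mass \<zeta> ((1/2) *\<^sub>R (x + y)) + mass \<zeta> (x - y)) = (\<Sum>\<zeta>\<in>F. 2 * mass \<zeta> x + 2 * mass \<zeta> y)"
      by (intro sum.cong mass_median F refl)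
    then show ?thesis by (simp only: S_def sum.distrib sum_distrib_left)
  qed
  obtain y where y: "\<And>k. y k \<in> D k"
    and yc: "\<And>e. 0 < e \<Longrightarrow> \<exists>N. \<forall>j\<ge>N. \<forall>k\<ge>N. S (y j - y k) < e"
  proof (rule quadratic_minimising_sequence[of S D B])
    show "0 \<le> S x" for x unfolding S_def by (intro sum_nonneg mass_nonneg F)
    show "D k \<subseteq> D j" if "j \<le> k" for j k using r(2)[OF that] by (auto simp: D_def)
    show "\<exists>x\<in>D k. S x \<le> B" for k using D_ne[of k] S_B by (auto simp: D_def)
  qed (use S_median D_mid in auto)
  have yK: "y k \<in> K" for k using y by (auto simp: D_def)
  have yA: "y k \<in> A" for k using yK KA by blast
  have mass_S: "mass \<zeta> x \<le> S x" if "\<zeta> \<in> F" for \<zeta> x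
    unfolding S_def using that F by (intro member_le_sum mass_nonneg) auto
  let ?G = "{blinfun_apply c (\<zeta> n) | c \<zeta> n. c \<in> commutant A \<and> \<zeta> \<in> F}"
  have dense: "closure (span ?G) = UNIV" by (rule commutant_orbit_dense[OF F le])
  have "convergent (\<lambda>k. y k g)" if "g \<in> ?G" for g
  proof -
    from that obtain c \<zeta> n where c: "c \<in> commutant A" "\<zeta> \<in> F" "g = c (\<zeta> n)" by blast
    have "Cauchy (\<lambda>k. y k (\<zeta> n))"
      unfolding Cauchy_def
    proof (intro allI impI)
      fix e :: real assume e: "0 < e"
      obtain N where N: "\<And>j k. j \<ge> N \<Longrightarrow> k \<ge> N \<Longrightarrow> S (y j - y k) < e\<^sup>2"
        using yc[of "e\<^sup>2"] e by auto
      have "dist (y j (\<zeta> n)) (y k (\<zeta> n)) < e" if "j \<ge> N" "k \<ge> N" for j k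
      proof -
        have "(norm ((y j - y k) (\<zeta> n)))\<^sup>2 < e\<^sup>2"
          using apply_le_mass[OF F(2)[OF c(2)], of "y j - y k" n] mass_S[OF c(2)] N[OF that]
          by (meson order_le_less_trans)
        then show ?thesis using e by (simp add: dist_norm blinfun.diff_left power_less_imp_less_base)
      qed
      then show "\<exists>M. \<forall>m\<ge>M. \<forall>k\<ge>M. dist (y m (\<zeta> n)) (y k (\<zeta> n)) < e" by blast
    qed
    then obtain l where "(\<lambda>k. y k (\<zeta> n)) \<longlonglongrightarrow> l"
      by (auto simp: Cauchy_convergent_iff convergent_def)
    then have "(\<lambda>k. c (y k (\<zeta> n))) \<longlonglongrightarrow> c l"
      by (rule bounded_linear.tendsto[OF blinfun.bounded_linear_right])
    moreover have "c (y k (\<zeta> n)) = y k g" for k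
      using commutantD[OF c(1) yA] unfolding c(3) by (metis blinfun_apply_blinfun_compose)
    ultimately show ?thesis by (auto simp: convergent_def)
  qed
  then obtain v where v: "v \<in> A" "\<And>x. (\<lambda>k. y k x) \<longlonglongrightarrow> v x"
    using strong_limit[OF dense, of y R] yA KR yK by blast
  have lim: "(\<lambda>k. norm2 \<tau> (y k - v)) \<longlonglongrightarrow> 0"
  proof (rule LIMSEQ_I)
    fix e :: real assume e: "0 < e"
    \<comment> \<open>\<open>card F + 1\<close> rather than \<open>card F\<close>: the set \<open>F\<close> may be empty, and the estimate becomes strict\<close>
    define \<delta> where "\<delta> = e\<^sup>2 / (C * (card F + 1))"
    have \<delta>: "0 < \<delta>" using e C by (simp add: \<delta>_def)
    obtain N where N: "\<And>j k. j \<ge> N \<Longrightarrow> k \<ge> N \<Longrightarrow> S (y k - y j) < \<delta>" using yc[OF \<delta>] by blast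
    have "norm (norm2 \<tau> (y k - v) - 0) < e" if k: "k \<ge> N" for k
    proof -
      have "mass \<zeta> (y k - v) \<le> \<delta>" if \<zeta>: "\<zeta> \<in> F" for \<zeta>
        unfolding mass_def
      proof (rule suminf_le_const[OF mass_summable[OF F(2)[OF \<zeta>]]])
        fix n
        \<comment> \<open>strong convergence passes to finite partial sums, which are bounded uniformly in \<open>n\<close> by the Cauchy estimate\<close>
        have "(\<lambda>j. \<Sum>i<n. (norm ((y k - y j) (\<zeta> i)))\<^sup>2) \<longlonglongrightarrow> (\<Sum>i<n. (norm ((y k - v) (\<zeta> i)))\<^sup>2)"
          unfolding blinfun.diff_left by (intro tendsto_intros v)
        moreover have "(\<Sum>i<n. (norm ((y k - y j) (\<zeta> i)))\<^sup>2) \<le> \<delta>" if "j \<ge> N" for j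
        proof -
          have "(\<Sum>i<n. (norm ((y k - y j) (\<zeta> i)))\<^sup>2) \<le> mass \<zeta> (y k - y j)"
            unfolding mass_def by (intro sum_le_suminf mass_summable F \<zeta>) auto
          then show ?thesis using mass_S[OF \<zeta>] N[OF that k] by (meson less_imp_le order_trans)
        qed
        ultimately show "(\<Sum>i<n. (norm ((y k - v) (\<zeta> i)))\<^sup>2) \<le> \<delta>"
          by (intro LIMSEQ_le_const2) auto
      qed
      then have "(\<Sum>\<zeta>\<in>F. mass \<zeta> (y k - v)) \<le> card F * \<delta>"
        using sum_bounded_above[of F "\<lambda>\<zeta>. mass \<zeta> (y k - v)" \<delta>] by simp
      then have "C * (\<Sum>\<zeta>\<in>F. mass \<zeta> (y k - v)) \<le> C * (card F * \<delta>)" using C by simp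
      then have "(norm2 \<tau> (y k - v))\<^sup>2 \<le> C * (card F * \<delta>)"
        using le[of "y k - v"] yA v(1) by (meson diff_mem order_trans)
      also have "\<dots> < e\<^sup>2"
      proof -
        have "C * (card F * \<delta>) < C * ((card F + 1) * \<delta>)" using C \<delta> by simp
        also have "\<dots> = e\<^sup>2" using C by (simp add: \<delta>_def)
        finally show ?thesis .
      qed
      finally show ?thesis using e yA v(1) by (simp add: power_less_imp_less_base)
    qed
    then show "\<exists>no. \<forall>n\<ge>no. norm (norm2 \<tau> (y n - v) - 0) < e" by blast
  qed
  show thesis
  proof (rule that[OF v(1) yK lim])
    fix x assume x: "x \<in> K"
    have "norm2 \<tau> v \<le> norm2 \<tau> (y k - v) + sqrt ((norm2 \<tau> x)\<^sup>2 + r k)" for k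
    proof -
      have "norm2 \<tau> v \<le> norm2 \<tau> (y k - v) + norm2 \<tau> (y k)"
        using norm2_triangle[of "v - y k" "y k"] norm2_minus_commute[of v "y k"] v(1) yA by simp
      moreover have "(norm2 \<tau> (y k))\<^sup>2 \<le> (norm2 \<tau> x)\<^sup>2 + r k"
        using y[of k] d_le[OF x] by (auto simp: D_def)
      then have "norm2 \<tau> (y k) \<le> sqrt ((norm2 \<tau> x)\<^sup>2 + r k)" by (rule real_le_rsqrt)
      ultimately show ?thesis by linarith
    qed
    moreover have "(\<lambda>k. norm2 \<tau> (y k - v) + sqrt ((norm2 \<tau> x)\<^sup>2 + r k)) \<longlonglongrightarrow> 0 + sqrt ((norm2 \<tau> x)\<^sup>2 + 0)"
      unfolding r_def by (intro tendsto_intros lim LIMSEQ_inverse_real_of_nat)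
    ultimately have "norm2 \<tau> v \<le> 0 + sqrt ((norm2 \<tau> x)\<^sup>2 + 0)"
      by (intro LIMSEQ_le_const) auto
    then show "norm2 \<tau> v \<le> norm2 \<tau> x" using x KA by auto
  qed
qed

text \<open>
  The minimal vector is unique, so it is fixed by every symmetry of the set.
\<close>

lemma norm2_minimiser_fixed:
  assumes v: "v \<in> A" and yK: "\<And>k::nat. y k \<in> K" and KA: "K \<subseteq> A"
    and lim: "(\<lambda>k. norm2 \<tau> (y k - v)) \<longlonglongrightarrow> 0"
    and min: "\<And>x. x \<in> K \<Longrightarrow> norm2 \<tau> v \<le> norm2 \<tau> x"
    and mid: "\<And>x y. x \<in> K \<Longrightarrow> y \<in> K \<Longrightarrow> (1/2) *\<^sub>R (x + y) \<in> K"
    and TK: "\<And>x. x \<in> K \<Longrightarrow> T x \<in> K" and TA: "\<And>x. x \<in> A \<Longrightarrow> T x \<in> A"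
    and Tdiff: "\<And>x z. x \<in> A \<Longrightarrow> z \<in> A \<Longrightarrow> T (x - z) = T x - T z"
    and Tiso: "\<And>x. x \<in> A \<Longrightarrow> norm2 \<tau> (T x) = norm2 \<tau> x"
  shows "T v = v"
proof -
  have yA: "y k \<in> A" for k using yK KA by blast
  define e where "e k = norm2 \<tau> (y k - v)" for k
  have e: "e \<longlonglongrightarrow> 0" using lim unfolding e_def .
  have bound: "norm2 \<tau> (T v - v) \<le> 2 * e k + 2 * sqrt (e k * (2 * norm2 \<tau> v + e k))" for k
  proof -
    let ?n = "norm2 \<tau>"
    have TyK: "T (y k) \<in> K" using TK yK by blast
    have "4 * (?n ((1/2) *\<^sub>R (T (y k) + y k)))\<^sup>2 + (?n (T (y k) - y k))\<^sup>2
        = 2 * (?n (T (y k)))\<^sup>2 + 2 * (?n (y k))\<^sup>2"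
      using TyK yA KA by (intro norm2_median) auto
    moreover have "(?n v)\<^sup>2 \<le> (?n ((1/2) *\<^sub>R (T (y k) + y k)))\<^sup>2"
      using min[OF mid[OF TyK yK]] v by (intro power_mono) auto
    ultimately have "(?n (T (y k) - y k))\<^sup>2 \<le> 4 * ((?n (y k))\<^sup>2 - (?n v)\<^sup>2)"
      using Tiso[OF yA, of k] by simp
    also have "\<dots> \<le> 4 * ((?n v + e k)\<^sup>2 - (?n v)\<^sup>2)"
    proof -
      have "?n (y k) \<le> ?n v + e k"
        using norm2_triangle[of v "y k - v"] v yA by (simp add: e_def)
      then have "(?n (y k))\<^sup>2 \<le> (?n v + e k)\<^sup>2" using yA by (intro power_mono) auto
      then show ?thesis by simp
    qed
    also have "\<dots> = (2 * sqrt (e k * (2 * ?n v + e k)))\<^sup>2"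
      using v yA by (simp add: e_def power_mult_distrib power2_eq_square algebra_simps)
    finally have "?n (T (y k) - y k) \<le> 2 * sqrt (e k * (2 * ?n v + e k))"
      using v yA by (elim power2_le_imp_le) (simp add: e_def)
    moreover have "?n (T v - v) \<le> ?n (T v - T (y k)) + (?n (T (y k) - y k) + ?n (y k - v))"
      using norm2_triangle[of "T v - T (y k)" "T (y k) - v"]
        norm2_triangle[of "T (y k) - y k" "y k - v"] v yA TA by simp
    moreover have "?n (T v - T (y k)) = e k"
      using Tiso[of "v - y k"] v yA by (simp add: e_def Tdiff norm2_minus_commute)
    ultimately show ?thesis by (simp add: e_def)
  qed
  have "(\<lambda>k. 2 * e k + 2 * sqrt (e k * (2 * norm2 \<tau> v + e k))) \<longlonglongrightarrow>
      2 * 0 + 2 * sqrt (0 * (2 * norm2 \<tau> v + 0))"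
    by (intro tendsto_intros e)
  then have "norm2 \<tau> (T v - v) \<le> 2 * 0 + 2 * sqrt (0 * (2 * norm2 \<tau> v + 0))"
    using bound by (intro LIMSEQ_le_const) auto
  then have "norm2 \<tau> (T v - v) = 0" using norm2_nonneg[of "T v - v"] v TA by (simp add: antisym)
  then show ?thesis using norm2_eq_0[of "T v - v"] v TA by simp
qed

end

section \<open>Intertwiners close to the identity\<close>

lemma isometry_norm:
  assumes "u \<in> complex_operators" "adj u o\<^sub>L u = id_blinfun"
  shows "norm (blinfun_apply u x) = norm x"
proof -
  have "inner (u x) (u x) = inner ((adj u o\<^sub>L u) x) x" using assms(1) by (simp add: inner_adj)
  then show ?thesis by (simp add: assms(2) norm_eq_sqrt_inner)
qed

lemma isometry_norm_le_1: "u \<in> complex_operators \<Longrightarrow> adj u o\<^sub>L u = id_blinfun \<Longrightarrow> norm u \<le> 1"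
  by (rule norm_blinfun_bound) (simp_all add: isometry_norm)

lemma projection_norm_le_1:
  assumes p: "p \<in> complex_operators" "adj p = p" "p o\<^sub>L p = p" shows "norm p \<le> 1"
proof (rule norm_blinfun_bound)
  fix x
  have "norm (p x) * norm (p x) = inner (p x) (p x)"
    by (simp add: power2_norm_eq_inner flip: power2_eq_square)
  also have "\<dots> = inner x ((p o\<^sub>L p) x)" using inner_adj[OF p(1), of x "p x"] p(2) by simp
  also have "\<dots> = inner x (p x)" by (simp only: p(3))
  also have "\<dots> \<le> norm x * norm (p x)" by (rule norm_cauchy_schwarz)
  finally show "norm (p x) \<le> 1 * norm x" by (cases "p x = 0") auto
qed simp

locale tracial_automorphism = tracial A \<tau> for A :: "'h::complex_hilbert operator set" and \<tau> +
  fixes \<theta> :: "'h operator \<Rightarrow> 'h operator"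
  assumes automorphism: "trace_preserving_automorphism A \<tau> \<theta>"
begin

lemma bij: "bij_betw \<theta> A A"
  and hom_add: "a \<in> A \<Longrightarrow> b \<in> A \<Longrightarrow> \<theta> (a + b) = \<theta> a + \<theta> b"
  and hom_compose: "a \<in> A \<Longrightarrow> b \<in> A \<Longrightarrow> \<theta> (a o\<^sub>L b) = \<theta> a o\<^sub>L \<theta> b"
  and hom_scalar: "a \<in> A \<Longrightarrow> \<theta> (scalar_op c o\<^sub>L a) = scalar_op c o\<^sub>L \<theta> a"
  and hom_adj: "a \<in> A \<Longrightarrow> \<theta> (adj a) = adj (\<theta> a)"
  and hom_trace: "a \<in> A \<Longrightarrow> \<tau> (\<theta> a) = \<tau> a"
  using automorphism unfolding trace_preserving_automorphism_def by simp_all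

lemma hom_mem [simp]: "a \<in> A \<Longrightarrow> \<theta> a \<in> A"
  using bij bij_betwE by blast

lemma hom_id: "\<theta> id_blinfun = id_blinfun"
proof -
  have "id_blinfun \<in> \<theta> ` A" using bij by (simp add: bij_betw_def)
  then obtain a where a: "a \<in> A" "\<theta> a = id_blinfun" by auto
  then show ?thesis using hom_compose[of "id_blinfun" a] by simp
qed

lemma hom_0: "\<theta> 0 = 0"
  using hom_scalar[of 0 0] by (simp add: scalar_op_0)

lemma hom_diff: "a \<in> A \<Longrightarrow> b \<in> A \<Longrightarrow> \<theta> (a - b) = \<theta> a - \<theta> b"
  using hom_add[of a "- b"] hom_scalar[of b "- 1"] by (simp flip: uminus_eq_scalar_op)

lemma norm2_hom: "a \<in> A \<Longrightarrow> norm2 \<tau> (\<theta> a) = norm2 \<tau> a"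
  by (simp add: norm2_def hom_trace flip: hom_adj hom_compose)

lemma hom_inj: "a \<in> A \<Longrightarrow> b \<in> A \<Longrightarrow> \<theta> a = \<theta> b \<Longrightarrow> a = b"
  using bij by (auto simp: bij_betw_def inj_on_def)

text \<open>
  The unitary group of \<open>N\<close> acts on the convex hull of the elements \<open>u \<theta>(u\<^sup>*)\<close> by the trace norm isometries
  \<open>x \<mapsto> w x \<theta>(w\<^sup>*)\<close>, which therefore fix the vector \<open>v\<close> of least norm in its closure. Every \<open>u \<theta>(u\<^sup>*)\<close> is within
  \<open>\<parallel>\<theta>(u\<^sup>*) - u\<^sup>*\<parallel>\<^sub>2 \<le> e\<close> of the identity, and so is \<open>v\<close>.
\<close>

lemma intertwiner_near_id:
  assumes N: "von_neumann N" "N \<subseteq> A"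
    and e: "\<And>x. x \<in> N \<Longrightarrow> norm x \<le> 1 \<Longrightarrow> norm2 \<tau> (\<theta> x - x) \<le> e"
  obtains v where "v \<in> A" "\<And>n. n \<in> N \<Longrightarrow> v o\<^sub>L \<theta> n = n o\<^sub>L v" "norm2 \<tau> (v - id_blinfun) \<le> e"
proof -
  interpret N: von_neumann N by (rule N(1))
  define U where "U = (\<lambda>u. u o\<^sub>L \<theta> (adj u)) ` unitaries N"
  define K where "K = convex hull U"
  define E where "E = {x \<in> A. norm x \<le> 1 \<and> norm2 \<tau> (x - id_blinfun) \<le> e}"
  have u: "u \<in> A" "adj u o\<^sub>L u = id_blinfun" "u o\<^sub>L adj u = id_blinfun" "norm u \<le> 1" "u \<in> N"
    if "u \<in> unitaries N" for u
    using that N(2) isometry_norm_le_1[OF complex, of u] by (auto simp: unitaries_def)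
  have \<theta>u: "\<theta> u o\<^sub>L \<theta> (adj u) = id_blinfun" "\<theta> (adj u) o\<^sub>L \<theta> u = id_blinfun"
    if "u \<in> unitaries N" for u
    using u[OF that] hom_id by (simp_all flip: hom_compose)
  have "U \<subseteq> E"
  proof
    fix x assume "x \<in> U"
    then obtain w where w: "w \<in> unitaries N" and x: "x = w o\<^sub>L \<theta> (adj w)" by (auto simp: U_def)
    have "norm x \<le> norm w * norm (\<theta> (adj w))" unfolding x by (rule norm_blinfun_compose)
    also have "\<dots> \<le> 1 * 1"
    proof (intro mult_mono)
      show "norm (\<theta> (adj w)) \<le> 1"
        using u[OF w] \<theta>u[OF w] by (intro isometry_norm_le_1 complex) (simp_all flip: hom_adj)
    qed (use u[OF w] in auto)
    finally have "norm x \<le> 1" by simp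
    moreover have "x - id_blinfun = w o\<^sub>L (\<theta> (adj w) - adj w)"
      by (simp add: x compose_diff_right u[OF w])
    then have "norm2 \<tau> (x - id_blinfun) = norm2 \<tau> (\<theta> (adj w) - adj w)"
      using u[OF w] by (simp add: norm2_isometry)
    moreover have "norm (adj w) \<le> 1"
      using u[OF w] norm_adj_le[OF complex, of w] by simp
    ultimately show "x \<in> E" using e[of "adj w"] u[OF w] by (simp add: E_def x)
  qed
  moreover have "convex E"
  proof (rule convexI)
    fix x y and a b :: real
    assume xy: "x \<in> E" "y \<in> E" and ab: "0 \<le> a" "0 \<le> b" "a + b = 1"
    have "norm (a *\<^sub>R x + b *\<^sub>R y) \<le> a * norm x + b * norm y"
      using ab norm_triangle_ineq[of "a *\<^sub>R x" "b *\<^sub>R y"] by simp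
    also have "\<dots> \<le> a * 1 + b * 1" using xy ab by (intro add_mono mult_left_mono) (auto simp: E_def)
    finally have "norm (a *\<^sub>R x + b *\<^sub>R y) \<le> 1" using ab by simp
    moreover have "a *\<^sub>R x + b *\<^sub>R y - id_blinfun
        = a *\<^sub>R (x - id_blinfun) + b *\<^sub>R (y - id_blinfun)"
      using ab(3) by (simp add: scaleR_diff_right algebra_simps flip: scaleR_add_left)
    then have "norm2 \<tau> (a *\<^sub>R x + b *\<^sub>R y - id_blinfun)
        \<le> a * norm2 \<tau> (x - id_blinfun) + b * norm2 \<tau> (y - id_blinfun)"
      using norm2_triangle[of "a *\<^sub>R (x - id_blinfun)" "b *\<^sub>R (y - id_blinfun)"] xy ab
      by (simp add: norm2_scaleR E_def)
    moreover have "\<dots> \<le> a * e + b * e" using xy ab by (intro add_mono mult_left_mono) (auto simp: E_def)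
    moreover have "a * e + b * e = e" using ab(3) by (simp flip: distrib_right)
    ultimately show "a *\<^sub>R x + b *\<^sub>R y \<in> E" using xy by (simp add: E_def)
  qed
  ultimately have KE: "K \<subseteq> E" unfolding K_def by (rule hull_minimal)
  have KA: "K \<subseteq> A" using KE by (auto simp: E_def)
  have id_U: "id_blinfun \<in> unitaries N" by (simp add: unitaries_def)
  have ne: "K \<noteq> {}" using id_U hull_subset[of U convex] by (auto simp: K_def U_def)
  have mid: "(1/2) *\<^sub>R (x + y) \<in> K" if "x \<in> K" "y \<in> K" for x y
    using convexD[OF convex_convex_hull that[unfolded K_def], of "1/2" "1/2"]
    by (simp add: K_def scaleR_add_right)
  obtain v y where v: "v \<in> A" "\<And>k::nat. y k \<in> K" "(\<lambda>k. norm2 \<tau> (y k - v)) \<longlonglongrightarrow> 0"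
    "\<And>x. x \<in> K \<Longrightarrow> norm2 \<tau> v \<le> norm2 \<tau> x"
    by (rule norm2_minimiser[OF KA ne _ mid, of 1]) (use KE in \<open>auto simp: E_def\<close>)
  have unit: "v o\<^sub>L \<theta> w = w o\<^sub>L v" if w: "w \<in> unitaries N" for w
  proof -
    define T where "T x = (w o\<^sub>L x) o\<^sub>L \<theta> (adj w)" for x
    have T_lin: "T (a *\<^sub>R x + b *\<^sub>R z) = a *\<^sub>R T x + b *\<^sub>R T z" for a b x z
      by (rule blinfun_eqI) (simp add: T_def blinfun.bilinear_simps)
    have "T v = v"
    proof (rule norm2_minimiser_fixed[OF v(1,2) KA v(3,4) mid])
      have "K \<subseteq> {x. T x \<in> K}" unfolding K_def
      proof (rule hull_minimal)
        show "U \<subseteq> {x. T x \<in> convex hull U}"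
        proof
          fix x assume "x \<in> U"
          then obtain z where z: "z \<in> unitaries N" "x = z o\<^sub>L \<theta> (adj z)" by (auto simp: U_def)
          have "adj (w o\<^sub>L z) o\<^sub>L (w o\<^sub>L z) = adj z o\<^sub>L ((adj w o\<^sub>L w) o\<^sub>L z)"
            "(w o\<^sub>L z) o\<^sub>L adj (w o\<^sub>L z) = w o\<^sub>L ((z o\<^sub>L adj z) o\<^sub>L adj w)"
            by (simp_all only: adj_compose_mem[OF u(1)[OF w] u(1)[OF z(1)]] compose_assoc)
          then have wz: "w o\<^sub>L z \<in> unitaries N"
            using u[OF w] u[OF z(1)] by (simp add: unitaries_def)
          have "T x = (w o\<^sub>L z) o\<^sub>L \<theta> (adj (w o\<^sub>L z))"
            using u[OF w] u[OF z(1)] by (simp add: T_def z(2) adj_compose_mem hom_compose compose_assoc)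
          then have "T x \<in> U" using wz by (auto simp: U_def)
          then show "x \<in> {x. T x \<in> convex hull U}" using hull_subset by fast
        qed
        show "convex {x. T x \<in> convex hull U}"
          using convexD[OF convex_convex_hull] by (auto intro!: convexI simp: T_lin)
      qed
      then show "T x \<in> K" if "x \<in> K" for x using that by blast
      show "T x \<in> A" if "x \<in> A" for x using that u[OF w] by (simp add: T_def)
      show "T (x - z) = T x - T z" for x z by (simp add: T_def compose_diff_left compose_diff_right)
      show "norm2 \<tau> (T x) = norm2 \<tau> x" if x: "x \<in> A" for x
      proof -
        have "norm2 \<tau> (T x) = norm2 \<tau> (w o\<^sub>L (x o\<^sub>L \<theta> (adj w)))" by (simp add: T_def compose_assoc)
        also have "\<dots> = norm2 \<tau> (x o\<^sub>L \<theta> (adj w))" using x u[OF w] by (intro norm2_isometry) auto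
        also have "\<dots> = norm2 \<tau> (adj (x o\<^sub>L \<theta> (adj w)))" using x u[OF w] by simp
        also have "adj (x o\<^sub>L \<theta> (adj w)) = \<theta> w o\<^sub>L adj x"
          using x u[OF w] by (simp add: adj_compose_mem flip: hom_adj)
        also have "norm2 \<tau> (\<theta> w o\<^sub>L adj x) = norm2 \<tau> (adj x)"
          using x u[OF w] \<theta>u[OF w] by (intro norm2_isometry) (simp_all flip: hom_adj)
        finally show ?thesis using x by simp
      qed
    qed
    then have "v o\<^sub>L \<theta> w = ((w o\<^sub>L v) o\<^sub>L \<theta> (adj w)) o\<^sub>L \<theta> w" by (simp add: T_def)
    also have "\<dots> = (w o\<^sub>L v) o\<^sub>L (\<theta> (adj w) o\<^sub>L \<theta> w)" by (rule compose_assoc)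
    finally show ?thesis by (simp add: \<theta>u[OF w])
  qed
  have inter: "v o\<^sub>L \<theta> n = n o\<^sub>L v" if "n \<in> N" for n
    by (rule N.intertwining_from_unitaries[OF _ _ _ hom_id complex[OF v(1)] unit that])
      (use N(2) in \<open>auto intro!: hom_add hom_compose hom_scalar\<close>)
  have "norm2 \<tau> (v - id_blinfun) \<le> norm2 \<tau> (y k - v) + e" for k
  proof -
    have yk: "y k \<in> A" "norm2 \<tau> (y k - id_blinfun) \<le> e" using v(2) KE by (auto simp: E_def)
    then show ?thesis
      using norm2_triangle[of "v - y k" "y k - id_blinfun"] norm2_minus_commute[of v "y k"] v(1) by simp
  qed
  moreover have "(\<lambda>k. norm2 \<tau> (y k - v) + e) \<longlonglongrightarrow> 0 + e" by (intro tendsto_intros v)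
  ultimately have "norm2 \<tau> (v - id_blinfun) \<le> 0 + e" by (intro LIMSEQ_le_const) auto
  then show thesis using v(1) inter by (intro that[of v]) auto
qed

end

section \<open>Intertwiners along a malleable deformation\<close>

locale deformation = tracial Mt \<tau> for Mt :: "'h::complex_hilbert operator set" and \<tau> +
  fixes M :: "'h operator set" and \<alpha> :: "real \<Rightarrow> 'h operator \<Rightarrow> 'h operator"
    and \<beta> :: "'h operator \<Rightarrow> 'h operator"
  assumes M: "von_neumann_subalgebra M Mt"
    and malleable: "s_malleable_deformation \<tau> M Mt \<alpha> \<beta>"
begin

sublocale \<alpha>: tracial_automorphism Mt \<tau> "\<alpha> t" for t
  using malleable by unfold_locales (simp add: s_malleable_deformation_def)

sublocale \<beta>: tracial_automorphism Mt \<tau> \<beta>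
  using malleable by unfold_locales (simp add: s_malleable_deformation_def)

lemma \<alpha>_add: "x \<in> Mt \<Longrightarrow> \<alpha> (s + t) x = \<alpha> s (\<alpha> t x)"
  and \<beta>_fixes: "x \<in> M \<Longrightarrow> \<beta> x = x"
  and \<beta>_involution: "x \<in> Mt \<Longrightarrow> \<beta> (\<beta> x) = x"
  and \<beta>_\<alpha>: "x \<in> Mt \<Longrightarrow> \<beta> (\<alpha> t x) = \<alpha> (- t) (\<beta> x)"
  using malleable unfolding s_malleable_deformation_def by blast+

lemma M_Mt: "x \<in> M \<Longrightarrow> x \<in> Mt"
  using M by (auto simp: von_neumann_subalgebra_def)

lemma \<alpha>_0: "x \<in> Mt \<Longrightarrow> \<alpha> 0 x = x"
  using \<alpha>_add[of x 0 0] by (intro \<alpha>.hom_inj[of "\<alpha> 0 x" x 0]) auto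

lemma \<alpha>_inverse: "x \<in> Mt \<Longrightarrow> \<alpha> t (\<alpha> (- t) x) = x" "x \<in> Mt \<Longrightarrow> \<alpha> (- t) (\<alpha> t x) = x"
  using \<alpha>_add[of x t "- t"] \<alpha>_add[of x "- t" t] by (simp_all add: \<alpha>_0)

lemma eps_bdd: "N \<subseteq> Mt \<Longrightarrow> bdd_above ((\<lambda>x. norm2 \<tau> (\<alpha> t x - x)) ` {x \<in> N. norm x \<le> 1})"
proof (rule bdd_aboveI2[of _ _ 2])
  fix x assume "N \<subseteq> Mt" "x \<in> {x \<in> N. norm x \<le> 1}"
  then have "x \<in> Mt" "norm x \<le> 1" by auto
  then show "norm2 \<tau> (\<alpha> t x - x) \<le> 2"
    using norm2_diff_triangle[of "\<alpha> t x" x] norm2_le_1[of x] \<alpha>.norm2_hom[of x t] by simp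
qed

lemma le_eps: "N \<subseteq> Mt \<Longrightarrow> x \<in> N \<Longrightarrow> norm x \<le> 1 \<Longrightarrow> norm2 \<tau> (\<alpha> t x - x) \<le> eps \<tau> \<alpha> t N"
  unfolding eps_def by (rule cSUP_upper[OF _ eps_bdd]) auto

lemma eps_nonneg: "von_neumann N \<Longrightarrow> N \<subseteq> Mt \<Longrightarrow> 0 \<le> eps \<tau> \<alpha> t N"
  using le_eps[of N 0 t] von_neumann.zero_mem[of N] by (simp add: \<alpha>.hom_0)

definition intertwiners :: "real \<Rightarrow> 'h operator set \<Rightarrow> 'h operator set" where
  "intertwiners t N = {x \<in> Mt. \<forall>n\<in>N. x o\<^sub>L \<alpha> t n = n o\<^sub>L x}"

lemma intertwinersD:
  assumes "w \<in> intertwiners t N"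
  shows "w \<in> Mt" "n \<in> N \<Longrightarrow> w o\<^sub>L \<alpha> t n = n o\<^sub>L w"
  using assms by (auto simp: intertwiners_def)

lemma intertwiners_antimono: "Q \<subseteq> N \<Longrightarrow> intertwiners t N \<subseteq> intertwiners t Q"
  by (auto simp: intertwiners_def)

lemma intertwiners_adj:
  assumes N: "von_neumann N" "N \<subseteq> Mt" and w: "w \<in> intertwiners t N" and n: "n \<in> N"
  shows "adj w o\<^sub>L n = \<alpha> t n o\<^sub>L adj w"
proof -
  interpret N: von_neumann N by (rule N(1))
  have "adj (w o\<^sub>L \<alpha> t (adj n)) = adj (adj n o\<^sub>L w)"
    using intertwinersD(2)[OF w, of "adj n"] n by simp
  moreover have "n \<in> Mt" using n N(2) by blast
  ultimately show ?thesis
    using n intertwinersD(1)[OF w] by (simp add: adj_compose_mem \<alpha>.hom_adj)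
qed

lemma intertwiners_compose:
  assumes N: "N \<subseteq> Mt" and w: "w \<in> intertwiners s N" and z: "z \<in> intertwiners t N"
  shows "w o\<^sub>L \<alpha> s z \<in> intertwiners (s + t) N"
proof -
  have "(w o\<^sub>L \<alpha> s z) o\<^sub>L \<alpha> (s + t) n = n o\<^sub>L (w o\<^sub>L \<alpha> s z)" if n: "n \<in> N" for n
  proof -
    have nM: "n \<in> Mt" using n N by blast
    have "(w o\<^sub>L \<alpha> s z) o\<^sub>L \<alpha> (s + t) n = w o\<^sub>L \<alpha> s (z o\<^sub>L \<alpha> t n)"
      using intertwinersD(1)[OF z] nM by (simp add: \<alpha>_add \<alpha>.hom_compose compose_assoc)
    also have "\<dots> = (w o\<^sub>L \<alpha> s n) o\<^sub>L \<alpha> s z"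
      using intertwinersD[OF z] n nM by (simp add: \<alpha>.hom_compose compose_assoc)
    finally show ?thesis using intertwinersD(2)[OF w n] by (simp add: compose_assoc)
  qed
  then show ?thesis using intertwinersD(1)[OF w] intertwinersD(1)[OF z] by (simp add: intertwiners_def)
qed

lemma intertwiners_compose_adj:
  assumes N: "von_neumann N" "N \<subseteq> Mt" and v: "v \<in> intertwiners t N" and w: "w \<in> intertwiners t N"
  shows "v o\<^sub>L adj w \<in> commutant N \<inter> Mt"
proof -
  have "n o\<^sub>L (v o\<^sub>L adj w) = (v o\<^sub>L adj w) o\<^sub>L n" if n: "n \<in> N" for n
    using intertwiners_adj[OF N w n] intertwinersD(2)[OF v n] by (metis compose_assoc)
  moreover have "v o\<^sub>L adj w \<in> Mt"
    using intertwinersD(1)[OF v] intertwinersD(1)[OF w] by simp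
  ultimately show ?thesis by (simp add: commutant_def complex)
qed

text \<open>
  As \<open>\<beta>\<close> fixes \<open>N\<close> and reverses \<open>\<alpha>\<close>, applying it to \<open>w\<^sup>* n = \<alpha>\<^sub>t(n) w\<^sup>*\<close> gives \<open>\<beta>(w\<^sup>*) n = \<alpha>\<^sub>-\<^sub>t(n) \<beta>(w\<^sup>*)\<close>; now apply \<open>\<alpha>\<^sub>t\<close>.
  This symmetry exchanges the left and the right supports of intertwiners.
\<close>

lemma intertwiners_reflection:
  assumes N: "von_neumann N" "N \<subseteq> M" and w: "w \<in> intertwiners t N"
  shows "\<alpha> t (\<beta> (adj w)) \<in> intertwiners t N"
proof -
  have NMt: "N \<subseteq> Mt" using N(2) M_Mt by blast
  have wM: "w \<in> Mt" by (rule intertwinersD(1)[OF w])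
  have "\<alpha> t (\<beta> (adj w)) o\<^sub>L \<alpha> t n = n o\<^sub>L \<alpha> t (\<beta> (adj w))" if n: "n \<in> N" for n
  proof -
    have nM: "n \<in> Mt" "\<beta> n = n" using n N NMt \<beta>_fixes by auto
    have "\<beta> (adj w) o\<^sub>L n = \<beta> (adj w o\<^sub>L n)" using wM nM by (simp add: \<beta>.hom_compose)
    also have "\<dots> = \<alpha> (- t) n o\<^sub>L \<beta> (adj w)"
      using wM nM by (simp add: intertwiners_adj[OF N(1) NMt w n] \<beta>.hom_compose \<beta>_\<alpha>)
    finally have "\<alpha> t (\<beta> (adj w) o\<^sub>L n) = \<alpha> t (\<alpha> (- t) n o\<^sub>L \<beta> (adj w))" by simp
    then show ?thesis using wM nM by (simp add: \<alpha>.hom_compose \<alpha>_inverse)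
  qed
  then show ?thesis using wM by (simp add: intertwiners_def)
qed

lemma intertwiners_reflection_involution:
  "w \<in> Mt \<Longrightarrow> \<alpha> t (\<beta> (adj (\<alpha> t (\<beta> (adj w))))) = w"
  by (simp add: \<beta>_\<alpha> \<alpha>_inverse \<beta>_involution flip: \<alpha>.hom_adj \<beta>.hom_adj)

text \<open>
  The union of the ranges of the intertwiners is invariant under \<open>N\<close>, since \<open>n w = w \<alpha>\<^sub>t(n)\<close>, and under the
  commutant of \<open>Mt\<close>. So the projection onto its complement lies in \<open>N' \<inter> Mt\<close>.
\<close>

lemma intertwiners_complement:
  assumes N: "von_neumann N" "N \<subseteq> Mt"
  obtains p where "p \<in> commutant N \<inter> Mt" "adj p = p" "norm p \<le> 1"
    "\<forall>w\<in>intertwiners t N. p o\<^sub>L w = 0"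
    "\<forall>y::'h operator. (\<forall>w\<in>intertwiners t N. y o\<^sub>L w = 0) \<longrightarrow> y o\<^sub>L p = y"
proof -
  interpret N: von_neumann N by (rule N(1))
  define G where "G = {blinfun_apply w x | w x. w \<in> intertwiners t N}"
  have inG: "blinfun_apply w x \<in> G" if "w \<in> intertwiners t N" for w x using that by (auto simp: G_def)
  have invariant: "b x \<in> G" if b: "\<And>w. w \<in> intertwiners t N \<Longrightarrow> \<exists>d. b o\<^sub>L w = w o\<^sub>L d" and x: "x \<in> G"
    for b :: "'h operator" and x
  proof -
    from x obtain w z where w: "w \<in> intertwiners t N" "x = w z" by (auto simp: G_def)
    then obtain d where "b o\<^sub>L w = w o\<^sub>L d" using b by blast
    then have "b x = w (d z)" unfolding w(2) by (metis blinfun_apply_blinfun_compose)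
    then show ?thesis using inG[OF w(1)] by simp
  qed
  have scalars: "\<forall>x\<in>G. \<forall>c. c *\<^sub>C x \<in> G"
    using complex_operatorsD[OF complex[OF intertwinersD(1)]] inG by (auto simp: G_def) (metis)
  obtain p :: "'h operator" where p: "p \<in> complex_operators" "adj p = p" "p o\<^sub>L p = p" "\<forall>x\<in>G. p x = 0"
    "\<forall>y::'h operator. (\<forall>x\<in>G. blinfun_apply y x = 0) \<longrightarrow> y o\<^sub>L p = y"
    "\<forall>c\<in>complex_operators. (\<forall>x\<in>G. blinfun_apply c x \<in> G \<and> adj c x \<in> G) \<longrightarrow> c o\<^sub>L p = p o\<^sub>L c"
    by (rule complement_projection[OF scalars]) (rule that)
  have commuting: "c o\<^sub>L w = w o\<^sub>L c" if "c \<in> commutant Mt" "w \<in> intertwiners t N" for c w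
    using commutantD[OF that(1) intertwinersD(1)[OF that(2)]] by simp
  have pM: "p \<in> Mt"
  proof (rule bicommutant_memI[OF p(1)])
    fix c assume c: "c \<in> commutant Mt"
    then show "c o\<^sub>L p = p o\<^sub>L c"
      using p(6) invariant[of c] invariant[of "adj c"] commuting commutant_adj commutant_complex
      by metis
  qed
  have "n o\<^sub>L p = p o\<^sub>L n" if n: "n \<in> N" for n
  proof -
    have "n \<in> complex_operators" using n N.complex by blast
    moreover have "\<forall>x\<in>G. n x \<in> G \<and> adj n x \<in> G"
      using invariant[of n] invariant[of "adj n"] intertwinersD(2)[of _ t N] n N.adj_mem by metis
    ultimately show ?thesis using p(6) by blast
  qed
  then have "p \<in> commutant N \<inter> Mt" using p(1) pM by (simp add: commutant_def)
  moreover have "norm p \<le> 1" by (rule projection_norm_le_1[OF p(1-3)])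
  moreover have "\<forall>w\<in>intertwiners t N. p o\<^sub>L w = 0"
    using p(4) inG by (auto intro!: blinfun_eqI)
  moreover have "\<forall>y::'h operator. (\<forall>w\<in>intertwiners t N. y o\<^sub>L w = 0) \<longrightarrow> y o\<^sub>L p = y"
  proof (intro allI impI)
    fix y :: "'h operator" assume y: "\<forall>w\<in>intertwiners t N. y o\<^sub>L w = 0"
    have "y (w x) = 0" if "w \<in> intertwiners t N" for w x
      using y that by (metis blinfun_apply_blinfun_compose zero_blinfun.rep_eq)
    then have "\<forall>x\<in>G. y x = 0" by (auto simp: G_def)
    then show "y o\<^sub>L p = y" using p(5) by blast
  qed
  ultimately show thesis using p(2) by (intro that)
qed

text \<open>
  Rigidity of \<open>N\<close> concerns small times, fullness all times. They are linked by doubling: the complement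
  \<open>P t\<close> of the ranges can only grow when the time is halved, and it is small at small times.
\<close>

lemma intertwiners_full:
  fixes y :: "'h operator"
  assumes N: "von_neumann N" "N \<subseteq> M" and relative: "commutant N \<inter> Mt \<subseteq> M"
    and rigid: "((\<lambda>t. eps \<tau> \<alpha> t N) \<longlongrightarrow> 0) (at 0)"
    and y: "\<forall>w\<in>intertwiners t N. y o\<^sub>L w = 0"
  shows "y = 0"
proof -
  have NMt: "N \<subseteq> Mt" using N(2) M_Mt by blast
  define R where "R t p \<longleftrightarrow> p \<in> commutant N \<inter> Mt \<and> adj p = p \<and> norm p \<le> 1 \<and>
    (\<forall>w\<in>intertwiners t N. p o\<^sub>L w = 0) \<and>
    (\<forall>y::'h operator. (\<forall>w\<in>intertwiners t N. y o\<^sub>L w = 0) \<longrightarrow> y o\<^sub>L p = y)" for t p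
  have "\<exists>p. R t p" for t
    unfolding R_def by (rule intertwiners_complement[OF N(1) NMt, of t]) (intro exI conjI)
  then obtain P where "\<And>t. R t (P t)" by metis
  then have P1: "P t \<in> commutant N \<inter> Mt" and P_adj: "adj (P t) = P t" and P2: "norm (P t) \<le> 1"
    and P3: "w \<in> intertwiners t N \<Longrightarrow> P t o\<^sub>L w = 0"
    and P4: "(\<And>w. w \<in> intertwiners t N \<Longrightarrow> y o\<^sub>L w = 0) \<Longrightarrow> y o\<^sub>L P t = y" for t w and y :: "'h operator"
    unfolding R_def by simp_all
  have PM: "P t \<in> Mt" "\<beta> (P t) = P t" for t
    using P1 relative \<beta>_fixes by auto
  \<comment> \<open>the reflection carries the left annihilator \<open>P t\<close>, which \<open>\<beta>\<close> fixes, to the right\<close>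
  have right: "w o\<^sub>L \<alpha> t (P t) = 0" if w: "w \<in> intertwiners t N" for t w
  proof -
    have wM: "w \<in> Mt" by (rule intertwinersD(1)[OF w])
    have "P t o\<^sub>L \<alpha> t (\<beta> (adj w)) = 0" by (rule P3[OF intertwiners_reflection[OF N w]])
    then have "\<beta> (\<alpha> (- t) (P t o\<^sub>L \<alpha> t (\<beta> (adj w)))) = 0" by (simp add: \<alpha>.hom_0 \<beta>.hom_0)
    then have "\<alpha> t (P t) o\<^sub>L adj w = 0"
      using wM PM[of t] by (simp add: \<alpha>.hom_compose \<beta>.hom_compose \<alpha>_inverse \<beta>_involution \<beta>_\<alpha>)
    then have "adj (\<alpha> t (P t) o\<^sub>L adj w) = adj 0" by simp
    then show ?thesis using wM PM[of t] adj_scalar_mem[of 0 0]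
      by (simp add: adj_compose_mem P_adj scalar_op_0 flip: \<alpha>.hom_adj)
  qed
  have halve: "norm2 \<tau> (P (s + s)) \<le> norm2 \<tau> (P s)" for s
  proof -
    have "P (s + s) o\<^sub>L w = 0" if w: "w \<in> intertwiners s N" for w
    proof -
      have wM: "w \<in> Mt" by (rule intertwinersD(1)[OF w])
      define y where "y = \<alpha> (- s) (P (s + s) o\<^sub>L w)"
      have yM: "y \<in> Mt" using wM PM by (simp add: y_def)
      \<comment> \<open>this is \<open>P (2s) w \<alpha>\<^sub>s(z) = 0\<close>, transported by \<open>\<alpha>\<^sub>-\<^sub>s\<close>\<close>
      have "y o\<^sub>L z = 0" if z: "z \<in> intertwiners s N" for z
      proof -
        have zM: "z \<in> Mt" by (rule intertwinersD(1)[OF z])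
        have "P (s + s) o\<^sub>L (w o\<^sub>L \<alpha> s z) = 0"
          by (rule P3[OF intertwiners_compose[OF NMt w z]])
        then have "\<alpha> (- s) ((P (s + s) o\<^sub>L w) o\<^sub>L \<alpha> s z) = 0" by (simp add: compose_assoc \<alpha>.hom_0)
        moreover have "\<alpha> (- s) ((P (s + s) o\<^sub>L w) o\<^sub>L \<alpha> s z) = y o\<^sub>L z"
          using PM wM zM \<alpha>.hom_compose[of "P (s + s) o\<^sub>L w" "\<alpha> s z" "- s"]
          by (simp add: y_def \<alpha>_inverse)
        ultimately show ?thesis by simp
      qed
      then have "y o\<^sub>L P s = y" by (rule P4)
      then have "\<alpha> s y = \<alpha> s y o\<^sub>L \<alpha> s (P s)"
        using yM PM \<alpha>.hom_compose by metis
      moreover have "\<alpha> s y = P (s + s) o\<^sub>L w" using PM wM by (simp add: y_def \<alpha>_inverse)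
      ultimately show ?thesis using right[OF w] by (simp add: compose_assoc)
    qed
    then have "P (s + s) o\<^sub>L P s = P (s + s)" by (rule P4)
    then show ?thesis using norm2_compose_contraction[of "P (s + s)" "P s"] P2 PM by simp
  qed
  have small: "norm2 \<tau> (P s) \<le> eps \<tau> \<alpha> s N" for s
  proof -
    obtain v where v: "v \<in> Mt" "\<And>n. n \<in> N \<Longrightarrow> v o\<^sub>L \<alpha> s n = n o\<^sub>L v"
      "norm2 \<tau> (v - id_blinfun) \<le> eps \<tau> \<alpha> s N"
      using \<alpha>.intertwiner_near_id[OF N(1) NMt le_eps[OF NMt]] by metis
    then have "P s o\<^sub>L v = 0" by (intro P3) (simp add: intertwiners_def)
    \<comment> \<open>\<open>P s\<close> annihilates an intertwiner that is close to the identity\<close>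
    then have "P s o\<^sub>L (v - id_blinfun) = - P s" by (simp add: compose_diff_right)
    then have "norm2 \<tau> (P s) = norm2 \<tau> (P s o\<^sub>L (v - id_blinfun))" using PM by simp
    also have "\<dots> \<le> norm2 \<tau> (v - id_blinfun)"
      using P2 PM v(1) by (intro norm2_compose_contraction) auto
    finally show ?thesis using v(3) by simp
  qed
  have "P t = 0"
  proof (cases "t = 0")
    case True
    have "id_blinfun \<in> intertwiners 0 N"
      using NMt \<alpha>_0 by (auto simp: intertwiners_def)
    then show ?thesis using P3[of id_blinfun 0] True by simp
  next
    case False
    have "norm2 \<tau> (P t) \<le> norm2 \<tau> (P (t / 2 ^ k))" for k
    proof (induction k)
      case (Suc k)
      have "t / 2 ^ k = t / 2 ^ Suc k + t / 2 ^ Suc k" by (simp add: field_simps)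
      then show ?case using Suc halve[of "t / 2 ^ Suc k"] by simp
    qed simp
    then have "norm2 \<tau> (P t) \<le> eps \<tau> \<alpha> (t / 2 ^ k) N" for k using small order_trans by blast
    moreover have "(\<lambda>k. eps \<tau> \<alpha> (t / 2 ^ k) N) \<longlonglongrightarrow> 0"
    proof (rule filterlim_compose[OF rigid])
      have "(\<lambda>k. t * (1 / 2) ^ k) \<longlonglongrightarrow> t * 0" by (intro tendsto_mult tendsto_const LIMSEQ_power_zero) simp
      then have "(\<lambda>k. t / 2 ^ k) \<longlonglongrightarrow> 0" by (simp add: power_divide)
      then show "filterlim (\<lambda>k. t / 2 ^ k) (at 0) sequentially"
        using False by (simp add: filterlim_at)
    qed
    ultimately have "norm2 \<tau> (P t) \<le> 0" by (intro LIMSEQ_le_const) auto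
    then show ?thesis using norm2_eq_0[OF PM(1)] norm2_nonneg[OF PM(1)] by (metis antisym)
  qed
  then show ?thesis using P4[of t y] y by simp
qed

text \<open>
  The reflection turns an annihilator of the adjoints of all intertwiners into a left annihilator of
  all intertwiners.
\<close>

lemma intertwiners_adj_dense:
  assumes N: "von_neumann N" "N \<subseteq> M" and relative: "commutant N \<inter> Mt \<subseteq> M"
    and rigid: "((\<lambda>t. eps \<tau> \<alpha> t N) \<longlongrightarrow> 0) (at 0)"
  shows "closure (span {blinfun_apply (adj w) x | w x. w \<in> intertwiners t N}) = UNIV"
    (is "closure (span ?G) = UNIV")
proof -
  have inG: "blinfun_apply (adj w) x \<in> ?G" if "w \<in> intertwiners t N" for w x using that by blast
  have invariant: "c x \<in> ?G" if c: "c \<in> commutant Mt" and x: "x \<in> ?G" for c x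
  proof -
    from x obtain w z where w: "w \<in> intertwiners t N" "x = adj w z" by auto
    have "adj w o\<^sub>L c = c o\<^sub>L adj w"
      using c intertwinersD(1)[OF w(1)] by (intro commutantD[OF c]) simp
    then have "c x = adj w (c z)" unfolding w(2) by (metis blinfun_apply_blinfun_compose)
    then show ?thesis using inG[OF w(1)] by simp
  qed
  have scalars: "\<forall>x\<in>?G. \<forall>c. c *\<^sub>C x \<in> ?G"
    using invariant[OF scalar_commutant] by (metis (no_types, lifting) scalar_op_apply)
  obtain q :: "'h operator" where q: "q \<in> complex_operators" "\<forall>x\<in>?G. q x = 0"
    "\<forall>c\<in>complex_operators. (\<forall>x\<in>?G. blinfun_apply c x \<in> ?G \<and> adj c x \<in> ?G) \<longrightarrow> c o\<^sub>L q = q o\<^sub>L c"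
    "q = 0 \<longrightarrow> closure (span ?G) = UNIV"
    by (rule complement_projection[OF scalars]) (rule that)
  have qM: "q \<in> Mt"
    by (intro bicommutant_memI q(1) q(3)[rule_format] conjI invariant commutant_adj commutant_complex)
  have "\<alpha> t (\<beta> q) o\<^sub>L w = 0" if w: "w \<in> intertwiners t N" for w
  proof -
    define z where "z = \<alpha> t (\<beta> (adj w))"
    have z: "z \<in> intertwiners t N" unfolding z_def by (rule intertwiners_reflection[OF N w])
    have zM: "z \<in> Mt" by (rule intertwinersD(1)[OF z])
    have "w = \<alpha> t (\<beta> (adj z))"
      unfolding z_def by (rule intertwiners_reflection_involution[OF intertwinersD(1)[OF w], symmetric])
    moreover have "q o\<^sub>L adj z = 0" using q(2) inG[OF z] by (intro blinfun_eqI) simp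
    then have "\<alpha> t (\<beta> (q o\<^sub>L adj z)) = 0" by (simp add: \<alpha>.hom_0 \<beta>.hom_0)
    ultimately show ?thesis using qM zM by (simp add: \<alpha>.hom_compose \<beta>.hom_compose)
  qed
  then have "\<alpha> t (\<beta> q) = 0" using intertwiners_full[OF assms] by blast
  then have "\<beta> q = 0" using \<alpha>.hom_inj[of "\<beta> q" 0 t] qM by (simp add: \<alpha>.hom_0)
  then have "q = 0" using \<beta>.hom_inj[of q 0] qM by (simp add: \<beta>.hom_0)
  then show ?thesis by (rule q(4)[rule_format])
qed

text \<open>
  As \<open>w z\<^sup>*\<close> lies in \<open>N' \<inter> Mt \<subseteq> M\<close>, it is fixed by \<open>\<beta>\<close>. This is the equality of the inner products
  of \<open>w\<^sup>* \<xi>\<close>, \<open>z\<^sup>* \<eta>\<close> and of \<open>\<beta>(w\<^sup>*) \<xi>\<close>, \<open>\<beta>(z\<^sup>*) \<eta>\<close>.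
\<close>

lemma transport_isometry:
  assumes N: "von_neumann N" "N \<subseteq> M" and relative: "commutant N \<inter> Mt \<subseteq> M"
    and dense: "closure (span {blinfun_apply (adj w) x | w x. w \<in> intertwiners t N}) = UNIV"
      (is "closure (span ?G) = UNIV")
  obtains Y where "Y \<in> Mt" "adj Y o\<^sub>L Y = id_blinfun"
    "\<And>w. w \<in> intertwiners t N \<Longrightarrow> Y o\<^sub>L adj w = \<beta> (adj w)"
proof -
  have NMt: "N \<subseteq> Mt" using N(2) M_Mt by blast
  define H where "H = {(blinfun_apply (adj w) x, blinfun_apply (\<beta> (adj w)) x) | w x. w \<in> intertwiners t N}"
  have fst_H: "fst ` H = ?G" by (force simp: H_def)
  have iso: "inner (fst g) (fst g') = inner (snd g) (snd g')" if "g \<in> H" "g' \<in> H" for g g'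
  proof -
    from that obtain w x w' x' where w: "w \<in> intertwiners t N" "w' \<in> intertwiners t N"
      and g: "g = (adj w x, \<beta> (adj w) x)" "g' = (adj w' x', \<beta> (adj w') x')"
      unfolding H_def by blast
    have wM: "w \<in> Mt" "w' \<in> Mt" using w intertwinersD(1) by blast+
    have "\<beta> (w o\<^sub>L adj w') = w o\<^sub>L adj w'"
      using intertwiners_compose_adj[OF N(1) NMt w] relative \<beta>_fixes by blast
    then have eq: "\<beta> w o\<^sub>L \<beta> (adj w') = w o\<^sub>L adj w'" using wM by (simp add: \<beta>.hom_compose)
    have "inner (\<beta> (adj w) x) (\<beta> (adj w') x') = inner x ((\<beta> w o\<^sub>L \<beta> (adj w')) x')"
      using wM by (simp add: \<beta>.hom_adj inner_adj complex)
    also have "\<dots> = inner (adj w x) (adj w' x')"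
      using wM by (simp add: eq inner_adj complex)
    finally show ?thesis by (simp add: g)
  qed
  obtain Y :: "'h operator" where Y: "\<And>g. g \<in> H \<Longrightarrow> blinfun_apply Y (fst g) = snd g"
    "\<And>a. norm (blinfun_apply Y a) = norm a"
    using isometry_extension[of H, OF iso dense[folded fst_H]] by blast
  have Yw: "Y o\<^sub>L adj w = \<beta> (adj w)" if "w \<in> intertwiners t N" for w
  proof (rule blinfun_eqI)
    fix x
    have "(adj w x, \<beta> (adj w) x) \<in> H" using that by (auto simp: H_def)
    from Y(1)[OF this] show "(Y o\<^sub>L adj w) x = \<beta> (adj w) x" by simp
  qed
  have comm: "c o\<^sub>L Y = Y o\<^sub>L c" if c: "c \<in> commutant Mt" for c
  proof (rule blinfun_eqI)
    fix x
    have "(c o\<^sub>L Y) z = (Y o\<^sub>L c) z" if z: "z \<in> ?G" for z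
    proof -
      from z obtain w y where w: "w \<in> intertwiners t N" "z = adj w y" by blast
      have wM: "w \<in> Mt" by (rule intertwinersD(1)[OF w(1)])
      have "c o\<^sub>L (Y o\<^sub>L adj w) = (Y o\<^sub>L adj w) o\<^sub>L c"
        unfolding Yw[OF w(1)] using wM by (intro commutantD[OF c, symmetric]) simp
      also have "\<dots> = Y o\<^sub>L (c o\<^sub>L adj w)"
        using commutantD[OF c, of "adj w"] wM by (simp add: compose_assoc)
      finally show ?thesis unfolding w(2) by (metis blinfun_apply_blinfun_compose)
    qed
    then show "(c o\<^sub>L Y) x = (Y o\<^sub>L c) x"
      by (rule bounded_linear_eq_closure_span[where G = "?G",
            OF blinfun.bounded_linear_right blinfun.bounded_linear_right])
        (simp_all only: dense UNIV_I)
  qed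
  have "Y (c *\<^sub>C x) = c *\<^sub>C Y x" for c x
    using comm[OF scalar_commutant, of c] by (metis blinfun_apply_blinfun_compose scalar_op_apply)
  then have YC: "Y \<in> complex_operators" by (simp add: complex_operators_def)
  then have YM: "Y \<in> Mt" using comm by (rule bicommutant_memI)
  have YY: "inner (Y x) (Y y) = inner x y" for x y
  proof -
    have "inner (Y (x + y)) (Y (x + y)) = inner (x + y) (x + y)" "inner (Y x) (Y x) = inner x x"
      "inner (Y y) (Y y) = inner y y"
      using Y(2) by (simp_all only: norm_eq_sqrt_inner real_sqrt_eq_iff)
    then show ?thesis by (simp add: blinfun.add_right inner_add_left inner_add_right inner_commute)
  qed
  have "inner ((adj Y o\<^sub>L Y) x) y = inner x y" for x y using YC by (simp add: inner_adj YY)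
  then have "adj Y o\<^sub>L Y = id_blinfun"
    by (intro blinfun_eqI) (metis blinfun_apply_id_blinfun id_apply vector_eq_rdot)
  then show thesis by (rule that[OF YM _ Yw])
qed

text \<open>
  The isometry \<open>Y\<close> conjugates \<open>\<alpha>\<^sub>t\<close> to \<open>\<alpha>\<^sub>-\<^sub>t\<close> on \<open>N\<close>, but its distance to the identity is controlled by \<open>Q\<close> alone,
  through \<open>\<beta>(v) Y = v\<close>. The constant \<open>4\<close> is \<open>2 \<cdot> 2\<close>: one factor from
  \<open>\<parallel>Y - 1\<parallel>\<^sub>2 \<le> 2 \<parallel>v - 1\<parallel>\<^sub>2\<close>, the other from the two terms of a commutator with \<open>Y - 1\<close>.
\<close>

theorem eps_double_le:
  assumes N: "von_neumann N" "N \<subseteq> M" and Q: "von_neumann Q" "Q \<subseteq> N"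
    and relative: "commutant Q \<inter> Mt \<subseteq> M"
    and rigid: "((\<lambda>t. eps \<tau> \<alpha> t N) \<longlongrightarrow> 0) (at 0)"
  shows "eps \<tau> \<alpha> (2 * t) N \<le> 4 * eps \<tau> \<alpha> t Q"
proof -
  have NMt: "N \<subseteq> Mt" and QMt: "Q \<subseteq> Mt" using N(2) Q(2) M_Mt by blast+
  have relative_N: "commutant N \<inter> Mt \<subseteq> M" using commutant_antimono[OF Q(2)] relative by blast
  define e where "e = eps \<tau> \<alpha> t Q"
  obtain v where vM: "v \<in> Mt" and vi: "\<And>n. n \<in> Q \<Longrightarrow> v o\<^sub>L \<alpha> t n = n o\<^sub>L v"
    and v1: "norm2 \<tau> (v - id_blinfun) \<le> e"
    using \<alpha>.intertwiner_near_id[OF Q(1) QMt le_eps[OF QMt]] unfolding e_def by metis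
  have v: "v \<in> intertwiners t Q" using vM vi by (simp add: intertwiners_def)
  have dense: "closure (span {blinfun_apply (adj w) x | w x. w \<in> intertwiners t N}) = UNIV"
    by (rule intertwiners_adj_dense[OF N relative_N rigid])
  obtain Y where YM: "Y \<in> Mt" and Yiso: "adj Y o\<^sub>L Y = id_blinfun"
    and Yw: "\<And>w. w \<in> intertwiners t N \<Longrightarrow> Y o\<^sub>L adj w = \<beta> (adj w)"
    by (rule transport_isometry[OF N relative_N dense]) (rule that)
  have cancel: "a = b" if "\<And>w. w \<in> intertwiners t N \<Longrightarrow> a o\<^sub>L adj w = b o\<^sub>L adj w"
    for a b :: "'h operator"
  proof (rule blinfun_eqI)
    fix x
    have "a z = b z" if "z \<in> {blinfun_apply (adj w) x | w x. w \<in> intertwiners t N}" for z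
      using that \<open>\<And>w. w \<in> intertwiners t N \<Longrightarrow> a o\<^sub>L adj w = b o\<^sub>L adj w\<close>
      by (auto simp flip: blinfun_apply_blinfun_compose)
    then show "a x = b x"
      by (rule bounded_linear_eq_closure_span[where G = "{blinfun_apply (adj w) x | w x. w \<in> intertwiners t N}",
            OF blinfun.bounded_linear_right blinfun.bounded_linear_right])
        (simp_all only: dense UNIV_I)
  qed
  have vY: "\<beta> v o\<^sub>L Y = v"
  proof (rule cancel)
    fix w assume w: "w \<in> intertwiners t N"
    then have w': "w \<in> intertwiners t Q" using intertwiners_antimono[OF Q(2)] by blast
    have "\<beta> (v o\<^sub>L adj w) = v o\<^sub>L adj w"
      using intertwiners_compose_adj[OF Q(1) QMt v w'] relative \<beta>_fixes by blast
    then show "(\<beta> v o\<^sub>L Y) o\<^sub>L adj w = v o\<^sub>L adj w"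
      using vM intertwinersD(1)[OF w] by (simp add: compose_assoc Yw[OF w] \<beta>.hom_compose)
  qed
  have Y1: "norm2 \<tau> (Y - id_blinfun) \<le> 2 * e"
  proof -
    have "norm2 \<tau> ((id_blinfun - \<beta> v) o\<^sub>L Y) \<le> norm2 \<tau> (id_blinfun - \<beta> v)"
      using YM vM isometry_norm_le_1[OF complex[OF YM] Yiso]
      by (intro norm2_compose_contraction_right) auto
    also have "\<dots> = norm2 \<tau> (\<beta> (v - id_blinfun))"
      using vM by (simp add: \<beta>.hom_diff \<beta>.hom_id norm2_minus_commute)
    also have "\<dots> \<le> e" using v1 vM by (simp add: \<beta>.norm2_hom)
    finally have "norm2 \<tau> ((id_blinfun - \<beta> v) o\<^sub>L Y) \<le> e" .
    then have "norm2 \<tau> (((id_blinfun - \<beta> v) o\<^sub>L Y) + (v - id_blinfun)) \<le> 2 * e"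
      using norm2_triangle[of "(id_blinfun - \<beta> v) o\<^sub>L Y" "v - id_blinfun"] v1 vM YM by simp
    moreover have "Y - id_blinfun = ((id_blinfun - \<beta> v) o\<^sub>L Y) + (v - id_blinfun)"
      by (simp add: compose_diff_left vY)
    ultimately show ?thesis by metis
  qed
  have main: "norm2 \<tau> (\<alpha> (2 * t) n - n) \<le> 4 * e" if n: "n \<in> N" "norm n \<le> 1" for n
  proof -
    have nM: "n \<in> Mt" "\<beta> n = n" using n N NMt \<beta>_fixes by auto
    have Yn: "Y o\<^sub>L \<alpha> t n = \<alpha> (- t) n o\<^sub>L Y"
    proof (rule cancel)
      fix w assume w: "w \<in> intertwiners t N"
      have wM: "w \<in> Mt" by (rule intertwinersD(1)[OF w])
      have "(Y o\<^sub>L \<alpha> t n) o\<^sub>L adj w = (Y o\<^sub>L adj w) o\<^sub>L n"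
        by (simp add: compose_assoc intertwiners_adj[OF N(1) NMt w n(1)])
      also have "\<dots> = \<beta> (adj w o\<^sub>L n)" using wM nM by (simp add: Yw[OF w] \<beta>.hom_compose)
      also have "\<dots> = \<alpha> (- t) n o\<^sub>L \<beta> (adj w)"
        using wM nM by (simp add: intertwiners_adj[OF N(1) NMt w n(1)] \<beta>.hom_compose \<beta>_\<alpha>)
      finally show "(Y o\<^sub>L \<alpha> t n) o\<^sub>L adj w = (\<alpha> (- t) n o\<^sub>L Y) o\<^sub>L adj w"
        by (simp add: compose_assoc Yw[OF w])
    qed
    \<comment> \<open>\<open>\<alpha>\<^sub>t\<close> moves \<open>m\<close> back to the contraction \<open>n\<close>, so products with \<open>m\<close> can be estimated in trace norm\<close>
    define m where "m = \<alpha> (- t) n"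
    define d where "d = Y - id_blinfun"
    have mM: "m \<in> Mt" and dM: "d \<in> Mt" using nM YM by (simp_all add: m_def d_def)
    have \<alpha>d: "norm2 \<tau> (\<alpha> t d) \<le> 2 * e" using Y1 dM by (simp add: \<alpha>.norm2_hom d_def)
    have "norm2 \<tau> (m o\<^sub>L d) = norm2 \<tau> (\<alpha> t (m o\<^sub>L d))"
      using mM dM by (simp add: \<alpha>.norm2_hom)
    also have "\<dots> = norm2 \<tau> (n o\<^sub>L \<alpha> t d)"
      using mM dM nM by (simp add: \<alpha>.hom_compose) (simp add: m_def \<alpha>_inverse)
    also have "\<dots> \<le> 2 * e"
      using norm2_compose_contraction[of n "\<alpha> t d"] nM n(2) dM \<alpha>d by simp
    finally have md: "norm2 \<tau> (m o\<^sub>L d) \<le> 2 * e" .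
    have "norm2 \<tau> (d o\<^sub>L m) = norm2 \<tau> (\<alpha> t (d o\<^sub>L m))"
      using mM dM by (simp add: \<alpha>.norm2_hom)
    also have "\<dots> = norm2 \<tau> (\<alpha> t d o\<^sub>L n)"
      using mM dM nM by (simp add: \<alpha>.hom_compose) (simp add: m_def \<alpha>_inverse)
    also have "\<dots> \<le> 2 * e"
      using norm2_compose_contraction_right[of n "\<alpha> t d"] nM n(2) dM \<alpha>d by simp
    finally have dm: "norm2 \<tau> (d o\<^sub>L m) \<le> 2 * e" .
    have "\<alpha> (2 * t) n = \<alpha> t (\<alpha> t n)" using \<alpha>_add[of n t t] nM by simp
    then have "\<alpha> (2 * t) n - n = \<alpha> t (\<alpha> t n - m)"
      using nM mM by (simp add: \<alpha>.hom_diff) (simp add: m_def \<alpha>_inverse)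
    then have "norm2 \<tau> (\<alpha> (2 * t) n - n) = norm2 \<tau> (\<alpha> t n - m)"
      using nM mM by (simp add: \<alpha>.norm2_hom)
    also have "\<dots> = norm2 \<tau> (Y o\<^sub>L (\<alpha> t n - m))"
      using nM mM YM Yiso by (simp add: norm2_isometry)
    also have "Y o\<^sub>L (\<alpha> t n - m) = (m o\<^sub>L d) - (d o\<^sub>L m)"
      by (simp add: compose_diff_right compose_diff_left Yn d_def m_def)
    also have "norm2 \<tau> \<dots> \<le> 4 * e"
      using norm2_diff_triangle[of "m o\<^sub>L d" "d o\<^sub>L m"] md dm mM dM by simp
    finally show ?thesis .
  qed
  have "0 \<in> N" using von_neumann.zero_mem[OF N(1)] .
  then show ?thesis
    unfolding eps_def[of \<tau> \<alpha> "2 * t" N] using main unfolding e_def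
    by (intro cSUP_least) auto
qed

end

theorem corollary1p4:
  fixes M Mt Q :: "'h::complex_hilbert operator set"
    and \<tau> :: "'h operator \<Rightarrow> complex"
    and \<alpha> :: "real \<Rightarrow> 'h operator \<Rightarrow> 'h operator"
    and \<beta> :: "'h operator \<Rightarrow> 'h operator"
    and t :: real
  assumes "tracial_von_neumann_algebra Mt \<tau>"
    and "von_neumann_subalgebra M Mt"
    and "s_malleable_deformation \<tau> M Mt \<alpha> \<beta>"
    and "Q \<in> Rig \<tau> M \<alpha>"
    and "commutant Q \<inter> Mt \<subseteq> M"
  shows "1 / 24 * (SUP N\<in>{N \<in> Rig \<tau> M \<alpha>. Q \<subseteq> N}. eps \<tau> \<alpha> (4 * t) N) \<le> eps \<tau> \<alpha> (2 * t) Q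
    \<and> eps \<tau> \<alpha> (2 * t) Q
        \<le> 24 * (INF N\<in>{N. von_neumann_subalgebra N Q \<and> commutant N \<inter> Mt \<subseteq> M}. eps \<tau> \<alpha> t N)"
proof -
  interpret deformation Mt \<tau> M \<alpha> \<beta>
    using assms(1-3) by unfold_locales (auto simp: tracial_von_neumann_algebra_def)
  have vn: "von_neumann N" if "von_neumann_algebra N" for N :: "'h operator set"
    using that by unfold_locales
  have Q: "von_neumann Q" "Q \<subseteq> M" and Q_rigid: "((\<lambda>t. eps \<tau> \<alpha> t Q) \<longlongrightarrow> 0) (at 0)"
    and Q_vna: "von_neumann_algebra Q"
    using assms(4) by (auto simp: Rig_def von_neumann_subalgebra_def intro: vn)
  have MMt: "M \<subseteq> Mt" using M_Mt by blast
  have eps_Q: "0 \<le> eps \<tau> \<alpha> s Q" for s using eps_nonneg[OF Q(1)] Q(2) MMt by blast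
  have upper: "eps \<tau> \<alpha> (4 * t) N \<le> 24 * eps \<tau> \<alpha> (2 * t) Q" if "N \<in> Rig \<tau> M \<alpha>" "Q \<subseteq> N" for N
  proof -
    have "eps \<tau> \<alpha> (2 * (2 * t)) N \<le> 4 * eps \<tau> \<alpha> (2 * t) Q"
      using that Q(1) assms(5) by (intro eps_double_le) (auto simp: Rig_def von_neumann_subalgebra_def intro: vn)
    then show ?thesis using eps_Q[of "2 * t"] by simp
  qed
  have "(SUP N\<in>{N \<in> Rig \<tau> M \<alpha>. Q \<subseteq> N}. eps \<tau> \<alpha> (4 * t) N) \<le> 24 * eps \<tau> \<alpha> (2 * t) Q"
    using assms(4) upper by (intro cSUP_least) auto
  moreover have lower: "eps \<tau> \<alpha> (2 * t) Q / 24 \<le> eps \<tau> \<alpha> t N"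
    if "von_neumann_subalgebra N Q" "commutant N \<inter> Mt \<subseteq> M" for N
  proof -
    have N: "von_neumann N" "N \<subseteq> Q" using that(1) by (auto simp: von_neumann_subalgebra_def intro: vn)
    have "eps \<tau> \<alpha> (2 * t) Q \<le> 4 * eps \<tau> \<alpha> t N"
      by (rule eps_double_le[OF Q N that(2) Q_rigid])
    moreover have "0 \<le> eps \<tau> \<alpha> t N" using eps_nonneg[OF N(1)] N(2) Q(2) MMt by blast
    ultimately show ?thesis by simp
  qed
  have "eps \<tau> \<alpha> (2 * t) Q / 24
      \<le> (INF N\<in>{N. von_neumann_subalgebra N Q \<and> commutant N \<inter> Mt \<subseteq> M}. eps \<tau> \<alpha> t N)"
    using assms(5) Q_vna lower by (intro cINF_greatest) (auto simp: von_neumann_subalgebra_def)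
  ultimately show ?thesis by simp
qed

end
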